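(* The dynamical $R$-matrices $h_i(\beta)$ satisfy the following identities in $\mathcal{Q}_{W^{\mathsf d}}$, for all weights $x,y\in X^*(T)$ and all simple indices $i\neq j$: (Unitarity) $h_i(x)h_i(-x)=1$. (Yang–Baxter equations) - if $s_is_j$ has order $2$: $h_i(x)h_j(y)=h_j(y)h_i(x)$; - if $s_is_j$ has order $3$: $h_i(x)h_j(x+y)h_i(y)=h_j(y)h_i(x+y)h_j(x)$; - if $s_is_j$ has order $4$, with $\alpha_i$ long and $\alpha_j$ short: $h_i(x)h_j(x+y)h_i(x+2y)h_j(y)=h_j(y)h_i(x+2y)h_j(x+y)h_i(x)$; - if $s_is_j$ has order $6$, with $\alpha_i$ long and $\alpha_j$ short: $h_i(x)h_j(x+y)h_i(2x+3y)h_j(x+2y)h_i(x+3y)h_j(y)=h_j(y)h_i(x+3y)h_j(x+2y)h_i(2x+3y)h_j(x+y)h_i(x)$.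
   Context: For a lattice $\Lambda$, $\mathbb{Q}[\Lambda]=\bigoplus_{\mu\in\Lambda}\mathbb{Q}\,e^{\pi i\mu}$ is the group algebra (formal symbols $e^{\pi i\mu}$). For $u\in\Lambda$, $\theta(u)=(e^{\pi iu}-e^{-\pi iu})\prod_{n>0}(1-q^ne^{2\pi iu})(1-q^ne^{-2\pi iu})\in\mathbb{Q}[\Lambda][[q]]$. Define $$\mathsf{P}(x,y)=\frac{\theta(x-y)\theta(\hbar)}{\theta(y+\hbar)\theta(x)},\qquad \mathsf{Q}(x,y)=\frac{\theta(x+\hbar)\theta(y)}{\theta(y+\hbar)\theta(x)}.$$ Let $G$ be a (connected, complex) reductive group with maximal torus $T$, simple roots $\alpha_i$, simple coroots $\alpha_i^\vee$, simple reflections $s_i$, Weyl group $W$. Let $\Lambda=X^*(T)\oplus X_*(T)\oplus\mathbb{Z}\hbar$ and $\mathcal{Q}=\operatorname{Frac}\mathbb{Q}[\Lambda][[q]]$. For $\alpha\in X^*(T)$ (resp. $\beta^\vee\in X_*(T)$) write $z_\alpha$ (resp. $\lambda_{\beta^\vee}$) for the corresponding element of $\Lambda$. $W$ acts on $\mathcal{Q}$ (dynamical action) by ${}^{v^{\mathsf d}}\lambda_{\beta^\vee}=\lambda_{v\beta^\vee}$, fixing all $z_\alpha$, $\hbar$ and $q$. $\mathcal{Q}_{W^{\mathsf d}}$ is the free left $\mathcal{Q}$-module with basis $\{\delta_v^{\mathsf d}:v\in W\}$ and product $a\,\delta_v^{\mathsf d}\cdot a'\,\delta_{v'}^{\mathsf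 d}=a\cdot{}^{v^{\mathsf d}}a'\,\delta_{vv'}^{\mathsf d}$. For a simple root $\alpha_i$ and a weight $\beta\in X^*(T)$, the dynamical $R$-matrix is $$h_i(\beta)=\mathsf{P}(\lambda_{\alpha_i^\vee},z_\beta)+\delta^{\mathsf d}_{s_i}\cdot\mathsf{Q}(\lambda_{\alpha_i^\vee},z_\beta)\in\mathcal{Q}_{W^{\mathsf d}}.$$ *)

theory Defs
  imports
    "HOL-Analysis.Infinite_Products"
    "HOL-Analysis.Product_Vector"
    "HOL-Library.Poly_Mapping"
    "HOL-Computational_Algebra.Formal_Power_Series"
    "HOL-Computational_Algebra.Fraction_Field"
    "HOL-Algebra.Bij"
    "HOL-Algebra.Generated_Groups"
    "HOL-Algebra.Multiplicative_Group"
begin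

section \<open>Lattices\<close>

definition (in ab_group_add) zsmul :: "int \<Rightarrow> 'a \<Rightarrow> 'a" where
  "zsmul n x = (\<Sum>k<nat n. x) - (\<Sum>k<nat (- n). x)"

notation zsmul (infixr "\<cdot>" 75)

class lattice_group = ab_group_add +
  assumes ex_Z_basis:
    "\<exists>B. finite B \<and> (\<forall>x. \<exists>!c::'a \<Rightarrow> int. (\<forall>b. b \<notin> B \<longrightarrow> c b = 0) \<and> (\<Sum>b\<in>B. zsmul (c b) b) = x)"

lemma zsmul_0_left [simp]: "0 \<cdot> x = 0"
  by (simp add: zsmul_def)

lemma zsmul_1_left [simp]: "1 \<cdot> x = x"
  by (simp add: zsmul_def)

lemma zsmul_of_nat_diff: "(int m - int n) \<cdot> x = (\<Sum>k<m. x) - (\<Sum>k<n. x)"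
proof -
  have split: "(\<Sum>k<a + b. x) = (\<Sum>k<a. x) + (\<Sum>k<b. x)" for a b :: nat
    by (induction b) (simp_all add: algebra_simps)
  show ?thesis
  proof (cases "n \<le> m")
    case True
    then obtain d where d: "m = n + d" using le_Suc_ex by blast
    show ?thesis unfolding zsmul_def d by (simp add: split)
  next
    case False
    then obtain d where d: "n = m + d" using le_Suc_ex nat_le_linear by blast
    show ?thesis unfolding zsmul_def d by (simp add: split)
  qed
qed

lemma zsmul_add_left: "(m + n) \<cdot> x = m \<cdot> x + n \<cdot> x"
proof -
  obtain a b where m: "m = int a - int b" by (rule int_diff_cases)
  obtain c d where n: "n = int c - int d" by (rule int_diff_cases)
  have split: "(\<Sum>k<a + b. x) = (\<Sum>k<a. x) + (\<Sum>k<b. x)" for a b :: nat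
    by (induction b) (simp_all add: algebra_simps)
  have "m + n = int (a + c) - int (b + d)" by (simp add: m n)
  then have "(m + n) \<cdot> x = (\<Sum>k<a + c. x) - (\<Sum>k<b + d. x)"
    by (simp only: zsmul_of_nat_diff)
  then show ?thesis unfolding m n zsmul_of_nat_diff by (simp add: split)
qed

lemma zsmul_0_right [simp]: "n \<cdot> 0 = 0"
  by (simp add: zsmul_def)

lemma zsmul_hom:
  assumes "\<And>a b. f (a + b) = f a + f b"
  shows "f (n \<cdot> x) = n \<cdot> f x"
proof -
  have f0: "f 0 = 0" using assms[of 0 0] by simp
  have fm: "f (- a) = - f a" for a
    using assms[of a "- a"] f0 by (simp add: eq_neg_iff_add_eq_0 add.commute)
  have fd: "f (a - b) = f a - f b" for a b
    using assms[of a "- b"] fm by simp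
  have fs: "f (\<Sum>k<m. x) = (\<Sum>k<m. f x)" for m :: nat
    by (induction m) (simp_all add: f0 assms)
  show ?thesis by (simp add: zsmul_def fd fs)
qed

lemma zsmul_int [simp]: "n \<cdot> (m :: int) = n * m"
  by (simp add: zsmul_def algebra_simps)

lemma zsmul_prod [simp]: "n \<cdot> (a, b) = (n \<cdot> a, n \<cdot> b)"
proof -
  have "fst (n \<cdot> (a, b)) = n \<cdot> a" by (subst zsmul_hom) simp_all
  moreover have "snd (n \<cdot> (a, b)) = n \<cdot> b" by (subst zsmul_hom) simp_all
  ultimately show ?thesis by (simp add: prod_eq_iff)
qed

instance int :: lattice_group
proof
  have "\<exists>!c::int \<Rightarrow> int. (\<forall>b. b \<notin> {1} \<longrightarrow> c b = 0) \<and> (\<Sum>b\<in>{1}. c b \<cdot> b) = x" for x :: int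
    by (rule ex1I[of _ "\<lambda>b. if b = 1 then x else 0"]) auto
  then show "\<exists>B. finite B \<and> (\<forall>x::int. \<exists>!c::int \<Rightarrow> int.
      (\<forall>b. b \<notin> B \<longrightarrow> c b = 0) \<and> (\<Sum>b\<in>B. c b \<cdot> b) = x)"
    by (intro exI[of _ "{1}"]) simp
qed

lemma ex1_unique: "\<exists>!x. P x \<Longrightarrow> P a \<Longrightarrow> P b \<Longrightarrow> a = b"
  by blast

instance prod :: (lattice_group, lattice_group) lattice_group
proof
  obtain A where A: "finite A"
    and A1: "\<And>x::'a. \<exists>!c::'a \<Rightarrow> int. (\<forall>b. b \<notin> A \<longrightarrow> c b = 0) \<and> (\<Sum>b\<in>A. c b \<cdot> b) = x"
    using ex_Z_basis[where 'a = 'a] by blast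
  obtain B where B: "finite B"
    and B1: "\<And>x::'b. \<exists>!c::'b \<Rightarrow> int. (\<forall>b. b \<notin> B \<longrightarrow> c b = 0) \<and> (\<Sum>b\<in>B. c b \<cdot> b) = x"
    using ex_Z_basis[where 'a = 'b] by blast
  have A0: "0 \<notin> A"
  proof
    assume z: "0 \<in> A"
    have "(\<lambda>a. if a = (0::'a) then 1 else 0 :: int) = (\<lambda>_. 0)"
      by (rule ex1_unique[OF A1[of 0]]) (use z in \<open>auto intro!: sum.neutral\<close>)
    then show False by (metis one_neq_zero)
  qed
  have B0: "0 \<notin> B"
  proof
    assume z: "0 \<in> B"
    have "(\<lambda>a. if a = (0::'b) then 1 else 0 :: int) = (\<lambda>_. 0)"
      by (rule ex1_unique[OF B1[of 0]]) (use z in \<open>auto intro!: sum.neutral\<close>)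
    then show False by (metis one_neq_zero)
  qed
  define C where "C = (\<lambda>a. (a, 0::'b)) ` A \<union> (\<lambda>b. (0::'a, b)) ` B"
  have disj: "(\<lambda>a. (a, 0::'b)) ` A \<inter> (\<lambda>b. (0::'a, b)) ` B = {}" using A0 by auto
  have sumC: "(\<Sum>p\<in>C. c p \<cdot> p) = (\<Sum>a\<in>A. c (a, 0) \<cdot> a, \<Sum>b\<in>B. c (0, b) \<cdot> b)" for c :: "'a \<times> 'b \<Rightarrow> int"
  proof -
    have s1: "(\<Sum>a\<in>A. (f a, 0)) = ((\<Sum>a\<in>A. f a), 0::'b)" for f :: "'a \<Rightarrow> 'a"
      using A by (induction A) (simp_all add: zero_prod_def)
    have s2: "(\<Sum>b\<in>B. (0, g b)) = (0::'a, (\<Sum>b\<in>B. g b))" for g :: "'b \<Rightarrow> 'b"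
      using B by (induction B) (simp_all add: zero_prod_def)
    have "(\<Sum>p\<in>C. c p \<cdot> p) = (\<Sum>a\<in>A. c (a, 0) \<cdot> (a, 0)) + (\<Sum>b\<in>B. c (0, b) \<cdot> (0, b))"
      unfolding C_def using A B disj
      by (subst sum.union_disjoint) (simp_all add: sum.reindex inj_on_def)
    then show ?thesis by (simp add: s1 s2)
  qed
  have "\<exists>!c::'a \<times> 'b \<Rightarrow> int. (\<forall>p. p \<notin> C \<longrightarrow> c p = 0) \<and> (\<Sum>p\<in>C. c p \<cdot> p) = z" for z
  proof -
    obtain x y where z: "z = (x, y)" by (cases z)
    obtain c where c: "\<forall>b. b \<notin> A \<longrightarrow> c b = 0" "(\<Sum>b\<in>A. c b \<cdot> b) = x"
      using ex1_implies_ex[OF A1[of x]] by blast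
    obtain d where d: "\<forall>b. b \<notin> B \<longrightarrow> d b = 0" "(\<Sum>b\<in>B. d b \<cdot> b) = y"
      using ex1_implies_ex[OF B1[of y]] by blast
    define e where "e = (\<lambda>(a, b). if b = 0 then c a else if a = 0 then d b else 0)"
    have e1: "e (a, 0) = c a" for a by (simp add: e_def)
    have e2: "b \<in> B \<Longrightarrow> e (0, b) = d b" for b using B0 by (auto simp: e_def)
    show ?thesis
    proof (rule ex1I[of _ e], intro conjI allI impI)
      fix p assume "p \<notin> C"
      then show "e p = 0" using c(1) d(1) A0 unfolding C_def e_def
        by (cases p) auto
    next
      show "(\<Sum>p\<in>C. e p \<cdot> p) = z" by (simp add: sumC e1 e2 c(2) d(2) z)
    next
      fix f assume f: "(\<forall>p. p \<notin> C \<longrightarrow> f p = 0) \<and> (\<Sum>p\<in>C. f p \<cdot> p) = z"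
      have fx: "(\<Sum>a\<in>A. f (a, 0) \<cdot> a) = x" and fy: "(\<Sum>b\<in>B. f (0, b) \<cdot> b) = y"
        using f by (simp_all add: sumC z)
      have nA: "a \<notin> A \<Longrightarrow> f (a, 0) = 0" for a using f B0 by (auto simp: C_def)
      have nB: "b \<notin> B \<Longrightarrow> f (0, b) = 0" for b using f A0 by (auto simp: C_def)
      have fc: "(\<lambda>a. f (a, 0)) = c" by (rule ex1_unique[OF A1[of x]]) (use fx nA c in simp_all)
      have fd: "(\<lambda>b. f (0, b)) = d" by (rule ex1_unique[OF B1[of y]]) (use fy nB d in simp_all)
      show "f = e"
      proof
        fix p :: "'a \<times> 'b"
        obtain a b where p: "p = (a, b)" by (cases p)
        consider "b = 0" | "b \<noteq> 0" "a = 0" | "b \<noteq> 0" "a \<noteq> 0" by blast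
        then show "f p = e p"
        proof cases
          case 1 then show ?thesis using fun_cong[OF fc, of a] by (simp add: p e1)
        next
          case 2 then show ?thesis using fun_cong[OF fd, of b] by (simp add: p e_def)
        next
          case 3 then have "p \<notin> C" by (auto simp: p C_def)
          then show ?thesis using f 3 by (simp add: p e_def)
        qed
      qed
    qed
  qed
  moreover have "finite C" using A B by (simp add: C_def)
  ultimately show "\<exists>B. finite B \<and> (\<forall>x::'a \<times> 'b. \<exists>!c::'a \<times> 'b \<Rightarrow> int.
      (\<forall>b. b \<notin> B \<longrightarrow> c b = 0) \<and> (\<Sum>b\<in>B. c b \<cdot> b) = x)"
    by (intro exI[of _ C] conjI allI)
qed

lemma lattice_embedding:
  "\<exists>\<iota>::'a::lattice_group \<Rightarrow> (nat \<Rightarrow>\<^sub>0 int). inj \<iota> \<and> (\<forall>x y. \<iota> (x + y) = \<iota> x + \<iota> y)"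
proof -
  obtain B where B: "finite B"
    and B1: "\<And>x::'a. \<exists>!c::'a \<Rightarrow> int. (\<forall>b. b \<notin> B \<longrightarrow> c b = 0) \<and> (\<Sum>b\<in>B. c b \<cdot> b) = x"
    using ex_Z_basis[where 'a = 'a] by blast
  define P where "P = (\<lambda>x (c::'a \<Rightarrow> int). (\<forall>b. b \<notin> B \<longrightarrow> c b = 0) \<and> (\<Sum>b\<in>B. c b \<cdot> b) = x)"
  define C where "C x = (THE c. P x c)" for x
  have PC: "P x (C x)" for x unfolding C_def P_def by (rule theI'[OF B1])
  have Pu: "c = C x" if "P x c" for x c
    using that PC[of x] unfolding P_def by (rule ex1_unique[OF B1])
  obtain e :: "'a \<Rightarrow> nat" where e: "inj_on e B" using finite_imp_inj_to_nat_seg[OF B] by blast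
  have Cadd: "C (x + y) = (\<lambda>b. C x b + C y b)" for x y
    by (rule Pu[symmetric]) (use PC[of x] PC[of y] in \<open>auto simp: P_def zsmul_add_left sum.distrib\<close>)
  define \<iota> where "\<iota> x = (\<Sum>b\<in>B. Poly_Mapping.single (e b) (C x b))" for x
  have lk: "Poly_Mapping.lookup (\<iota> x) (e b) = C x b" if "b \<in> B" for x b
  proof -
    have "Poly_Mapping.lookup (\<iota> x) (e b) = (\<Sum>b'\<in>B. if b' = b then C x b' else 0)"
      unfolding \<iota>_def lookup_sum using that e
      by (intro sum.cong refl) (auto simp: lookup_single when_def inj_on_def)
    then show ?thesis using that B by simp
  qed
  have "inj \<iota>"
  proof (rule injI)
    fix x y assume "\<iota> x = \<iota> y"
    then have "\<forall>b\<in>B. C x b = C y b" using lk by metis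
    then have "(\<Sum>b\<in>B. C x b \<cdot> b) = (\<Sum>b\<in>B. C y b \<cdot> b)" by simp
    then show "x = y" using PC[of x] PC[of y] unfolding P_def by simp
  qed
  moreover have "\<iota> (x + y) = \<iota> x + \<iota> y" for x y
    by (simp add: \<iota>_def Cadd single_add sum.distrib)
  ultimately show ?thesis by (intro exI[of _ \<iota>] conjI allI)
qed


section \<open>The group algebra\<close>

definition push :: "('a \<Rightarrow> 'b) \<Rightarrow> ('a \<Rightarrow>\<^sub>0 'c) \<Rightarrow> ('b \<Rightarrow>\<^sub>0 'c::comm_monoid_add)" where
  "push \<phi> p = (\<Sum>k\<in>Poly_Mapping.keys p. Poly_Mapping.single (\<phi> k) (Poly_Mapping.lookup p k))"

lemma push_superset:
  assumes "finite A" "Poly_Mapping.keys p \<subseteq> A"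
  shows "push \<phi> p = (\<Sum>k\<in>A. Poly_Mapping.single (\<phi> k) (Poly_Mapping.lookup p k))"
  unfolding push_def using assms by (intro sum.mono_neutral_left) (auto simp: in_keys_iff)

lemma push_add: "push \<phi> (p + q) = push \<phi> p + push \<phi> q"
proof -
  let ?A = "Poly_Mapping.keys p \<union> Poly_Mapping.keys q"
  have "push \<phi> (p + q) = (\<Sum>k\<in>?A. Poly_Mapping.single (\<phi> k) (Poly_Mapping.lookup (p + q) k))"
    by (rule push_superset) (auto simp: in_keys_iff lookup_add)
  also have "\<dots> = push \<phi> p + push \<phi> q"
    by (simp add: push_superset[of ?A p] push_superset[of ?A q] lookup_add single_add sum.distrib)
  finally show ?thesis .
qed

lemma push_zero [simp]: "push \<phi> 0 = 0" by (simp add: push_def)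

lemma push_single [simp]: "push \<phi> (Poly_Mapping.single k c) = Poly_Mapping.single (\<phi> k) c"
  by (cases "c = 0") (simp_all add: push_def)

lemma push_sum: "push \<phi> (\<Sum>i\<in>I. f i) = (\<Sum>i\<in>I. push \<phi> (f i))"
  by (induction I rule: infinite_finite_induct) (simp_all add: push_add)

lemma sum_singles: "(\<Sum>k\<in>Poly_Mapping.keys p. Poly_Mapping.single k (Poly_Mapping.lookup p k)) = p"
  by (rule poly_mapping_eqI)
    (auto simp: lookup_sum lookup_single when_def in_keys_iff sum.delta' cong: if_cong)

lemma push_mult:
  fixes p q :: "'a::monoid_add \<Rightarrow>\<^sub>0 'c::semiring_0"
  assumes "\<And>x y. \<phi> (x + y) = \<phi> x + \<phi> y"
  shows "push \<phi> (p * q) = push \<phi> p * push \<phi> (q::'a \<Rightarrow>\<^sub>0 'c)"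
proof -
  have "push \<phi> (p * q) = push \<phi> ((\<Sum>k\<in>Poly_Mapping.keys p. Poly_Mapping.single k (Poly_Mapping.lookup p k))
      * (\<Sum>k\<in>Poly_Mapping.keys q. Poly_Mapping.single k (Poly_Mapping.lookup q k)))"
    by (simp only: sum_singles)
  also have "\<dots> = push \<phi> p * push \<phi> q"
    by (simp add: sum_product push_sum mult_single assms) (simp add: push_def sum_product mult_single)
  finally show ?thesis .
qed

lemma lookup_push_inj:
  assumes "inj \<phi>" shows "Poly_Mapping.lookup (push \<phi> p) (\<phi> x) = Poly_Mapping.lookup p x"
proof -
  have "Poly_Mapping.lookup (push \<phi> p) (\<phi> x)
      = (\<Sum>k\<in>Poly_Mapping.keys p. if k = x then Poly_Mapping.lookup p k else 0)"
    unfolding push_def lookup_sum using assms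
    by (intro sum.cong refl) (auto simp: lookup_single when_def inj_def)
  then show ?thesis by (simp add: in_keys_iff sum.delta')
qed

lemma push_inj: "inj \<phi> \<Longrightarrow> inj (push \<phi>)"
  by (intro injI poly_mapping_eqI) (metis lookup_push_inj)

lemma push_comp: "push \<phi> (push \<psi> p) = push (\<phi> \<circ> \<psi>) p"
  by (simp add: push_def[of \<psi>] push_sum) (simp add: push_def)

lemma push_id: "push (\<lambda>x. x) p = p"
  by (simp add: push_def sum_singles)

text \<open>
  A copy of \<open>'a \<Rightarrow>\<^sub>0 rat\<close> with its convolution product. The library makes \<open>'a \<Rightarrow>\<^sub>0 rat\<close> an
  integral domain only for linearly ordered exponents; the copy is one for every lattice.
\<close>

typedef 'a group_alg = "UNIV :: ('a \<Rightarrow>\<^sub>0 rat) set" ..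

setup_lifting type_definition_group_alg

instantiation group_alg :: (ab_group_add) comm_ring_1
begin
lift_definition zero_group_alg :: "'a group_alg" is 0 .
lift_definition one_group_alg :: "'a group_alg" is 1 .
lift_definition plus_group_alg :: "'a group_alg \<Rightarrow> 'a group_alg \<Rightarrow> 'a group_alg" is "(+)" .
lift_definition minus_group_alg :: "'a group_alg \<Rightarrow> 'a group_alg \<Rightarrow> 'a group_alg" is "(-)" .
lift_definition uminus_group_alg :: "'a group_alg \<Rightarrow> 'a group_alg" is uminus .
lift_definition times_group_alg :: "'a group_alg \<Rightarrow> 'a group_alg \<Rightarrow> 'a group_alg" is "(*)" .
instance by standard (transfer; simp add: algebra_simps)+
end

instance group_alg :: (lattice_group) idom
proof
  fix a b :: "'a group_alg"
  assume "a \<noteq> 0" "b \<noteq> 0"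
  then show "a * b \<noteq> 0"
  proof transfer
    fix p q :: "'a \<Rightarrow>\<^sub>0 rat"
    assume nz: "p \<noteq> 0" "q \<noteq> 0"
    obtain \<iota> :: "'a \<Rightarrow> (nat \<Rightarrow>\<^sub>0 int)" where \<iota>: "inj \<iota>" "\<And>x y. \<iota> (x + y) = \<iota> x + \<iota> y"
      using lattice_embedding by blast
    have "push \<iota> p \<noteq> 0" "push \<iota> q \<noteq> 0"
      using nz push_inj[OF \<iota>(1)] push_zero[of \<iota>] by (metis injD)+
    then have "push \<iota> (p * q) \<noteq> 0" by (simp add: push_mult \<iota>(2))
    then show "p * q \<noteq> 0" by auto
  qed
qed

text \<open>The basis vector written \<open>e\<^sup>\<pi>\<^sup>i\<^sup>u\<close>; thus \<open>e\<^sup>2\<^sup>\<pi>\<^sup>i\<^sup>u\<close> is \<open>expo (u + u)\<close>.\<close>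

lift_definition expo :: "'a \<Rightarrow> 'a group_alg" is "\<lambda>u. Poly_Mapping.single u 1" .

lift_definition ga_map :: "('a \<Rightarrow> 'b) \<Rightarrow> 'a group_alg \<Rightarrow> 'b group_alg" is push .


section \<open>Theta function\<close>

text \<open>The infinite product is taken in the \<open>q\<close>-adic topology of the library, with \<open>q = fps_X\<close>.\<close>

definition theta :: "'l::lattice_group \<Rightarrow> 'l group_alg fps" where
  "theta u = fps_const (expo u - expo (- u)) *
     prodinf (\<lambda>n. (1 - fps_X ^ Suc n * fps_const (expo (u + u))) *
                  (1 - fps_X ^ Suc n * fps_const (expo (- (u + u)))))"

section \<open>The field of fractions and the functions P and Q\<close>

text \<open>\<open>\<Lambda> = X \<oplus> Y \<oplus> \<int>\<hbar>\<close> is \<open>'x \<times> 'y \<times> int\<close>.\<close>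

type_synonym ('x, 'y) dynfield = "('x \<times> 'y \<times> int) group_alg fps fract"

definition zvar :: "'x \<Rightarrow> 'x::lattice_group \<times> 'y::lattice_group \<times> int" where
  "zvar \<beta> = (\<beta>, 0, 0)"

definition lamvar :: "'y \<Rightarrow> 'x::lattice_group \<times> 'y::lattice_group \<times> int" where
  "lamvar \<gamma> = (0, \<gamma>, 0)"

definition hbar :: "'x::lattice_group \<times> 'y::lattice_group \<times> int" where
  "hbar = (0, 0, 1)"

definition funP :: "'x::lattice_group \<times> 'y::lattice_group \<times> int \<Rightarrow> 'x \<times> 'y \<times> int \<Rightarrow> ('x, 'y) dynfield" where
  "funP x y = Fract (theta (x - y) * theta hbar) (theta (y + hbar) * theta x)"

definition funQ :: "'x::lattice_group \<times> 'y::lattice_group \<times> int \<Rightarrow> 'x \<times> 'y \<times> int \<Rightarrow> ('x, 'y) dynfield" where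
  "funQ x y = Fract (theta (x + hbar) * theta y) (theta (y + hbar) * theta x)"

text \<open>Functoriality of fractions, meaningful for injective ring homomorphisms \<open>f\<close>.\<close>

definition fract_map :: "('a \<Rightarrow> 'b) \<Rightarrow> 'a::idom fract \<Rightarrow> 'b::idom fract" where
  "fract_map f x = (THE y. \<exists>a b. b \<noteq> 0 \<and> x = Fract a b \<and> y = Fract (f a) (f b))"

definition fps_map :: "('a \<Rightarrow> 'b) \<Rightarrow> 'a fps \<Rightarrow> 'b fps" where
  "fps_map f a = Abs_fps (\<lambda>n. f (fps_nth a n))"

definition dyn_fps :: "('y \<Rightarrow> 'y) \<Rightarrow> ('x \<times> 'y \<times> int) group_alg fps \<Rightarrow> ('x \<times> 'y \<times> int) group_alg fps" where
  "dyn_fps v = fps_map (ga_map (\<lambda>(x, y, n). (x, v y, n)))"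

definition dyn :: "('y \<Rightarrow> 'y) \<Rightarrow> ('x::lattice_group, 'y::lattice_group) dynfield \<Rightarrow> ('x, 'y) dynfield" where
  "dyn v = fract_map (dyn_fps v)"

lemma fract_map_Fract:
  assumes mult: "\<And>a b. f (a * b) = f a * f b" and nz: "\<And>a. a \<noteq> 0 \<Longrightarrow> f a \<noteq> 0" and "b \<noteq> 0"
  shows "fract_map f (Fract a b) = Fract (f a) (f b)"
  unfolding fract_map_def
proof (rule the_equality)
  show "\<exists>a' b'. b' \<noteq> 0 \<and> Fract a b = Fract a' b' \<and> Fract (f a) (f b) = Fract (f a') (f b')"
    using assms(3) by blast
next
  fix y assume "\<exists>a' b'. b' \<noteq> 0 \<and> Fract a b = Fract a' b' \<and> y = Fract (f a') (f b')"
  then obtain a' b' where *: "b' \<noteq> 0" "Fract a b = Fract a' b'" "y = Fract (f a') (f b')" by blast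
  then have "f (a * b') = f (a' * b)" using assms(3) by (simp add: eq_fract)
  then show "y = Fract (f a) (f b)" using * nz assms(3) by (simp add: eq_fract mult)
qed


section \<open>Root data\<close>

text \<open>
  A connected complex reductive group with maximal torus and base enters only through its based
  root datum: \<open>'x = X\<^sup>*(T)\<close> and \<open>'y = X\<^sub>*(T)\<close> with their pairing, the roots, the map
  \<open>\<alpha> \<mapsto> \<alpha>\<^sup>\<or>\<close>, and the simple roots indexed by a set.
\<close>

record ('x, 'y, 'i) root_data =
  pairing :: "'x \<Rightarrow> 'y \<Rightarrow> int"
  roots :: "'x set"
  coroot :: "'x \<Rightarrow> 'y"
  index :: "'i set"
  simple_root :: "'i \<Rightarrow> 'x"

definition root_refl :: "('x::ab_group_add, 'y, 'i) root_data \<Rightarrow> 'x \<Rightarrow> 'x \<Rightarrow> 'x" where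
  "root_refl D \<alpha> x = x - pairing D x (coroot D \<alpha>) \<cdot> \<alpha>"

definition coroot_refl :: "('x, 'y::ab_group_add, 'i) root_data \<Rightarrow> 'x \<Rightarrow> 'y \<Rightarrow> 'y" where
  "coroot_refl D \<alpha> y = y - pairing D \<alpha> y \<cdot> coroot D \<alpha>"

locale based_root_datum =
  fixes D :: "('x::lattice_group, 'y::lattice_group, 'i) root_data"
  assumes pairing_add_left: "pairing D (x + x') y = pairing D x y + pairing D x' y"
    and pairing_add_right: "pairing D x (y + y') = pairing D x y + pairing D x y'"
    and perfect_left: "(\<And>y y'. f (y + y') = f y + f y') \<Longrightarrow> \<exists>!x. \<forall>y. pairing D x y = f y"
    and perfect_right: "(\<And>x x'. g (x + x') = g x + g x') \<Longrightarrow> \<exists>!y. \<forall>x. pairing D x y = g x"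
    and finite_roots: "finite (roots D)"
    and inj_coroot: "inj_on (coroot D) (roots D)"
    and pairing_root_coroot: "\<alpha> \<in> roots D \<Longrightarrow> pairing D \<alpha> (coroot D \<alpha>) = 2"
    and refl_roots: "\<alpha> \<in> roots D \<Longrightarrow> root_refl D \<alpha> ` roots D = roots D"
    and corefl_coroots: "\<alpha> \<in> roots D \<Longrightarrow> coroot_refl D \<alpha> ` coroot D ` roots D = coroot D ` roots D"
    and reduced: "\<alpha> \<in> roots D \<Longrightarrow> 2 \<cdot> \<alpha> \<notin> roots D"
    and finite_index: "finite (index D)"
    and simple_roots: "simple_root D ` index D \<subseteq> roots D"
    and simple_independent:
      "(\<Sum>i\<in>index D. c i \<cdot> simple_root D i) = 0 \<Longrightarrow> i \<in> index D \<Longrightarrow> c i = 0"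
    and simple_generate: "\<beta> \<in> roots D \<Longrightarrow>
      \<exists>c. (\<forall>i\<in>index D. c i \<ge> 0) \<and>
          (\<beta> = (\<Sum>i\<in>index D. c i \<cdot> simple_root D i) \<or> \<beta> = - (\<Sum>i\<in>index D. c i \<cdot> simple_root D i))"

text \<open>
  The Weyl group in its faithful action on \<open>X\<^sub>*(T)\<close>; an element \<open>v\<close> is the map
  \<open>\<beta>\<^sup>\<or> \<mapsto> v \<beta>\<^sup>\<or>\<close>, and the product is composition.
\<close>

definition weyl :: "('x, 'y::ab_group_add, 'i) root_data \<Rightarrow> ('y \<Rightarrow> 'y) monoid" where
  "weyl D = BijGroup UNIV \<lparr>carrier := generate (BijGroup UNIV) (coroot_refl D ` roots D)\<rparr>"

definition srefl :: "('x, 'y::ab_group_add, 'i) root_data \<Rightarrow> 'i \<Rightarrow> 'y \<Rightarrow> 'y" where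
  "srefl D i = coroot_refl D (simple_root D i)"

text \<open>
  Relative length with respect to a Weyl-invariant inner product on \<open>X\<^sup>*(T) \<otimes> \<rat>\<close>. For roots that
  are linked in the Dynkin diagram it does not depend on the choice of that inner product.
\<close>

definition invariant_form :: "('x::ab_group_add, 'y, 'i) root_data \<Rightarrow> ('x \<Rightarrow> 'x \<Rightarrow> rat) \<Rightarrow> bool" where
  "invariant_form D B \<longleftrightarrow>
     (\<forall>x x' y. B (x + x') y = B x y + B x' y) \<and> (\<forall>x y. B x y = B y x) \<and>
     (\<forall>x. x \<noteq> 0 \<longrightarrow> B x x > 0) \<and>
     (\<forall>\<alpha>\<in>roots D. \<forall>x y. B (root_refl D \<alpha> x) (root_refl D \<alpha> y) = B x y)"

definition longer :: "('x::ab_group_add, 'y, 'i) root_data \<Rightarrow> 'x \<Rightarrow> 'x \<Rightarrow> bool" where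
  "longer D \<alpha> \<beta> \<longleftrightarrow> (\<exists>B. invariant_form D B \<and> B \<alpha> \<alpha> > B \<beta> \<beta>)"


section \<open>The dynamical twisted group algebra and the R-matrices\<close>

text \<open>
  A finitely supported function \<open>f\<close> stands for \<open>\<Sum>\<^sub>v f(v) \<delta>\<^sub>v\<close>, with coefficients on the left.
\<close>

definition twisted_mult ::
  "(('y \<Rightarrow> 'y) \<Rightarrow>\<^sub>0 ('x::lattice_group, 'y::lattice_group) dynfield) \<Rightarrow>
   (('y \<Rightarrow> 'y) \<Rightarrow>\<^sub>0 ('x, 'y) dynfield) \<Rightarrow> (('y \<Rightarrow> 'y) \<Rightarrow>\<^sub>0 ('x, 'y) dynfield)" where
  "twisted_mult f g = (\<Sum>v\<in>Poly_Mapping.keys f. \<Sum>w\<in>Poly_Mapping.keys g.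
     Poly_Mapping.single (v \<circ> w) (Poly_Mapping.lookup f v * dyn v (Poly_Mapping.lookup g w)))"

definition QW :: "('x::lattice_group, 'y::lattice_group, 'i) root_data \<Rightarrow>
    (('y \<Rightarrow> 'y) \<Rightarrow>\<^sub>0 ('x, 'y) dynfield) ring" where
  "QW D = \<lparr>carrier = {f. Poly_Mapping.keys f \<subseteq> carrier (weyl D)},
           mult = twisted_mult, one = Poly_Mapping.single id 1, zero = 0, add = (+)\<rparr>"

definition scalar :: "('x, 'y) dynfield \<Rightarrow>
    (('y \<Rightarrow> 'y) \<Rightarrow>\<^sub>0 ('x::lattice_group, 'y::lattice_group) dynfield)" where
  "scalar a = Poly_Mapping.single id a"

definition delta :: "('y \<Rightarrow> 'y) \<Rightarrow>
    (('y \<Rightarrow> 'y) \<Rightarrow>\<^sub>0 ('x::lattice_group, 'y::lattice_group) dynfield)" where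
  "delta v = Poly_Mapping.single v 1"

definition Rmat :: "('x::lattice_group, 'y::lattice_group, 'i) root_data \<Rightarrow> 'i \<Rightarrow> 'x \<Rightarrow>
    (('y \<Rightarrow> 'y) \<Rightarrow>\<^sub>0 ('x, 'y) dynfield)" where
  "Rmat D i \<beta> =
     scalar (funP (lamvar (coroot D (simple_root D i))) (zvar \<beta>)) \<oplus>\<^bsub>QW D\<^esub>
     delta (srefl D i) \<otimes>\<^bsub>QW D\<^esub> scalar (funQ (lamvar (coroot D (simple_root D i))) (zvar \<beta>))"

section \<open>The twisted product makes the above a ring\<close>

definition add_bij :: "('y::ab_group_add \<Rightarrow> 'y) \<Rightarrow> bool" where
  "add_bij v \<longleftrightarrow> bij v \<and> (\<forall>x y. v (x + y) = v x + v y)"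

lemma ga_map_add: "ga_map f (a + b) = ga_map f a + ga_map f b"
  by transfer (rule push_add)

lemma ga_map_0 [simp]: "ga_map f 0 = 0"
  by transfer simp

lemma ga_map_mult:
  assumes "\<And>x y. f (x + y) = f x + f y"
  shows "ga_map f (a * b) = ga_map f a * ga_map f b"
  using assms by transfer (rule push_mult)

lemma ga_map_1:
  assumes "\<And>x y. f (x + y) = f x + f y"
  shows "ga_map f 1 = 1"
proof -
  have "f 0 = 0" using assms[of 0 0] by simp
  then show ?thesis by transfer (simp flip: single_one)
qed

lemma ga_map_inj: "inj f \<Longrightarrow> ga_map f a = 0 \<Longrightarrow> a = 0"
  by transfer (metis push_inj push_zero injD)

lemma ga_map_comp: "ga_map f (ga_map g a) = ga_map (f \<circ> g) a"
  by transfer (rule push_comp)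

lemma ga_map_id: "ga_map (\<lambda>x. x) a = a"
  by transfer (rule push_id)

lemma ga_map_sum: "ga_map f (\<Sum>i\<in>I. g i) = (\<Sum>i\<in>I. ga_map f (g i))"
  by (induction I rule: infinite_finite_induct) (simp_all add: ga_map_add)

lemma dyn_fps_nth: "fps_nth (dyn_fps v a) n = ga_map (\<lambda>(x, y, n). (x, v y, n)) (fps_nth a n)"
  by (simp add: dyn_fps_def fps_map_def)

lemma dyn_fps_add: "dyn_fps v (a + b) = dyn_fps v a + dyn_fps v b"
  by (rule fps_ext) (simp add: dyn_fps_nth ga_map_add)

lemma dyn_fps_mult:
  fixes v :: "'y::lattice_group \<Rightarrow> 'y" and a b :: "('x::lattice_group \<times> 'y \<times> int) group_alg fps"
  assumes "add_bij v"
  shows "dyn_fps v (a * b) = dyn_fps v a * dyn_fps v b"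
proof (rule fps_ext)
  fix n
  have "ga_map (\<lambda>(x, y, n). (x, v y, n)) (c * d)
      = ga_map (\<lambda>(x, y, n). (x, v y, n)) c * ga_map (\<lambda>(x, y, n). (x, v y, n)) d"
    for c d :: "('x \<times> 'y \<times> int) group_alg"
    by (rule ga_map_mult) (use assms in \<open>auto simp: add_bij_def\<close>)
  then show "fps_nth (dyn_fps v (a * b)) n = fps_nth (dyn_fps v a * dyn_fps v b) n"
    by (simp add: dyn_fps_nth fps_mult_nth ga_map_sum)
qed

lemma dyn_fps_1:
  fixes v :: "'y::lattice_group \<Rightarrow> 'y"
  assumes "add_bij v"
  shows "dyn_fps v (1 :: ('x::lattice_group \<times> 'y \<times> int) group_alg fps) = 1"
proof -
  have "ga_map (\<lambda>(x, y, n). (x, v y, n)) (1 :: ('x \<times> 'y \<times> int) group_alg) = 1"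
    by (rule ga_map_1) (use assms in \<open>auto simp: add_bij_def\<close>)
  then show ?thesis by (intro fps_ext) (simp add: dyn_fps_nth)
qed

lemma dyn_fps_nz:
  fixes v :: "'y::lattice_group \<Rightarrow> 'y"
  assumes "add_bij v" "(a :: ('x::lattice_group \<times> 'y \<times> int) group_alg fps) \<noteq> 0"
  shows "dyn_fps v a \<noteq> 0"
proof
  assume z: "dyn_fps v a = 0"
  have "inj (\<lambda>(x::'x, y, n::int). (x, v y, n))"
    using assms(1) by (auto simp: inj_on_def add_bij_def bij_def)
  then have "fps_nth a n = 0" for n
    using ga_map_inj dyn_fps_nth[of v a n] z by (metis fps_zero_nth)
  then show False using assms(2) by (auto intro: fps_ext)
qed

lemma dyn_Fract:
  assumes "add_bij v" "b \<noteq> 0"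
  shows "dyn v (Fract a b) = Fract (dyn_fps v a) (dyn_fps v b)"
  unfolding dyn_def
  by (rule fract_map_Fract) (use assms in \<open>auto simp: dyn_fps_mult dyn_fps_nz\<close>)

lemma dyn_add: "add_bij v \<Longrightarrow> dyn v (a + b) = dyn v a + dyn v b"
  by (cases a, cases b) (simp add: dyn_Fract dyn_fps_nz dyn_fps_add dyn_fps_mult)

lemma dyn_mult: "add_bij v \<Longrightarrow> dyn v (a * b) = dyn v a * dyn v b"
  by (cases a, cases b) (simp add: dyn_Fract dyn_fps_mult)

lemma dyn_1: "add_bij v \<Longrightarrow> dyn v 1 = 1"
  by (simp add: One_fract_def dyn_Fract dyn_fps_1)

lemma dyn_0:
  fixes v :: "'y::lattice_group \<Rightarrow> 'y"
  assumes "add_bij v" shows "dyn v (0 :: ('x::lattice_group, 'y) dynfield) = 0"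
proof -
  have "dyn v 0 + dyn v 0 = dyn v 0 + (0 :: ('x, 'y) dynfield)"
    using dyn_add[OF assms, of 0 0, symmetric] unfolding add_0_right .
  then show ?thesis by (rule add_left_imp_eq)
qed

lemma dyn_comp:
  fixes v w :: "'y::lattice_group \<Rightarrow> 'y" and a :: "('x::lattice_group, 'y) dynfield"
  assumes "add_bij v" "add_bij w"
  shows "dyn v (dyn w a) = dyn (v \<circ> w) a"
proof -
  have vw: "add_bij (v \<circ> w)" using assms by (auto simp: add_bij_def bij_comp)
  have "dyn_fps v (dyn_fps w c) = dyn_fps (v \<circ> w) c" for c :: "('x \<times> 'y \<times> int) group_alg fps"
    by (rule fps_ext) (simp add: dyn_fps_nth ga_map_comp comp_def split_def)
  then show ?thesis using assms vw by (cases a) (simp add: dyn_Fract dyn_fps_nz)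
qed

lemma dyn_id:
  fixes a :: "('x::lattice_group, 'y::lattice_group) dynfield"
  shows "dyn id a = a"
proof -
  have i: "add_bij (id :: 'y \<Rightarrow> 'y)" by (simp add: add_bij_def)
  have "dyn_fps id c = c" for c :: "('x \<times> 'y \<times> int) group_alg fps"
    by (rule fps_ext) (simp add: dyn_fps_nth ga_map_id flip: id_def, simp add: id_def ga_map_id)
  then show ?thesis using i by (cases a) (simp add: dyn_Fract)
qed

lemma twisted_mult_superset:
  assumes "finite A" "finite B" "Poly_Mapping.keys f \<subseteq> A" "Poly_Mapping.keys g \<subseteq> B"
    and "\<And>v. v \<in> A \<Longrightarrow> add_bij v"
  shows "twisted_mult f g = (\<Sum>v\<in>A. \<Sum>w\<in>B.
     Poly_Mapping.single (v \<circ> w) (Poly_Mapping.lookup f v * dyn v (Poly_Mapping.lookup g w)))"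
proof -
  have "twisted_mult f g = (\<Sum>v\<in>A. \<Sum>w\<in>Poly_Mapping.keys g.
     Poly_Mapping.single (v \<circ> w) (Poly_Mapping.lookup f v * dyn v (Poly_Mapping.lookup g w)))"
    unfolding twisted_mult_def using assms
    by (intro sum.mono_neutral_left) (auto simp: in_keys_iff)
  also have "\<dots> = (\<Sum>v\<in>A. \<Sum>w\<in>B.
     Poly_Mapping.single (v \<circ> w) (Poly_Mapping.lookup f v * dyn v (Poly_Mapping.lookup g w)))"
    using assms by (intro sum.cong refl sum.mono_neutral_left) (auto simp: in_keys_iff dyn_0)
  finally show ?thesis .
qed

lemma twisted_mult_add_left:
  assumes "\<And>v. v \<in> Poly_Mapping.keys f \<union> Poly_Mapping.keys f' \<Longrightarrow> add_bij v"
  shows "twisted_mult (f + f') g = twisted_mult f g + twisted_mult f' g"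
proof -
  let ?A = "Poly_Mapping.keys f \<union> Poly_Mapping.keys f'" and ?B = "Poly_Mapping.keys g"
  have "Poly_Mapping.keys (f + f') \<subseteq> ?A" by (auto simp: in_keys_iff lookup_add)
  then show ?thesis
    using assms
    by (simp add: twisted_mult_superset[of ?A ?B] lookup_add distrib_right single_add sum.distrib
        del: Un_iff)
qed

lemma twisted_mult_add_right:
  assumes "\<And>v. v \<in> Poly_Mapping.keys f \<Longrightarrow> add_bij v"
  shows "twisted_mult f (g + g') = twisted_mult f g + twisted_mult f g'"
proof -
  let ?A = "Poly_Mapping.keys f" and ?B = "Poly_Mapping.keys g \<union> Poly_Mapping.keys g'"
  have k: "Poly_Mapping.keys (g + g') \<subseteq> ?B" by (auto simp: in_keys_iff lookup_add)
  have "twisted_mult f (g + g') = (\<Sum>v\<in>?A. \<Sum>w\<in>?B. Poly_Mapping.single (v \<circ> w)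
      (Poly_Mapping.lookup f v * dyn v (Poly_Mapping.lookup g w + Poly_Mapping.lookup g' w)))"
    using assms k by (simp add: twisted_mult_superset[of ?A ?B] lookup_add)
  also have "\<dots> = (\<Sum>v\<in>?A. \<Sum>w\<in>?B.
      Poly_Mapping.single (v \<circ> w) (Poly_Mapping.lookup f v * dyn v (Poly_Mapping.lookup g w)) +
      Poly_Mapping.single (v \<circ> w) (Poly_Mapping.lookup f v * dyn v (Poly_Mapping.lookup g' w)))"
    using assms by (intro sum.cong refl) (simp add: dyn_add distrib_left single_add)
  also have "\<dots> = twisted_mult f g + twisted_mult f g'"
    using assms by (simp add: twisted_mult_superset[of ?A ?B] sum.distrib)
  finally show ?thesis .
qed

lemma twisted_mult_single:
  assumes "add_bij v"
  shows "twisted_mult (Poly_Mapping.single v a) (Poly_Mapping.single w b) =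
    Poly_Mapping.single (v \<circ> w) (a * dyn v b)"
  using assms by (subst twisted_mult_superset[of "{v}" "{w}"]) auto

lemma twisted_mult_zero [simp]: "twisted_mult 0 g = 0" "twisted_mult f 0 = 0"
  by (simp_all add: twisted_mult_def)

lemma keys_twisted_mult:
  "Poly_Mapping.keys (twisted_mult f g) \<subseteq> (\<lambda>(v, w). v \<circ> w) ` (Poly_Mapping.keys f \<times> Poly_Mapping.keys g)"
  unfolding twisted_mult_def
proof (rule order_trans[OF keys_sum UN_least], rule order_trans[OF keys_sum UN_least])
  fix v w assume "v \<in> Poly_Mapping.keys f" "w \<in> Poly_Mapping.keys g"
  then show "Poly_Mapping.keys (Poly_Mapping.single (v \<circ> w) (Poly_Mapping.lookup f v * dyn v (Poly_Mapping.lookup g w)))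
    \<subseteq> (\<lambda>(v, w). v \<circ> w) ` (Poly_Mapping.keys f \<times> Poly_Mapping.keys g)"
    by auto
qed

lemma single_induct [consumes 1, case_names zero single add]:
  fixes f :: "'k \<Rightarrow>\<^sub>0 'c::comm_monoid_add"
  assumes "Poly_Mapping.keys f \<subseteq> C" and "P 0"
    and "\<And>v a. v \<in> C \<Longrightarrow> P (Poly_Mapping.single v a)"
    and "\<And>g h. Poly_Mapping.keys g \<subseteq> C \<Longrightarrow> Poly_Mapping.keys h \<subseteq> C \<Longrightarrow> P g \<Longrightarrow> P h \<Longrightarrow> P (g + h)"
  shows "P f"
proof -
  have "Poly_Mapping.keys (\<Sum>k\<in>A. Poly_Mapping.single k (Poly_Mapping.lookup f k)) \<subseteq> C \<and>
      P (\<Sum>k\<in>A. Poly_Mapping.single k (Poly_Mapping.lookup f k))" if "A \<subseteq> Poly_Mapping.keys f" for A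
    using finite_subset[OF that finite_keys] that
  proof (induction A rule: finite_induct)
    case empty then show ?case using assms(2) by simp
  next
    case (insert v A)
    let ?s = "Poly_Mapping.single v (Poly_Mapping.lookup f v)"
    let ?t = "\<Sum>k\<in>A. Poly_Mapping.single k (Poly_Mapping.lookup f k)"
    have v: "v \<in> C" using insert.prems assms(1) by auto
    have k: "Poly_Mapping.keys ?s \<subseteq> C" using v by simp
    have IH: "Poly_Mapping.keys ?t \<subseteq> C" "P ?t" using insert by auto
    have "P (?s + ?t)" by (rule assms(4)[OF k IH(1) assms(3)[OF v] IH(2)])
    moreover have "Poly_Mapping.keys (?s + ?t) \<subseteq> C"
      using k IH(1) Poly_Mapping.keys_add[of ?s ?t] by blast
    ultimately show ?case using insert.hyps by simp
  qed
  from this[OF order_refl] show ?thesis by (simp add: sum_singles)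
qed

context based_root_datum
begin

lemma weyl_mult: "v \<in> carrier (weyl D) \<Longrightarrow> w \<in> carrier (weyl D) \<Longrightarrow> v \<otimes>\<^bsub>weyl D\<^esub> w = v \<circ> w"
  and weyl_add_bij: "v \<in> carrier (weyl D) \<Longrightarrow> add_bij v"
  and weyl_group: "group (weyl D)"
  and weyl_one: "\<one>\<^bsub>weyl D\<^esub> = id"
proof -
  interpret B: group "BijGroup (UNIV :: 'y set)" by (rule group_BijGroup)
  have cB: "carrier (BijGroup (UNIV :: 'y set)) = {f. bij f}"
    by (auto simp: BijGroup_def Bij_def)
  have mB: "v \<otimes>\<^bsub>BijGroup UNIV\<^esub> w = v \<circ> w" if "bij v" "bij w" for v w :: "'y \<Rightarrow> 'y"
    using that by (auto simp: BijGroup_def Bij_def compose_def)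
  have oB: "\<one>\<^bsub>BijGroup (UNIV :: 'y set)\<^esub> = id"
    by (auto simp: BijGroup_def)
  have p0: "pairing D \<alpha> 0 = 0" for \<alpha> using pairing_add_right[of \<alpha> 0 0] by simp
  have pm: "pairing D \<alpha> (- y) = - pairing D \<alpha> y" for \<alpha> y
    using pairing_add_right[of \<alpha> y "- y"] p0 by simp
  have zm: "(- n) \<cdot> z = - (n \<cdot> z)" for n and z :: 'y
    using zsmul_add_left[of n "- n" z] by (simp add: eq_neg_iff_add_eq_0 add.commute)
  have refl_add: "coroot_refl D \<alpha> (x + y) = coroot_refl D \<alpha> x + coroot_refl D \<alpha> y" for \<alpha> x y
    by (simp add: coroot_refl_def pairing_add_right zsmul_add_left)
  have refl_inv: "coroot_refl D \<alpha> (coroot_refl D \<alpha> y) = y" if "\<alpha> \<in> roots D" for \<alpha> y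
  proof -
    have a: "pairing D \<alpha> (n \<cdot> z) = n * pairing D \<alpha> z" for n z
      using zsmul_hom[of "pairing D \<alpha>" n z] pairing_add_right by simp
    have "pairing D \<alpha> (coroot_refl D \<alpha> y) = - pairing D \<alpha> y"
      using pairing_add_right[of \<alpha> y "- (pairing D \<alpha> y \<cdot> coroot D \<alpha>)"] a pm pairing_root_coroot[OF that]
      by (simp add: coroot_refl_def)
    then show ?thesis unfolding coroot_refl_def[of D \<alpha> "coroot_refl D \<alpha> y"]
      by (simp add: coroot_refl_def zm)
  qed
  have gens: "add_bij (coroot_refl D \<alpha>)" if "\<alpha> \<in> roots D" for \<alpha>
    unfolding add_bij_def using refl_add refl_inv[OF that] by (auto intro!: o_bij simp: fun_eq_iff)
  have sub: "coroot_refl D ` roots D \<subseteq> carrier (BijGroup UNIV)"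
    using gens by (auto simp: cB add_bij_def)
  have car: "carrier (weyl D) = generate (BijGroup UNIV) (coroot_refl D ` roots D)"
    by (simp add: weyl_def)
  have sg: "subgroup (carrier (weyl D)) (BijGroup UNIV)"
    unfolding car by (rule B.generate_is_subgroup[OF sub])
  have m: "mult (weyl D) = mult (BijGroup UNIV)" by (simp add: weyl_def)
  show "\<one>\<^bsub>weyl D\<^esub> = id" using oB by (simp add: weyl_def)
  show "group (weyl D)"
    using B.subgroup_imp_group[OF sg] by (simp add: weyl_def)
  have bij: "bij v" if "v \<in> carrier (weyl D)" for v
    using subgroup.mem_carrier[OF sg that] by (simp add: cB)
  show "v \<in> carrier (weyl D) \<Longrightarrow> w \<in> carrier (weyl D) \<Longrightarrow> v \<otimes>\<^bsub>weyl D\<^esub> w = v \<circ> w"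
    using mB bij m by simp
  show "add_bij v" if "v \<in> carrier (weyl D)"
    using that unfolding car
  proof (induction rule: generate.induct)
    case one then show ?case unfolding oB add_bij_def using bij_id by simp
  next
    case (incl h) then show ?case using gens by auto
  next
    case (inv h)
    then obtain \<alpha> where h: "\<alpha> \<in> roots D" "h = coroot_refl D \<alpha>" by blast
    have "h \<otimes>\<^bsub>BijGroup UNIV\<^esub> h = \<one>\<^bsub>BijGroup UNIV\<^esub>"
      using gens[OF h(1)] refl_inv[OF h(1)] by (simp add: h(2) mB oB add_bij_def fun_eq_iff)
    then have "inv\<^bsub>BijGroup UNIV\<^esub> h = h"
      using B.inv_equality sub h by blast
    then show ?case using gens h by simp
  next
    case (eng h1 h2)
    then show ?case using bij_comp[of h2 h1] by (simp add: mB add_bij_def comp_def)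
  qed
qed

lemma QW_ring: "ring (QW D)"
proof -
  interpret W: group "weyl D" by (rule weyl_group)
  have ab: "\<And>v. v \<in> carrier (weyl D) \<Longrightarrow> add_bij v" by (rule weyl_add_bij)
  have closed: "Poly_Mapping.keys (twisted_mult f g) \<subseteq> carrier (weyl D)"
    if "Poly_Mapping.keys f \<subseteq> carrier (weyl D)" "Poly_Mapping.keys g \<subseteq> carrier (weyl D)" for f g :: "('y \<Rightarrow> 'y) \<Rightarrow>\<^sub>0 ('x, 'y) dynfield"
  proof (rule order_trans[OF keys_twisted_mult], clarify)
    fix v w assume "v \<in> Poly_Mapping.keys f" "w \<in> Poly_Mapping.keys g"
    then have "v \<in> carrier (weyl D)" "w \<in> carrier (weyl D)" using that by auto
    then show "v \<circ> w \<in> carrier (weyl D)" using W.m_closed weyl_mult by metis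
  qed
  have id: "id \<in> carrier (weyl D)" using W.one_closed weyl_one by simp
  have plus: "Poly_Mapping.keys (f + g) \<subseteq> carrier (weyl D)"
    if "Poly_Mapping.keys f \<subseteq> carrier (weyl D)" "Poly_Mapping.keys g \<subseteq> carrier (weyl D)"
    for f g :: "('y \<Rightarrow> 'y) \<Rightarrow>\<^sub>0 ('x, 'y) dynfield"
    using that Poly_Mapping.keys_add[of f g] by blast
  have dl: "twisted_mult (f + f') g = twisted_mult f g + twisted_mult f' g"
    if "Poly_Mapping.keys f \<subseteq> carrier (weyl D)" "Poly_Mapping.keys f' \<subseteq> carrier (weyl D)" for f f' g :: "('y \<Rightarrow> 'y) \<Rightarrow>\<^sub>0 ('x, 'y) dynfield"
    by (rule twisted_mult_add_left) (use that ab in auto)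
  have dr: "twisted_mult f (g + g') = twisted_mult f g + twisted_mult f g'"
    if "Poly_Mapping.keys f \<subseteq> carrier (weyl D)" for f g g' :: "('y \<Rightarrow> 'y) \<Rightarrow>\<^sub>0 ('x, 'y) dynfield"
    by (rule twisted_mult_add_right) (use that ab in auto)
  have assoc1: "twisted_mult (twisted_mult (Poly_Mapping.single u a) (Poly_Mapping.single v b)) (Poly_Mapping.single w c)
      = twisted_mult (Poly_Mapping.single u a) (twisted_mult (Poly_Mapping.single v b) (Poly_Mapping.single w c))"
    if u: "u \<in> carrier (weyl D)" and v: "v \<in> carrier (weyl D)" and w: "w \<in> carrier (weyl D)" for u v w and a b c :: "('x, 'y) dynfield"
  proof -
    have "add_bij (u \<circ> v)" using ab[OF u] ab[OF v] by (auto simp: add_bij_def bij_comp)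
    then show ?thesis using ab[OF u] ab[OF v]
      by (simp add: twisted_mult_single dyn_mult dyn_comp comp_assoc mult.assoc)
  qed
  have ks: "Poly_Mapping.keys (Poly_Mapping.single u a) \<subseteq> carrier (weyl D)"
    if "u \<in> carrier (weyl D)" for u and a :: "('x, 'y) dynfield" using that by simp
  have assoc2: "twisted_mult (twisted_mult (Poly_Mapping.single u a) (Poly_Mapping.single v b)) h
      = twisted_mult (Poly_Mapping.single u a) (twisted_mult (Poly_Mapping.single v b) h)"
    if "Poly_Mapping.keys h \<subseteq> carrier (weyl D)" "u \<in> carrier (weyl D)" "v \<in> carrier (weyl D)" for u v h and a b :: "('x, 'y) dynfield"
    using that(1)
  proof (induction rule: single_induct)
    case (add g h)
    then show ?case by (simp only: dr[OF closed[OF ks[OF that(2)] ks[OF that(3)]]] dr[OF ks[OF that(3)]] dr[OF ks[OF that(2)]])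
  qed (simp_all only: assoc1 that twisted_mult_zero)
  have assoc3: "twisted_mult (twisted_mult (Poly_Mapping.single u a) g) h
      = twisted_mult (Poly_Mapping.single u a) (twisted_mult g h)"
    if "Poly_Mapping.keys g \<subseteq> carrier (weyl D)" "Poly_Mapping.keys h \<subseteq> carrier (weyl D)" "u \<in> carrier (weyl D)" for u and a :: "('x, 'y) dynfield" and g h
    using that(1)
  proof (induction rule: single_induct)
    case (add g g')
    then show ?case by (simp only: dr[OF ks[OF that(3)]] dl closed[OF ks[OF that(3)]])
  qed (simp_all only: assoc2 that twisted_mult_zero)
  have assoc: "twisted_mult (twisted_mult f g) h = twisted_mult f (twisted_mult g h)"
    if "Poly_Mapping.keys f \<subseteq> carrier (weyl D)" "Poly_Mapping.keys g \<subseteq> carrier (weyl D)"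
      "Poly_Mapping.keys h \<subseteq> carrier (weyl D)" for f g h :: "('y \<Rightarrow> 'y) \<Rightarrow>\<^sub>0 ('x, 'y) dynfield"
    using that(1)
  proof (induction rule: single_induct)
    case (add f f')
    then show ?case using that by (simp only: dl closed)
  qed (simp_all only: assoc3 that twisted_mult_zero)
  have l1: "twisted_mult (Poly_Mapping.single id 1) f = f" if "Poly_Mapping.keys f \<subseteq> carrier (weyl D)" for f :: "('y \<Rightarrow> 'y) \<Rightarrow>\<^sub>0 ('x, 'y) dynfield"
    using that
  proof (induction rule: single_induct)
    case (single v a) then show ?case by (simp only: twisted_mult_single[OF ab[OF id]] dyn_id id_comp mult_1_left)
  next
    case (add g h) then show ?case by (simp only: dr[OF ks[OF id]])
  qed simp
  have r1: "twisted_mult f (Poly_Mapping.single id 1) = f" if "Poly_Mapping.keys f \<subseteq> carrier (weyl D)" for f :: "('y \<Rightarrow> 'y) \<Rightarrow>\<^sub>0 ('x, 'y) dynfield"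
    using that
  proof (induction rule: single_induct)
    case (single v a) then show ?case by (simp only: twisted_mult_single[OF ab] dyn_1[OF ab] comp_id mult_1_right)
  next
    case (add g h) then show ?case by (simp only: dl)
  qed simp
  show ?thesis
  proof (intro ringI abelian_groupI monoidI)
    fix x assume "x \<in> carrier (QW D)"
    then show "\<exists>y\<in>carrier (QW D). y \<oplus>\<^bsub>QW D\<^esub> x = \<zero>\<^bsub>QW D\<^esub>"
      by (intro bexI[of _ "- x"]) (auto simp: QW_def)
  qed (auto simp: QW_def plus[THEN subsetD] closed[THEN subsetD] assoc l1 r1 dl dr id ac_simps)
qed

lemma Rmat_closed: "i \<in> index D \<Longrightarrow> Rmat D i \<beta> \<in> carrier (QW D)"
proof -
  assume i: "i \<in> index D"
  interpret Q: ring "QW D" by (rule QW_ring)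
  interpret W: group "weyl D" by (rule weyl_group)
  have s: "srefl D i \<in> carrier (weyl D)"
    using i simple_roots by (auto simp: srefl_def weyl_def intro!: generate.incl)
  have id: "id \<in> carrier (weyl D)" using W.one_closed weyl_one by simp
  have "scalar a \<in> carrier (QW D)" for a using id by (simp add: QW_def scalar_def)
  moreover have "delta (srefl D i) \<in> carrier (QW D)" using s by (simp add: QW_def delta_def)
  ultimately show ?thesis unfolding Rmat_def by blast
qed

end

section \<open>Nonvanishing of theta\<close>

definition theta_factor :: "'l::lattice_group \<Rightarrow> nat \<Rightarrow> 'l group_alg fps" where
  "theta_factor u n = (1 - fps_X ^ Suc n * fps_const (expo (u + u))) *
                  (1 - fps_X ^ Suc n * fps_const (expo (- (u + u))))"

lemma theta_convergent:
  "\<exists>p. theta_factor (u::'a::lattice_group) has_prod p \<and> fps_nth p 0 = 1"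
proof -
  define P where "P n = (\<Prod>i\<le>n. theta_factor u i)" for n
  have f: "\<exists>g. theta_factor u n = 1 + fps_X ^ Suc n * g" for n
  proof -
    have "(1 - X * a) * (1 - X * b) = 1 + X * (- a - b + X * a * b)"
      for X a b :: "'a group_alg fps" by (simp add: algebra_simps)
    then show ?thesis unfolding theta_factor_def by blast
  qed
  have step: "fps_nth (P (Suc n)) k = fps_nth (P n) k" if "k \<le> n" for n k
  proof -
    obtain g where "theta_factor u (Suc n) = 1 + fps_X ^ Suc (Suc n) * g" using f by blast
    then have "P (Suc n) = P n + fps_X ^ Suc (Suc n) * (P n * g)"
      by (simp add: P_def algebra_simps)
    then show ?thesis using that by (simp add: fps_X_power_mult_nth del: power_Suc)
  qed
  have stab: "fps_nth (P (k + d)) k = fps_nth (P k) k" for k d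
    by (induction d) (simp_all add: step)
  define p where "p = Abs_fps (\<lambda>k. fps_nth (P k) k)"
  have lim: "P \<longlonglongrightarrow> p"
  proof (rule tendsto_fpsI)
    fix k
    show "\<forall>\<^sub>F n in sequentially. fps_nth (P n) k = fps_nth p k"
      unfolding eventually_sequentially
      by (rule exI[of _ k]) (metis stab p_def fps_nth_Abs_fps le_add_diff_inverse)
  qed
  have p0: "fps_nth p 0 = 1" by (simp add: p_def P_def theta_factor_def)
  then have "p \<noteq> 0" by auto
  then have "theta_factor u has_prod p" using lim by (simp add: has_prod_def raw_has_prod_def P_def[abs_def])
  then show ?thesis using p0 by blast
qed

lemma theta_nonzero:
  fixes u :: "'l::lattice_group"
  assumes "u \<noteq> 0" shows "theta u \<noteq> 0"
proof -
  obtain p where p: "theta_factor u has_prod p" "fps_nth p 0 = 1" using theta_convergent by blast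
  obtain \<iota> :: "'l \<Rightarrow> (nat \<Rightarrow>\<^sub>0 int)" where \<iota>: "inj \<iota>" "\<And>x y. \<iota> (x + y) = \<iota> x + \<iota> y"
    using lattice_embedding by blast
  have i0: "\<iota> 0 = 0" using \<iota>(2)[of 0 0] by simp
  have "u \<noteq> - u"
  proof
    assume "u = - u"
    then have "u + u = 0" by (metis add.right_inverse)
    then have "\<iota> u + \<iota> u = 0" using \<iota>(2) i0 by metis
    then have "Poly_Mapping.lookup (\<iota> u) k + Poly_Mapping.lookup (\<iota> u) k = 0" for k
      by (metis lookup_add lookup_zero)
    then have "\<iota> u = 0" by (intro poly_mapping_eqI) simp
    then show False using assms \<iota>(1) i0 by (metis injD)
  qed
  then have "expo u \<noteq> expo (- u)"
    by transfer (metis lookup_single_eq lookup_single_not_eq one_neq_zero)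
  moreover have "prodinf (theta_factor u) = p" by (rule has_prod_unique[OF p(1), symmetric])
  then have "theta u = fps_const (expo u - expo (- u)) * p"
    unfolding theta_def theta_factor_def[abs_def] by simp
  then have "fps_nth (theta u) 0 = expo u - expo (- u)" using p(2) by simp
  ultimately show ?thesis by auto
qed

end

theory Submission
  imports
    Defs
    "HOL-Algebra.Algebraic_Closure_Type"
begin

text \<open>
  Right multiplication by \<open>h\<^sub>i(z)\<close> acts on a coefficient function \<open>F\<close> on the Weyl group by
  \<open>w \<mapsto> F(w) P(w \<alpha>\<^sub>i\<^sup>\<or>, z) + F(w s\<^sub>i) Q(w \<alpha>\<^sub>i\<^sup>\<or>, z)\<close>. Up to factors common to both sides of a Yang--Baxter
  equation, the coefficient of \<open>\<delta>\<^sub>w\<close> is, as a function of \<open>x\<close>, a sum of products of \<open>N\<close> thetas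
  \<open>\<theta>(x - b)\<close> whose points \<open>b\<close> have a fixed sum, which depends on \<open>w\<close> only; by the three-term relation
  of theta such a function vanishes as soon as it has \<open>N\<close> zeros with the wrong sum. Enough zeros come from
  unitarity: wherever one of the arguments of the \<open>h\<close>'s is \<open>0\<close>, both sides collapse, because \<open>h(0) = 1\<close>
  and \<open>h(z) h(-z) = 1\<close>. The two elements \<open>w\<close> for which the sum of the zeros is the right one contribute a
  single product on either side.

  In type \<open>G\<^sub>2\<close> the argument \<open>2x + 3y\<close> produces four zeros that differ by half-periods. They exist
  only in an enlarged model of theta, with \<open>e\<^sup>u\<close> replaced by \<open>e\<^sup>6\<^sup>u\<close>, \<open>q\<close> by \<open>r\<^sup>1\<^sup>6\<close>, and half-periods
  adjoined through the series form of theta (Jacobi's triple product). Quasi-periodicity in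
  \<open>(x, y)\<close> moves all four to the line \<open>2x + 3y = 0\<close>, since \<open>(2, 3)\<close> is primitive.
\<close>

text \<open>The obstacle is that everything is formal: on the lattice itself \<open>theta\<close>
  vanishes only at 0, and there is no complex variable in which zeros could be counted by a contour
  integral or by Liouville's theorem. The three-term relation takes over that role, because it lets
  a zero be divided out of a sum of theta products. The relation is read off from the series: there
  a product of two thetas is a 2 by 2 determinant, and three-term relations are Pluecker relations.
  Passing to the enlarged model is an injective map of fields, so identities may be proved there and
  pulled back. The scaling by 6 has two sources: the fundamental coweight that measures how often
  \<open>x\<close> occurs in an argument has denominator 3 in type A2 and 2 in type B2, and type G2
  requires half of \<open>y\<close>. The order of a product of two simple reflections enters only
  through the Cartan integers, which it determines through the trace of that product; relative
  length then tells the two integers apart.\<close>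

section \<open>Integer multiples in abelian groups\<close>

lemma zsmul_minus_left: "(- n) \<cdot> x = - (n \<cdot> x)"
  using zsmul_add_left[of n "- n" x] by (simp add: eq_neg_iff_add_eq_0 add.commute)

lemma zsmul_diff_left: "(m - n) \<cdot> x = m \<cdot> x - n \<cdot> x"
  using zsmul_add_left[of m "- n" x] by (simp add: zsmul_minus_left)

lemma zsmul_2: "2 \<cdot> x = x + x"
  using zsmul_add_left[of 1 1 x] by simp

lemma zsmul_add_right: "n \<cdot> (x + y) = n \<cdot> x + n \<cdot> y"
  by (simp add: zsmul_def sum.distrib algebra_simps)

lemma zsmul_minus_right: "n \<cdot> (- x) = - (n \<cdot> x)"
  by (rule zsmul_hom[symmetric]) simp

lemma zsmul_diff_right: "n \<cdot> (x - y) = n \<cdot> x - n \<cdot> y"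
  using zsmul_add_right[of n x "- y"] by (simp add: zsmul_minus_right)

lemma zsmul_assoc: "m \<cdot> (n \<cdot> x) = (m * n) \<cdot> x"
  using zsmul_hom[of "\<lambda>n. n \<cdot> x" m n] by (simp add: zsmul_add_left)

lemma sum_list_replicate_zsmul: "sum_list (replicate n x) = int n \<cdot> x"
proof (induction n)
  case (Suc n)
  have "int (Suc n) \<cdot> x = x + int n \<cdot> x" using zsmul_add_left[of 1 "int n" x] by simp
  then show ?case using Suc by simp
qed simp

section \<open>Zeros of sums of theta products, from the three-term relation\<close>

text \<open>The sequence \<open>far\<close> serves only to choose auxiliary points that avoid the zeros of \<open>th\<close>.\<close>

locale theta_function =
  fixes th :: "'g::ab_group_add \<Rightarrow> 'k::field" and far :: "nat \<Rightarrow> 'g"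
  assumes th_minus: "th (- u) = - th u"
    and th_0: "th 0 = 0"
    and fay: "th a * th b * th (c + d - a) * th (c - d + b) + th c * th (a - b - c) * th d * th (a + b - d)
        + th (c + b) * th (c - a) * th (d - b) * th (a - d) = 0"
    and th_far: "0 < k \<Longrightarrow> \<forall>\<^sub>F N in sequentially. th (k \<cdot> far N + u) \<noteq> 0"
begin

lemma th_diff_commute: "th (x - y) = - th (y - x)"
  using th_minus[of "y - x"] by simp

text \<open>The three-term relation at \<open>(l + z, l - z, H + z, l)\<close>, divided by the
  square of \<open>th l\<close>. It is the diagonal coefficient of h(z) h(-z) before division by
  \<open>th (H + z) * th (H - z)\<close>.\<close>

lemma theta_unitarity:
  assumes l: "th l \<noteq> 0"
  shows "th (l - z) * th H / th l * (th (l + z) * th H / th l) 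
     + th (H - l) * th z / th l * (th (l + H) * th z / th l) = th (H + z) * th (H - z)"
proof -
  have e: "H + z + l - (l + z) = H" "H + z - l + (l - z) = H" "l + z - (l - z) - (H + z) = - (H - z)"
    "l + z + (l - z) - l = l" "H + z + (l - z) = l + H" "H + z - (l + z) = H - l" "l - (l - z) = z" "l + z - l = z"
    by simp_all
  have "th (l + z) * th (l - z) * th H * th H + th (H + z) * (- th (H - z)) * th l * th l
      + th (l + H) * th (H - l) * th z * th z = 0"
    using fay[of "l + z" "l - z" "H + z" l] unfolding e th_minus .
  then show ?thesis using l by (simp add: field_simps)
qed

text \<open>
  Replaces the space of theta functions of degree \<open>n\<close> with prescribed multiplier, which cannot be
  defined by quasi-periods here because \<open>th\<close> is only assumed to satisfy the three-term relation.
\<close>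

inductive thf :: "nat \<Rightarrow> 'g \<Rightarrow> ('g \<Rightarrow> 'k) \<Rightarrow> bool" where
  zero: "thf n s (\<lambda>t. 0)"
| prod: "thf (length bs) (sum_list bs) (\<lambda>t. k * (\<Prod>b\<leftarrow>bs. th (t - b)))"
| add: "thf n s f \<Longrightarrow> thf n s g \<Longrightarrow> thf n s (\<lambda>t. f t + g t)"

lemma thf_prod': "length bs = n \<Longrightarrow> sum_list bs = s \<Longrightarrow> thf n s (\<lambda>t. k * (\<Prod>b\<leftarrow>bs. th (t - b)))"
  using thf.prod by blast

lemma thf_cmult: "thf n s f \<Longrightarrow> thf n s (\<lambda>t. c * f t)"
proof (induction rule: thf.induct)
  case (prod bs k)
  then show ?case using thf.prod[of bs "c * k"] by (simp add: mult.assoc)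
qed (auto simp: distrib_left intro: thf.intros)

lemma thf_mult: "thf n s f \<Longrightarrow> thf m s' g \<Longrightarrow> thf (n + m) (s + s') (\<lambda>t. f t * g t)"
proof (induction rule: thf.induct)
  case (prod bs k)
  from prod show ?case
  proof (induction rule: thf.induct)
    case (prod bs' k')
    then show ?case using thf.prod[of "bs @ bs'" "k * k'"] by (simp add: mult_ac)
  qed (auto simp: distrib_left intro: thf.intros)
qed (auto simp: distrib_right intro: thf.intros)

lemma thf_diff: "thf n s f \<Longrightarrow> thf n s g \<Longrightarrow> thf n s (\<lambda>t. f t - g t)"
  using thf.add[of n s f "\<lambda>t. - 1 * g t"] thf_cmult[of n s g "- 1"] by simp

lemma thf_const: "thf 0 0 (\<lambda>t. c)"
  using thf_prod'[of "[]" 0 0 c] by simp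

lemma thf_th: "thf 1 b (\<lambda>t. th (t - b))"
  using thf_prod'[of "[b]" 1 b 1] by simp

lemma thf_th_pair:
  assumes "b + b' = s"
  shows "thf 2 s (\<lambda>t. th (t - b) * th (t - b'))"
  using thf_mult[OF thf_th[of b] thf_th[of b']] assms by (simp add: numeral_2_eq_2)

text \<open>Products of two thetas whose points have sum \<open>b + b'\<close> span at most a plane,
  generated by the product with a point at \<open>a\<close> and the one with a point at
  \<open>c\<close>. The coefficients come from the three-term relation at
  \<open>(t - b, t - b', c - b, t - a)\<close>; the hypotheses make its leading coefficient
  \<open>D\<close> invertible.\<close>

lemma th_pair_rewrite:
  assumes "th (c - a) \<noteq> 0" "th (c + a - (b + b')) \<noteq> 0"
  obtains \<alpha> \<beta> where "\<And>t. th (t - b) * th (t - b') =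
     \<alpha> * (th (t - a) * th (t - (b + b' - a))) + \<beta> * (th (t - c) * th (t - (b + b' - c)))"
proof -
  define D where "D = th (c - a) * th (c + a - (b + b'))"
  have D: "D \<noteq> 0" using assms by (simp add: D_def)
  have *: "D * (th (t - b) * th (t - b')) =
     - (th (c - b) * th (b' - c)) * (th (t - a) * th (t - (b + b' - a)))
     + th (b' - a) * th (a - b) * (th (t - c) * th (t - (b + b' - c)))" for t
  proof -
    have "th (t - b) * th (t - b') * th (c - a) * th (c + a - (b + b'))
        + th (c - b) * th (b' - c) * th (t - a) * th (t - (b + b' - a))
        + th (t - (b + b' - c)) * th (c - t) * th (b' - a) * th (a - b) = 0"
    proof -
      have e: "c - b + (t - a) - (t - b) = c - a" "c - b - (t - a) + (t - b') = c + a - (b + b')"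
        "t - b - (t - b') - (c - b) = b' - c" "t - b + (t - b') - (t - a) = t - (b + b' - a)"
        "c - b + (t - b') = t - (b + b' - c)" "c - b - (t - b) = c - t" "t - a - (t - b') = b' - a"
        "t - b - (t - a) = a - b" by simp_all
      show ?thesis using fay[of "t - b" "t - b'" "c - b" "t - a"] unfolding e .
    qed
    moreover have "(r * s) * (p * q) = - (A * B) * (C * E) + H * I * (G * F)"
      if "p * q * r * s + A * B * C * E + F * (- G) * H * I = 0" for p q r s A B C E F G H I :: 'k
    proof -
      have "(r * s) * (p * q) - (- (A * B) * (C * E) + H * I * (G * F)) =
         p * q * r * s + A * B * C * E + F * (- G) * H * I" by (simp add: algebra_simps)
      then show ?thesis using that by (metis eq_iff_diff_eq_0)
    qed
    ultimately show ?thesis unfolding D_def th_diff_commute[of c t] by blast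
  qed
  show thesis
  proof (rule that)
    fix t
    show "th (t - b) * th (t - b') =
       (- (th (c - b) * th (b' - c)) / D) * (th (t - a) * th (t - (b + b' - a)))
       + (th (b' - a) * th (a - b) / D) * (th (t - c) * th (t - (b + b' - c)))"
      using *[of t] D by (simp add: field_simps)
  qed
qed

text \<open>A standard product of degree \<open>n + 1\<close> with sum \<open>s\<close>: all points
  but one sit at a generic \<open>c\<close>, and the last is forced. It spans a complement of the
  multiples of \<open>th (t - a)\<close>.\<close>

definition ref_prod :: "'g \<Rightarrow> nat \<Rightarrow> 'g \<Rightarrow> 'g \<Rightarrow> 'k" where
  "ref_prod c n s t = th (t - c) ^ n * th (t - (s - int n \<cdot> c))"

text \<open>One point is treated at a time: the new point \<open>b\<close> is paired with the free
  point of the reference product, and \<open>th_pair_rewrite\<close> moves the pair either to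
  \<open>a\<close>, which goes into the quotient, or to \<open>c\<close>, which raises the reference
  product. The eventual form, instead of the existence of some \<open>c\<close>, lets several
  summands share one reference point.\<close>

lemma thf_decomp_prod:
  assumes "bs \<noteq> []"
  shows "\<forall>\<^sub>F N in sequentially. \<exists>g k. thf (length bs - 1) (sum_list bs - a) g \<and>
    (\<forall>t. (\<Prod>b\<leftarrow>bs. th (t - b)) = th (t - a) * g t + k * ref_prod (far N) (length bs - 1) (sum_list bs) t)"
  using assms
proof (induction bs rule: list_nonempty_induct)
  case (single b)
  have "thf 0 (b - a) (\<lambda>t. 0)" by (rule thf.zero)
  then show ?case
    by (intro always_eventually allI exI[of _ "\<lambda>t. 0"] exI[of _ 1]) (simp add: ref_prod_def)
next
  case (cons b bs)
  define n where "n = length bs - 1"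
  define s where "s = sum_list bs"
  have len: "length bs = Suc n" using cons.hyps by (simp add: n_def)
  have e1: "\<forall>\<^sub>F N in sequentially. th (1 \<cdot> far N + (- a)) \<noteq> 0"
    by (rule th_far) simp
  have e2: "\<forall>\<^sub>F N in sequentially. th (int (Suc n) \<cdot> far N + (a - b - s)) \<noteq> 0"
    by (rule th_far) simp
  from cons.IH[folded n_def s_def] e1 e2 show ?case
  proof eventually_elim
    case (elim N)
    define c where "c = far N"
    from elim(1) obtain g k where g: "thf n (s - a) g"
      and gk: "\<And>t. (\<Prod>b\<leftarrow>bs. th (t - b)) = th (t - a) * g t + k * ref_prod c n s t"
      unfolding c_def by blast
    define b' where "b' = s - int n \<cdot> c"
    have ca: "th (c - a) \<noteq> 0" using elim(2) by (simp add: c_def)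
    have "int (Suc n) \<cdot> c = c + int n \<cdot> c" using zsmul_add_left[of 1 "int n" c] by simp
    then have e: "c + a - (b + b') = int (Suc n) \<cdot> far N + (a - b - s)"
      by (simp add: b'_def c_def algebra_simps del: of_nat_Suc)
    have "th (c + a - (b + b')) \<noteq> 0" unfolding e by (rule elim(3))
    from th_pair_rewrite[OF ca this] obtain \<alpha> \<beta> where ab: "\<And>t. th (t - b) * th (t - b') =
     \<alpha> * (th (t - a) * th (t - (b + b' - a))) + \<beta> * (th (t - c) * th (t - (b + b' - c)))" by metis
    define h where "h t = th (t - b) * g t + k * \<alpha> * (th (t - c) ^ n * th (t - (b + b' - a)))" for t
    have "thf (Suc n) (b + (s - a)) (\<lambda>t. th (t - b) * g t)"
      using thf_mult[OF thf_th[of b] g] by simp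
    moreover have "thf (Suc n) (b + (s - a)) (\<lambda>t. k * \<alpha> * (th (t - c) ^ n * th (t - (b + b' - a))))"
    proof -
      have "sum_list (replicate n c @ [b + b' - a]) = b + (s - a)" by (simp add: b'_def sum_list_replicate_zsmul)
      from thf_prod'[OF _ this, of "Suc n" "k * \<alpha>"] show ?thesis by simp
    qed
    ultimately have h: "thf (Suc n) (b + s - a) h"
      unfolding h_def[abs_def] by (metis (no_types) thf.add add_diff_eq)
    have e: "ref_prod c (Suc n) (b + s) t = th (t - c) ^ n * (th (t - c) * th (t - (b + b' - c)))" for t
      using zsmul_add_left[of 1 "int n" c] by (simp add: ref_prod_def b'_def algebra_simps)
    have "(\<Prod>b\<leftarrow>b # bs. th (t - b)) = th (t - a) * h t + k * \<beta> * ref_prod c (Suc n) (b + s) t" for t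
    proof -
      have "(\<Prod>b\<leftarrow>b # bs. th (t - b)) = th (t - b) * (th (t - a) * g t) + k * th (t - c) ^ n * (th (t - b) * th (t - b'))"
        by (simp add: gk ref_prod_def b'_def algebra_simps)
      then show ?thesis unfolding ab e h_def by (simp add: algebra_simps)
    qed
    then show ?case using h unfolding c_def s_def by (intro exI[of _ h] exI[of _ "k * \<beta>"]) (simp add: len)
  qed
qed

lemma thf_decomp:
  assumes "thf m s f" "m = Suc n"
  shows "\<forall>\<^sub>F N in sequentially. \<exists>g k. thf n (s - a) g \<and>
    (\<forall>t. f t = th (t - a) * g t + k * ref_prod (far N) n s t)"
  using assms
proof (induction rule: thf.induct)
  case (zero n' s)
  show ?case
    by (intro always_eventually allI exI[of _ "\<lambda>t. 0"] exI[of _ 0]) (simp add: thf.zero)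
next
  case (prod bs k0)
  then have "bs \<noteq> []" by auto
  from thf_decomp_prod[OF this, of a] show ?case
  proof eventually_elim
    case (elim N)
    then obtain g k where "thf n (sum_list bs - a) g"
      "\<And>t. (\<Prod>b\<leftarrow>bs. th (t - b)) = th (t - a) * g t + k * ref_prod (far N) n (sum_list bs) t"
      using prod by auto
    then show ?case
      by (intro exI[of _ "\<lambda>t. k0 * g t"] exI[of _ "k0 * k"]) (simp add: thf_cmult algebra_simps)
  qed
next
  case (add n' s f g)
  from add.IH(1)[OF add.prems] add.IH(2)[OF add.prems] show ?case
  proof eventually_elim
    case (elim N)
    then obtain f1 k1 f2 k2 where "thf n (s - a) f1" "thf n (s - a) f2"
      "\<And>t. f t = th (t - a) * f1 t + k1 * ref_prod (far N) n s t"
      "\<And>t. g t = th (t - a) * f2 t + k2 * ref_prod (far N) n s t" by blast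
    then show ?case
      by (intro exI[of _ "\<lambda>t. f1 t + f2 t"] exI[of _ "k1 + k2"]) (simp add: thf.add algebra_simps)
  qed
qed

text \<open>At \<open>t = a\<close> only the reference product survives, and for large
  \<open>N\<close> it does not vanish there, so its coefficient is 0. Degree at least 2 matters: in
  degree 1 the reference product is \<open>th (t - s)\<close>, on which the choice of
  \<open>c\<close> has no influence.\<close>

lemma thf_divide:
  assumes "thf (Suc (Suc n)) s f" "f a = 0"
  obtains g where "thf (Suc n) (s - a) g" "\<And>t. f t = th (t - a) * g t"
proof -
  have e1: "\<forall>\<^sub>F N in sequentially. th (1 \<cdot> far N + (- a)) \<noteq> 0"
    by (rule th_far) simp
  have e2: "\<forall>\<^sub>F N in sequentially. th (int (Suc n) \<cdot> far N + (a - s)) \<noteq> 0"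
    by (rule th_far) simp
  have "\<forall>\<^sub>F N in sequentially. \<exists>g. thf (Suc n) (s - a) g \<and> (\<forall>t. f t = th (t - a) * g t)"
    using thf_decomp[OF assms(1) refl, of a] e1 e2
  proof eventually_elim
    case (elim N)
    then obtain g k where g: "thf (Suc n) (s - a) g"
      and fg: "\<And>t. f t = th (t - a) * g t + k * ref_prod (far N) (Suc n) s t" by blast
    have "th (a - far N) \<noteq> 0" using elim(2) th_diff_commute[of a "far N"] by simp
    moreover have "th (a - (s - int (Suc n) \<cdot> far N)) \<noteq> 0"
      using elim(3) by (simp add: algebra_simps del: of_nat_Suc)
    ultimately have "ref_prod (far N) (Suc n) s a \<noteq> 0" by (simp add: ref_prod_def del: of_nat_Suc)
    moreover have "k * ref_prod (far N) (Suc n) s a = 0" using fg[of a] assms(2) by (simp add: th_0)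
    ultimately have "k = 0" by simp
    then show ?case using g fg by auto
  qed
  from eventually_happens[OF this] show thesis using that by auto
qed

lemma thf_1: "thf m s f \<Longrightarrow> m = 1 \<Longrightarrow> \<exists>k. \<forall>t. f t = k * th (t - s)"
proof (induction rule: thf.induct)
  case (zero n s) then show ?case by (intro exI[of _ 0]) simp
next
  case (prod bs k)
  then obtain b where "bs = [b]" by (metis One_nat_def length_0_conv length_Suc_conv)
  then show ?case by (intro exI[of _ k]) simp
next
  case (add n s f g)
  then obtain k l where "\<forall>t. f t = k * th (t - s)" "\<forall>t. g t = l * th (t - s)" by blast
  then show ?case by (intro exI[of _ "k + l"]) (simp add: algebra_simps)
qed

text \<open>The zeros are divided out one by one; the pairwise condition on
  \<open>th (b - a)\<close> keeps the later ones zeros of the quotient. What remains is a multiple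
  of one theta whose point differs from the last zero by \<open>s - sum_list as\<close>, so the
  multiple is 0.\<close>

lemma thf_eq_0:
  assumes "thf (length as) s f" "as \<noteq> []" "\<And>a. a \<in> set as \<Longrightarrow> f a = 0"
    and "sorted_wrt (\<lambda>a b. th (b - a) \<noteq> 0) as" "th (s - sum_list as) \<noteq> 0"
  shows "f t = 0"
  using assms(2,1,3-)
proof (induction as arbitrary: s f t rule: list_nonempty_induct)
  case (single a)
  then obtain k where k: "\<And>t. f t = k * th (t - s)" using thf_1[of 1 s f] by auto
  then have "k * th (a - s) = 0" using single by force
  then have "k = 0" using single th_diff_commute[of a s] by simp
  then show ?case using k by simp
next
  case (cons a as)
  then obtain n where n: "length as = Suc n" by (cases as) auto
  obtain g where g: "thf (length as) (s - a) g" and fg: "\<And>t. f t = th (t - a) * g t"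
    using thf_divide[of n s f a] cons.prems n by auto
  have "g t = 0" for t
  proof (rule cons.IH[OF g])
    show "sorted_wrt (\<lambda>a b. th (b - a) \<noteq> 0) as" using cons.prems by simp
    show "th (s - a - sum_list as) \<noteq> 0" using cons.prems by (simp add: diff_diff_eq)
    fix b assume b: "b \<in> set as"
    then have "th (b - a) \<noteq> 0" "th (b - a) * g b = 0" using cons.prems fg[of b] by auto
    then show "g b = 0" by simp
  qed
  then show ?case by (simp add: fg)
qed

text \<open>For \<open>n = 2\<close>, the three-term relation at
  \<open>(2 t + c, b, t + b, t)\<close> with an auxiliary \<open>b\<close> writes
  \<open>th (2 t + c)\<close> as a combination of two products of four thetas, both with sum
  \<open>- 2 c\<close>.\<close>

lemma thf_th_scaled:
  assumes "n \<le> 2"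
  shows "thf (n * n) (- (int n \<cdot> c)) (\<lambda>t. th (int n \<cdot> t + c))"
proof -
  consider "n = 0" | "n = 1" | "n = 2" using assms by linarith
  then show ?thesis
  proof cases
    case 1 then show ?thesis using thf_const by simp
  next
    case 2 then show ?thesis using thf_th[of "- c"] by simp
  next
    case 3
    have far1: "\<forall>\<^sub>F N in sequentially. th (1 \<cdot> far N + u) \<noteq> 0" 
      and far2: "\<forall>\<^sub>F N in sequentially. th (2 \<cdot> far N + u) \<noteq> 0" for u by (rule th_far; simp)+
    from far1[of 0] far1[of "- c"] far2[of 0]
    have "\<forall>\<^sub>F N in sequentially. th (far N) \<noteq> 0 \<and> th (far N - c) \<noteq> 0 \<and> th (far N + far N) \<noteq> 0"
    proof eventually_elim
      case (elim N)
      then show ?case unfolding zsmul_2 zsmul_1_left by simp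
    qed
    from eventually_happens[OF this] obtain b
      where b: "th b \<noteq> 0" "th (b - c) \<noteq> 0" "th (b + b) \<noteq> 0" by auto
    define D where "D = th b * th (b - c) * th (b + b)"
    have D: "D \<noteq> 0" using b by (simp add: D_def)
    define g where "g t = th (t - - b) * th (t - (b + b - c)) * (th (t - 0) * th (t - (- c - b)))" for t
    define h where "h t = th (t - - (b + b)) * th (t - (b - c)) * (th (t - b) * th (t - - c))" for t
    have eq: "th (t + t + c) * D = h t - g t" for t
    proof -
      have e: "t + b + t - (t + t + c) = b - c" "t + b - t + b = b + b" "t + t + c - b - (t + b) = t - (b + b - c)"
        "t + t + c + b - t = t - (- c - b)" "t + b + b = t - - (b + b)" "t + b - (t + t + c) = - (t - (b - c))"
        "t + t + c - t = t - - c" "t - - b = t + b" "t - 0 = t" by simp_all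
      have "th (t + t + c) * th b * th (t + b + t - (t + t + c)) * th (t + b - t + b)
          + th (t + b) * th (t + t + c - b - (t + b)) * th t * th (t + t + c + b - t)
          + th (t + b + b) * th (t + b - (t + t + c)) * th (t - b) * th (t + t + c - t) = 0"
        by (rule fay)
      then have "th (t + t + c) * th b * th (b - c) * th (b + b)
          + th (t + b) * th (t - (b + b - c)) * th t * th (t - (- c - b))
          - th (t - - (b + b)) * th (t - (b - c)) * th (t - b) * th (t - - c) = 0"
        unfolding e(1-7) th_minus by simp
      moreover have "th (t + t + c) * D - (h t - g t) = th (t + t + c) * th b * th (b - c) * th (b + b)
          + th (t + b) * th (t - (b + b - c)) * th t * th (t - (- c - b))
          - th (t - - (b + b)) * th (t - (b - c)) * th (t - b) * th (t - - c)"
        unfolding g_def h_def D_def e(8,9) by (simp only: mult.assoc diff_diff_eq2 add_diff_eq)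
      ultimately show ?thesis by (metis eq_iff_diff_eq_0)
    qed
    have gh: "thf (2 + 2) ((- b + (b + b - c)) + (0 + (- c - b))) g"
      unfolding g_def by (intro thf_mult thf_th_pair refl)
    moreover have "thf (2 + 2) ((- (b + b) + (b - c)) + (b + (- c))) h"
      unfolding h_def by (intro thf_mult thf_th_pair refl)
    moreover have "(- b + (b + b - c)) + (0 + (- c - b)) = - (2 \<cdot> c)" "(- (b + b) + (b - c)) + (b + (- c)) = - (2 \<cdot> c)"
      by (simp_all add: zsmul_2)
    ultimately have "thf 4 (- (2 \<cdot> c)) (\<lambda>t. inverse D * (h t - g t))"
      by (intro thf_cmult thf_diff) simp_all
    also have "(\<lambda>t. inverse D * (h t - g t)) = (\<lambda>t. th (2 \<cdot> t + c))"
      unfolding eq[symmetric] zsmul_2 using D by (simp add: mult.commute[of _ D] flip: mult.assoc)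
    finally show ?thesis unfolding 3 by simp
  qed
qed

end

section \<open>Coefficients of products of R-matrices in rank two\<close>

text \<open>
  A matrix \<open>(a, b, c, d)\<close> stands for a Weyl group element \<open>w\<close> with \<open>w \<alpha>\<^sub>i\<^sup>\<or> = a \<alpha>\<^sub>i\<^sup>\<or> + b \<alpha>\<^sub>j\<^sup>\<or>\<close> and
  \<open>w \<alpha>\<^sub>j\<^sup>\<or> = c \<alpha>\<^sub>i\<^sup>\<or> + d \<alpha>\<^sub>j\<^sup>\<or>\<close>; the index \<open>i\<close> is encoded as \<open>True\<close> and \<open>j\<close> as \<open>False\<close>. The integers
  \<open>p\<close> and \<open>p'\<close> are \<open>\<langle>\<alpha>\<^sub>i, \<alpha>\<^sub>j\<^sup>\<or>\<rangle>\<close> and \<open>\<langle>\<alpha>\<^sub>j, \<alpha>\<^sub>i\<^sup>\<or>\<rangle>\<close>, and \<open>Z\<close> contains the possible arguments of the \<open>h\<close>'s.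
  The factor 6 in \<open>lrow\<close> keeps the vectors of \<open>chain\<close>, fractional combinations of coroots, integral.
\<close>

type_synonym mat = "int \<times> int \<times> int \<times> int"

locale rank_two = theta_function th far
  for th :: "'g::ab_group_add \<Rightarrow> 'k::field" and far +
  fixes J :: "int \<times> int \<Rightarrow> 'g" and H :: 'g and Z :: "'g set" and p p' :: int
  assumes J_add: "J (u + v) = J u + J v"
    and Z_diff: "z \<in> Z \<Longrightarrow> z' \<in> Z \<Longrightarrow> z - z' \<in> Z"
    and th_J: "v \<noteq> 0 \<Longrightarrow> z \<in> Z \<Longrightarrow> th (J v + z) \<noteq> 0"
    and th_H: "z \<in> Z \<Longrightarrow> th (z + H) \<noteq> 0"
    and Z_0: "0 \<in> Z"
begin

lemma Z_minus: "z \<in> Z \<Longrightarrow> - z \<in> Z" using Z_diff[OF Z_0] by auto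
lemma Z_add: "z \<in> Z \<Longrightarrow> z' \<in> Z \<Longrightarrow> z + z' \<in> Z" using Z_diff[of z "- z'"] Z_minus by auto
lemmas Z_closed = Z_minus Z_add Z_diff

lemma Z_zsmul: "z \<in> Z \<Longrightarrow> n \<cdot> z \<in> Z"
proof (induction n rule: int_induct[of _ 0])
  case (step1 i) then show ?case by (simp add: zsmul_add_left Z_add)
next
  case (step2 i) then show ?case by (simp add: zsmul_diff_left Z_diff)
qed (simp add: Z_0)

lemma J_0: "J 0 = 0" using J_add[of 0 0] by simp
lemma J_minus: "J (- u) = - J u" using J_add[of u "- u"] J_0 by (simp add: eq_neg_iff_add_eq_0 add.commute)
lemma J_diff: "J (u - v) = J u - J v" using J_add[of u "- v"] J_minus by simp
lemma J_zsmul: "J (n \<cdot> u) = n \<cdot> J u" by (rule zsmul_hom) (rule J_add)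

fun row :: "bool \<Rightarrow> mat \<Rightarrow> int \<times> int" where
  "row True (a, b, c, d) = (a, b)"
| "row False (a, b, c, d) = (c, d)"

text \<open>Passage from the matrix of \<open>w\<close> to that of \<open>w\<close> times the simple
  reflection \<open>k\<close>: reflection \<open>i\<close> subtracts \<open>p\<close> times coroot
  \<open>i\<close> from coroot \<open>j\<close>, and reflection \<open>j\<close> subtracts
  \<open>p'\<close> times coroot \<open>j\<close> from coroot \<open>i\<close>. \<open>svec\<close>
  is the same reflection on coordinate vectors, to be moved across \<open>vmul\<close>.\<close>

fun rmul :: "bool \<Rightarrow> mat \<Rightarrow> mat" where
  "rmul True (a, b, c, d) = (- a, - b, c - p * a, d - p * b)"
| "rmul False (a, b, c, d) = (a - p' * c, b - p' * d, - c, - d)"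

fun svec :: "bool \<Rightarrow> int \<times> int \<Rightarrow> int \<times> int" where
  "svec True (x, y) = (- x - p * y, y)"
| "svec False (x, y) = (x, - y - p' * x)"

fun vmul :: "int \<times> int \<Rightarrow> mat \<Rightarrow> int \<times> int" where
  "vmul (x, y) (a, b, c, d) = (x * a + y * c, x * b + y * d)"

fun unit :: "bool \<Rightarrow> int \<times> int" where
  "unit True = (1, 0)" | "unit False = (0, 1)"

fun det :: "mat \<Rightarrow> int" where "det (a, b, c, d) = a * d - b * c"

definition lrow :: "bool \<Rightarrow> mat \<Rightarrow> 'g" where "lrow k M = J (6 \<cdot> row k M)"

lemma det_rmul: "det (rmul k M) = - det M"
  by (cases k; cases M) (auto simp: algebra_simps)

lemma rmul_rmul: "rmul k (rmul k M) = M"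
  by (cases k; cases M) auto

lemma vmul_rmul: "vmul v (rmul k M) = vmul (svec k v) M"
  by (cases k; cases M; cases v) (auto simp: algebra_simps)

lemma vmul_diff: "vmul (u - v) M = vmul u M - vmul v M"
  by (cases u; cases v; cases M) (auto simp: algebra_simps)

lemma vmul_unit: "vmul (n \<cdot> unit k) M = n \<cdot> row k M"
  by (cases k; cases M) (auto)

lemma row_rmul: "row k (rmul k M) = - row k M"
  by (cases k; cases M) auto

lemma lrow_rmul: "lrow k (rmul k M) = - lrow k M"
  unfolding lrow_def row_rmul zsmul_minus_right J_minus ..

lemma lrow_nz: "det M \<noteq> 0 \<Longrightarrow> th (lrow k M) \<noteq> 0"
proof -
  assume "det M \<noteq> 0"
  then have "6 \<cdot> row k M \<noteq> 0" by (cases k; cases M) (auto simp: zero_prod_def)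
  from th_J[OF this Z_0] show ?thesis by (simp add: lrow_def)
qed

text \<open>\<open>pc\<close> and \<open>qc\<close> are P and Q at the coroot image
  \<open>lrow k M\<close>, with \<open>th (z + H)\<close> removed from the denominator; what remains
  there does not involve \<open>z\<close>.\<close>

definition pc :: "bool \<Rightarrow> mat \<Rightarrow> 'g \<Rightarrow> 'k" where
  "pc k M z = th (lrow k M - z) * th H / th (lrow k M)"

definition qc :: "bool \<Rightarrow> mat \<Rightarrow> 'g \<Rightarrow> 'k" where
  "qc k M z = th (lrow k M + H) * th z / th (lrow k M)"

text \<open>
  The coefficient at \<open>M\<close> of a product of \<open>h\<close>'s. Words are reversed: the head of the list is the last
  factor of the product. The raw version omits the denominators \<open>th (z + H)\<close>.
\<close>

fun raw_coeff :: "(bool \<times> 'g) list \<Rightarrow> mat \<Rightarrow> 'k" where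
  "raw_coeff [] M = (if M = (1, 0, 0, 1) then 1 else 0)"
| "raw_coeff ((k, z) # zs) M = raw_coeff zs M * pc k M z + raw_coeff zs (rmul k M) * qc k M z"

fun word_coeff :: "(bool \<times> 'g) list \<Rightarrow> mat \<Rightarrow> 'k" where
  "word_coeff [] M = (if M = (1, 0, 0, 1) then 1 else 0)"
| "word_coeff ((k, z) # zs) M = (word_coeff zs M * pc k M z + word_coeff zs (rmul k M) * qc k M z) / th (z + H)"

lemma raw_coeff_word_coeff: "snd ` set zs \<subseteq> Z \<Longrightarrow> raw_coeff zs M = word_coeff zs M * (\<Prod>(k, z)\<leftarrow>zs. th (z + H))"
proof (induction zs arbitrary: M)
  case (Cons x zs)
  obtain k z where x: "x = (k, z)" by (cases x)
  have z: "th (z + H) \<noteq> 0" and zs: "snd ` set zs \<subseteq> Z" using Cons.prems x th_H by auto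
  show ?case using z unfolding x by (simp add: Cons.IH[OF zs] field_simps)
qed simp

definition eqv :: "(bool \<times> 'g) list \<Rightarrow> (bool \<times> 'g) list \<Rightarrow> bool" where
  "eqv zs zs' \<longleftrightarrow> (\<forall>M. det M \<noteq> 0 \<longrightarrow> word_coeff zs M = word_coeff zs' M)"

lemma eqv_trans: "eqv a b \<Longrightarrow> eqv b c \<Longrightarrow> eqv a c" by (simp add: eqv_def)
lemma eqv_sym: "eqv a b \<Longrightarrow> eqv b a" by (simp add: eqv_def)
lemma eqvD: "eqv a b \<Longrightarrow> det M \<noteq> 0 \<Longrightarrow> word_coeff a M = word_coeff b M" unfolding eqv_def by blast
lemma eqv_Cons: "eqv a b \<Longrightarrow> eqv (x # a) (x # b)"
proof -
  assume ab: "eqv a b"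
  obtain k z where x: "x = (k, z)" by (cases x)
  show ?thesis unfolding eqv_def x
  proof (intro allI impI)
    fix M assume M: "det M \<noteq> 0"
    then have "det (rmul k M) \<noteq> 0" by (simp add: det_rmul)
    note eqvD[OF ab this]
    then show "word_coeff ((k, z) # a) M = word_coeff ((k, z) # b) M"
      by (simp only: word_coeff.simps eqvD[OF ab M])
  qed
qed

lemma eqv_zero: "z = 0 \<Longrightarrow> eqv ((k, z) # zs) zs"
  using th_H[OF Z_0] by (auto simp: eqv_def pc_def qc_def th_0 lrow_nz)

text \<open>Of the four paths through the two letters, the two that carry the coefficient at
  \<open>M\<close> combine by \<open>theta_unitarity\<close>. The two that carry the coefficient at
  \<open>rmul k M\<close> cancel, because \<open>lrow k\<close> changes sign under
  \<open>rmul k\<close> and theta is odd.\<close>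

lemma eqv_unit:
  assumes "z \<in> Z" "z' = - z"
  shows "eqv ((k, z') # (k, z) # zs) zs"
  unfolding eqv_def
proof (intro allI impI)
  fix M assume M: "det M \<noteq> 0"
  define l where "l = lrow k M"
  have l: "th l \<noteq> 0" using lrow_nz[OF M] by (simp add: l_def)
  have l': "lrow k (rmul k M) = - l" by (simp add: lrow_rmul l_def)
  have e: "- l - z = - (l + z)" "- l + H = H - l" "l - - z = l + z" by simp_all
  have H1: "th (H + z) \<noteq> 0" "th (H - z) \<noteq> 0"
    using th_H[OF assms(1)] th_H[OF Z_minus[OF assms(1)]] by (simp_all add: add.commute)
  have p1: "pc k (rmul k M) z = th (l + z) * th H / th l" "qc k (rmul k M) z = - (th (H - l) * th z / th l)"
    "pc k M z = th (l - z) * th H / th l" "qc k M z = th (l + H) * th z / th l"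
    "pc k M (- z) = th (l + z) * th H / th l" "qc k M (- z) = - (th (l + H) * th z / th l)"
    unfolding pc_def qc_def l' l_def[symmetric] e th_minus by simp_all
  define A where "A = word_coeff zs M" define B where "B = word_coeff zs (rmul k M)"
  have "word_coeff ((k, z') # (k, z) # zs) M =
     ((A * pc k M z + B * qc k M z) / th (H + z) * pc k M (- z)
      + (B * pc k (rmul k M) z + A * qc k (rmul k M) z) / th (H + z) * qc k M (- z)) / th (H - z)"
    unfolding A_def B_def using assms(2) by (simp add: rmul_rmul add.commute)
  also have "\<dots> = (A * (pc k M z * pc k M (- z) + qc k (rmul k M) z * qc k M (- z))
      + B * (qc k M z * pc k M (- z) + pc k (rmul k M) z * qc k M (- z))) / (th (H + z) * th (H - z))"
    using H1 by (simp add: field_simps)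
  also have "qc k M z * pc k M (- z) + pc k (rmul k M) z * qc k M (- z) = 0"
    unfolding p1 by simp
  also have "pc k M z * pc k M (- z) + qc k (rmul k M) z * qc k M (- z) = th (H + z) * th (H - z)"
    unfolding p1 using theta_unitarity[OF l, of z H] by simp
  finally show "word_coeff ((k, z') # (k, z) # zs) M = word_coeff zs M" using H1 by (simp add: A_def)
qed

lemma eqv_cancel:
  "eqv zs ((k, z) # zs') \<Longrightarrow> z \<in> Z \<Longrightarrow> z' = - z \<Longrightarrow> eqv ((k, z') # zs) zs'"
  by (meson eqv_Cons eqv_trans eqv_unit)

text \<open>
  Here \<open>n\<close> is the multiplicity of \<open>x\<close> in the argument of \<open>h\<^sub>k\<close>. In a product of \<open>n\<^sup>2\<close> thetas, passing from
  \<open>P\<close> to \<open>Q\<close> moves the sum of the points by \<open>n\<close> times a coroot; the condition makes \<open>J (vmul u M)\<close> move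
  by the same amount, so that the sum depends on \<open>M\<close> only and not on the path that leads to \<open>M\<close>.
\<close>

fun chain :: "(bool \<times> int) list \<Rightarrow> int \<times> int \<Rightarrow> int \<times> int \<Rightarrow> bool" where
  "chain [] v u = (u = v)"
| "chain ((k, n) # ns) v u = (chain ns v (svec k u) \<and> svec k u - u = (6 * n) \<cdot> unit k)"

lemma svec_svec: "svec k (svec k v) = v"
  by (cases k; cases v) auto

lemma J_vmul_chain:
  assumes "svec k u - u = (6 * n) \<cdot> unit k"
  shows "J (vmul u M) = J (vmul (svec k u) M) - n \<cdot> lrow k M"
proof -
  have "vmul u M = vmul (svec k u - (6 * n) \<cdot> unit k) M" using assms by (simp add: algebra_simps)
  also have "\<dots> = vmul (svec k u) M - n \<cdot> (6 \<cdot> row k M)"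
    by (simp only: vmul_diff vmul_unit zsmul_assoc mult.commute)
  finally show ?thesis by (simp only: J_diff J_zsmul lrow_def)
qed

text \<open>In the applications \<open>t\<close> is \<open>x\<close> and the constants are multiples
  of \<open>y\<close>, so that a word becomes a function of one variable.\<close>

definition inst :: "'g \<Rightarrow> (bool \<times> nat \<times> 'g) list \<Rightarrow> (bool \<times> 'g) list" where
  "inst t ns = map (\<lambda>(k, n, c). (k, int n \<cdot> t + c)) ns"

text \<open>A factor P contributes \<open>n * n\<close> points with sum \<open>n\<close> times
  \<open>lrow k M - c\<close>, a factor Q equally many with sum \<open>- n\<close> times
  \<open>c\<close>. The \<open>chain\<close> condition lets \<open>J (vmul u M)\<close> absorb the
  difference, so both branches lie in one space and may be added. The empty word is nonzero only at
  the identity matrix, where \<open>u = v\<close> makes the sum 0.\<close>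

lemma raw_coeff_thf:
  assumes "chain (map (\<lambda>(k, n, c). (k, int n)) ns) v u" "\<forall>(k, n, c) \<in> set ns. n \<le> 2"
  shows "thf (\<Sum>(k, n, c)\<leftarrow>ns. n * n) (J v - (\<Sum>(k, n, c)\<leftarrow>ns. int n \<cdot> c) - J (vmul u M)) (\<lambda>t. raw_coeff (inst t ns) M)"
  using assms
proof (induction ns arbitrary: u M)
  case Nil
  show ?case
  proof (cases "M = (1, 0, 0, 1)")
    case True
    then have "vmul u M = u" by (cases u) auto
    then show ?thesis using Nil True thf_const[of 1] by (simp add: inst_def)
  next
    case False
    then show ?thesis by (simp add: inst_def thf.zero)
  qed
next
  case (Cons x ns)
  obtain k n c where x: "x = (k, n, c)" by (cases x)
  define N where "N = (\<Sum>(k, n, c)\<leftarrow>ns. n * n)"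
  define C where "C = (\<Sum>(k, n, c)\<leftarrow>ns. int n \<cdot> c)"
  have ch: "chain (map (\<lambda>(k, n, c). (k, int n)) ns) v (svec k u)" and u: "svec k u - u = (6 * int n) \<cdot> unit k"
    and n: "n \<le> 2" and ns: "\<forall>(k, n, c) \<in> set ns. n \<le> 2"
    using Cons.prems x by auto
  have IH: "thf N (J v - C - J (vmul (svec k u) M)) (\<lambda>t. raw_coeff (inst t ns) M)" for M
    using Cons.IH[OF ch ns] by (simp add: N_def C_def)
  have "thf (n * n) (- (int n \<cdot> (c - lrow k M))) (\<lambda>t. th H / th (lrow k M) * - 1 * th (int n \<cdot> t + (c - lrow k M)))"
    by (intro thf_cmult thf_th_scaled n)
  also have "(\<lambda>t. th H / th (lrow k M) * - 1 * th (int n \<cdot> t + (c - lrow k M))) = (\<lambda>t. pc k M (int n \<cdot> t + c))"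
  proof
    fix t
    have "th (lrow k M - (int n \<cdot> t + c)) = - th (int n \<cdot> t + (c - lrow k M))"
      using th_minus[of "int n \<cdot> t + (c - lrow k M)"] by (simp add: algebra_simps)
    then show "th H / th (lrow k M) * - 1 * th (int n \<cdot> t + (c - lrow k M)) = pc k M (int n \<cdot> t + c)"
      by (simp add: pc_def)
  qed
  finally have 1: "thf (N + n * n) (J v - C - J (vmul (svec k u) M) + - (int n \<cdot> (c - lrow k M)))
      (\<lambda>t. raw_coeff (inst t ns) M * pc k M (int n \<cdot> t + c))" by (rule thf_mult[OF IH])
  have "thf (n * n) (- (int n \<cdot> c)) (\<lambda>t. th (lrow k M + H) / th (lrow k M) * th (int n \<cdot> t + c))"
    by (intro thf_cmult thf_th_scaled n)
  also have "(\<lambda>t. th (lrow k M + H) / th (lrow k M) * th (int n \<cdot> t + c)) = (\<lambda>t. qc k M (int n \<cdot> t + c))"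
    by (simp add: qc_def fun_eq_iff)
  finally have 2: "thf (N + n * n) (J v - C - J (vmul (svec k u) (rmul k M)) + - (int n \<cdot> c))
      (\<lambda>t. raw_coeff (inst t ns) (rmul k M) * qc k M (int n \<cdot> t + c))" by (rule thf_mult[OF IH])
  have e1: "J v - C - J (vmul (svec k u) M) + - (int n \<cdot> (c - lrow k M)) = J v - (int n \<cdot> c + C) - J (vmul u M)"
    unfolding J_vmul_chain[OF u] zsmul_diff_right by (simp add: algebra_simps)
  have e2: "J v - C - J (vmul (svec k u) (rmul k M)) + - (int n \<cdot> c) = J v - (int n \<cdot> c + C) - J (vmul u M)"
    unfolding vmul_rmul svec_svec by (simp add: algebra_simps)
  have "thf (N + n * n) (J v - (int n \<cdot> c + C) - J (vmul u M)) (\<lambda>t. raw_coeff (inst t (x # ns)) M)"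
    using thf.add[OF 1[unfolded e1] 2[unfolded e2]] by (simp add: x inst_def)
  then show ?case by (simp add: x N_def C_def add.commute)
qed

lemma sum_list_mset_cong:
  fixes xs ys :: "('b \<times> 'c) list" and f :: "'c \<Rightarrow> 'a::comm_monoid_add"
  assumes "mset (map snd xs) = mset (map snd ys)"
  shows "(\<Sum>(k, r)\<leftarrow>xs. f r) = (\<Sum>(k, r)\<leftarrow>ys. f r)"
proof -
  have "(\<Sum>(k, r)\<leftarrow>zs. f r) = sum_mset (image_mset f (mset (map snd zs)))" for zs :: "('b \<times> 'c) list"
    by (induction zs) auto
  then show ?thesis by (simp only: assms)
qed

lemma prod_list_mset_cong:
  fixes xs ys :: "('b \<times> 'c) list" and f :: "'c \<Rightarrow> 'a::comm_monoid_mult"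
  assumes "mset (map snd xs) = mset (map snd ys)"
  shows "(\<Prod>(k, r)\<leftarrow>xs. f r) = (\<Prod>(k, r)\<leftarrow>ys. f r)"
proof -
  have "(\<Prod>(k, r)\<leftarrow>zs. f r) = prod_mset (image_mset f (mset (map snd zs)))" for zs :: "('b \<times> 'c) list"
    by (induction zs) auto
  then show ?thesis by (simp only: assms)
qed

lemma snd_set_mset_cong: "mset (map snd xs) = mset (map snd ys) \<Longrightarrow> snd ` set xs = snd ` set ys"
  by (metis list.set_map set_mset_mset)

lemma raw_coeff_eq_if_eqv:
  assumes "eqv zs zs'" "mset (map snd zs) = mset (map snd zs')" "snd ` set zs \<subseteq> Z" "det M \<noteq> 0"
  shows "raw_coeff zs M = raw_coeff zs' M"
  using eqvD[OF assms(1,4)] assms(3) prod_list_mset_cong[OF assms(2), of "\<lambda>z. th (z + H)"] snd_set_mset_cong[OF assms(2)]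
  by (simp add: raw_coeff_word_coeff)

lemma word_coeff_eq_if_raw:
  assumes "raw_coeff zs M = raw_coeff zs' M" "mset (map snd zs) = mset (map snd zs')" "snd ` set zs \<subseteq> Z"
  shows "word_coeff zs M = word_coeff zs' M"
proof -
  have "(\<Prod>(k, z)\<leftarrow>zs. th (z + H)) \<noteq> 0"
    using assms(3) th_H by (auto simp: prod_list_zero_iff)
  then show ?thesis
    using assms(1,3) prod_list_mset_cong[OF assms(2), of "\<lambda>z. th (z + H)"] snd_set_mset_cong[OF assms(2)]
    by (simp add: raw_coeff_word_coeff)
qed

lemma inst_mset: "mset (map snd ns) = mset (map snd ms) \<Longrightarrow> mset (map snd (inst t ns)) = mset (map snd (inst t ms))"
proof -
  have "map snd (inst t ns) = map (\<lambda>(n, c). int n \<cdot> t + c) (map snd ns)" for ns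
    by (induction ns) (auto simp: inst_def)
  then show "mset (map snd ns) = mset (map snd ms) \<Longrightarrow> mset (map snd (inst t ns)) = mset (map snd (inst t ms))"
    by (simp only: mset_map)
qed

lemma inst_Z: "t \<in> Z \<Longrightarrow> (\<lambda>(k, n, c). c) ` set ns \<subseteq> Z \<Longrightarrow> snd ` set (inst t ns) \<subseteq> Z"
  by (auto simp: inst_def Z_add Z_zsmul)

lemma Z_sum_list: "set xs \<subseteq> Z \<Longrightarrow> sum_list xs \<in> Z"
  by (induction xs) (auto simp: Z_0 Z_add)

text \<open>The difference of the two raw coefficients vanishes at all points of \<open>as\<close>,
  and its own sum differs from theirs by \<open>J (v - vmul u M)\<close> plus an element of
  \<open>Z\<close>. When \<open>vmul u M\<close> is not \<open>v\<close>, theta is nonzero at this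
  discrepancy and \<open>thf_eq_0\<close> applies.\<close>

lemma word_identity:
  assumes "chain (map (\<lambda>(k, n, c). (k, int n)) ns) v u" "chain (map (\<lambda>(k, n, c). (k, int n)) ms) v u"
    and ms: "mset (map snd ns) = mset (map snd ms)"
    and n: "\<forall>(k, n, c) \<in> set ns. n \<le> 2" "\<forall>(k, n, c) \<in> set ms. n \<le> 2"
    and c: "(\<lambda>(k, n, c). c) ` set ns \<subseteq> Z"
    and M: "det M \<noteq> 0" "vmul u M \<noteq> v"
    and as: "set as \<subseteq> Z" "length as = (\<Sum>(k, n, c)\<leftarrow>ns. n * n)" "as \<noteq> []"
      "sorted_wrt (\<lambda>a b. th (b - a) \<noteq> 0) as"
    and eq: "\<And>a. a \<in> set as \<Longrightarrow> raw_coeff (inst a ns) M = raw_coeff (inst a ms) M"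
    and t: "t \<in> Z"
  shows "word_coeff (inst t ns) M = word_coeff (inst t ms) M"
proof -
  define C where "C = (\<Sum>(k, n, c)\<leftarrow>ns. int n \<cdot> c)"
  define f where "f t = raw_coeff (inst t ns) M - raw_coeff (inst t ms) M" for t
  have e: "(\<Sum>(k, n, c)\<leftarrow>ms. n * n) = (\<Sum>(k, n, c)\<leftarrow>ns. n * n)" "(\<Sum>(k, n, c)\<leftarrow>ms. int n \<cdot> c) = C"
    unfolding C_def by (rule sum_list_mset_cong[OF sym[OF ms]])+
  have CZ: "C \<in> Z" unfolding C_def
    by (rule Z_sum_list) (use c in \<open>auto intro!: Z_zsmul\<close>)
  have "thf (\<Sum>(k, n, c)\<leftarrow>ns. n * n) (J v - C - J (vmul u M)) f"
    unfolding f_def C_def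
    by (rule thf_diff[OF raw_coeff_thf[OF assms(1) n(1)] raw_coeff_thf[OF assms(2) n(2), unfolded e, unfolded C_def]])
  moreover have "th (J v - C - J (vmul u M) - sum_list as) \<noteq> 0"
  proof -
    have e: "J v - C - J (vmul u M) - sum_list as = J (v - vmul u M) + (- C - sum_list as)"
      by (simp add: J_diff)
    show ?thesis unfolding e
      by (rule th_J) (use M Z_diff[OF Z_minus[OF CZ] Z_sum_list[OF as(1)]] in auto)
  qed
  ultimately have "f t = 0"
    using thf_eq_0[of as _ f t] as(2-4) eq by (simp add: f_def)
  then have "raw_coeff (inst t ns) M = raw_coeff (inst t ms) M" by (simp add: f_def)
  then show ?thesis by (rule word_coeff_eq_if_raw[OF _ inst_mset[OF ms] inst_Z[OF t c]])
qed

text \<open>Iteration produces values of the character \<open>E\<close> at multiples of the period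
  itself; they are independent of \<open>u\<close> and go into \<open>C\<close>.\<close>

lemma quasi_period_multiple:
  assumes E: "\<And>u v. E (u + v) = E u * E v" "\<And>u. E u \<noteq> 0" and "c \<noteq> 0" and per: "\<And>u. th (u + \<Omega>) = c * E u * th u"
  shows "\<exists>C. \<forall>u. th (u + n \<cdot> \<Omega>) = C * E (n \<cdot> u) * th u"
proof (induction n rule: int_induct[of _ 0])
  case base
  have "E 0 = 1" using E(1)[of 0 0] E(2)[of 0] by simp
  then show ?case by (intro exI[of _ 1]) simp
next
  case (step1 i)
  then obtain C where C: "\<And>u. th (u + i \<cdot> \<Omega>) = C * E (i \<cdot> u) * th u" by blast
  have "th (u + (i + 1) \<cdot> \<Omega>) = (c * E (i \<cdot> \<Omega>) * C) * E ((i + 1) \<cdot> u) * th u" for u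
    using per[of "u + i \<cdot> \<Omega>"] by (simp add: zsmul_add_left C E mult_ac add.assoc)
  then show ?case by blast
next
  case (step2 i)
  then obtain C where C: "\<And>u. th (u + i \<cdot> \<Omega>) = C * E (i \<cdot> u) * th u" by blast
  have "th (u + (i - 1) \<cdot> \<Omega>) = (C / (c * E ((i - 1) \<cdot> \<Omega>))) * E ((i - 1) \<cdot> u) * th u" for u
  proof -
    have "C * E (i \<cdot> u) * th u = c * E (u + (i - 1) \<cdot> \<Omega>) * th (u + (i - 1) \<cdot> \<Omega>)"
      using per[of "u + (i - 1) \<cdot> \<Omega>"] C[of u] by (simp add: zsmul_diff_left)
    moreover have "E (i \<cdot> u) = E ((i - 1) \<cdot> u) * E u" by (simp add: zsmul_diff_left flip: E(1))
    ultimately show ?thesis using E(2) \<open>c \<noteq> 0\<close> by (simp add: E(1) field_simps)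
  qed
  then show ?case by blast
qed

text \<open>The multiplier of a shifted word is the same along all paths, for the reason behind
  \<open>raw_coeff_thf\<close>: the value of \<open>E\<close> at \<open>n\<close> times
  \<open>lrow k M\<close> that P picks up is balanced by \<open>E (J (vmul u M))\<close>. Here
  \<open>n\<close> is a component of a direction of shift and may be negative.\<close>

lemma raw_coeff_shift:
  assumes E: "\<And>u v. E (u + v) = E u * E v" and C: "\<And>n u. th (u + n \<cdot> \<Omega>) = C n * E (n \<cdot> u) * th u"
    and "chain (map (\<lambda>(k, n, z). (k, n)) zs) v u"
  shows "raw_coeff (map (\<lambda>(k, n, z). (k, z + n \<cdot> \<Omega>)) zs) M * E (J v) =
    (\<Prod>(k, n, z)\<leftarrow>zs. C n * E (n \<cdot> z)) * E (J (vmul u M)) * raw_coeff (map (\<lambda>(k, n, z). (k, z)) zs) M"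
  using assms(3)
proof (induction zs arbitrary: u M)
  case Nil
  show ?case
  proof (cases "M = (1, 0, 0, 1)")
    case True
    then have "vmul u M = u" by (cases u) auto
    then show ?thesis using Nil True by simp
  qed simp
next
  case (Cons x zs)
  obtain k n z where x: "x = (k, n, z)" by (cases x)
  have ch: "chain (map (\<lambda>(k, n, z). (k, n)) zs) v (svec k u)" and u: "svec k u - u = (6 * n) \<cdot> unit k"
    using Cons.prems x by auto
  define D where "D = (\<Prod>(k, n, z)\<leftarrow>zs. C n * E (n \<cdot> z))"
  define F where "F M = raw_coeff (map (\<lambda>(k, n, z). (k, z + n \<cdot> \<Omega>)) zs) M" for M
  define G where "G M = raw_coeff (map (\<lambda>(k, n, z). (k, z)) zs) M" for M
  define l where "l = lrow k M"
  have IH: "F M * E (J v) = D * E (J (vmul (svec k u) M)) * G M" for M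
    using Cons.IH[OF ch] by (simp add: D_def F_def G_def)
  have p: "E (J (vmul (svec k u) M)) * pc k M (z + n \<cdot> \<Omega>) = C n * E (n \<cdot> z) * E (J (vmul u M)) * pc k M z"
  proof -
    have "th (l - (z + n \<cdot> \<Omega>)) = - th (z - l + n \<cdot> \<Omega>)"
      using th_minus[of "z - l + n \<cdot> \<Omega>"] by (simp add: algebra_simps)
    also have "\<dots> = C n * E (n \<cdot> (z - l)) * th (l - z)"
      using th_minus[of "l - z"] by (simp add: C)
    finally have "E (J (vmul (svec k u) M)) * th (l - (z + n \<cdot> \<Omega>)) =
        C n * (E (n \<cdot> (z - l)) * E (J (vmul (svec k u) M))) * th (l - z)" by simp
    also have "E (n \<cdot> (z - l)) * E (J (vmul (svec k u) M)) = E (n \<cdot> z) * E (J (vmul u M))"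
      unfolding J_vmul_chain[OF u] E[symmetric] by (simp add: l_def zsmul_diff_right algebra_simps)
    finally show ?thesis by (simp add: pc_def l_def)
  qed
  have q: "E (J (vmul (svec k u) (rmul k M))) * qc k M (z + n \<cdot> \<Omega>) = C n * E (n \<cdot> z) * E (J (vmul u M)) * qc k M z"
    by (simp add: qc_def C vmul_rmul svec_svec)
  have "(F M * pc k M (z + n \<cdot> \<Omega>) + F (rmul k M) * qc k M (z + n \<cdot> \<Omega>)) * E (J v) =
     D * G M * (E (J (vmul (svec k u) M)) * pc k M (z + n \<cdot> \<Omega>))
     + D * G (rmul k M) * (E (J (vmul (svec k u) (rmul k M))) * qc k M (z + n \<cdot> \<Omega>))"
  proof -
    have "(F M * a + F (rmul k M) * b) * E (J v) = (F M * E (J v)) * a + (F (rmul k M) * E (J v)) * b" for a b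
      by (simp add: algebra_simps)
    note d = this
    show ?thesis unfolding d IH by (simp only: mult_ac)
  qed
  also have "\<dots> = C n * E (n \<cdot> z) * D * E (J (vmul u M)) * (G M * pc k M z + G (rmul k M) * qc k M z)"
    unfolding p q by (simp add: algebra_simps)
  finally show ?case by (simp add: x F_def G_def D_def)
qed

end

section \<open>Yang-Baxter identities between coefficients in types A2, B2 and G2\<close>

text \<open>This set and the next two are the orbits of the identity matrix under
  \<open>rmul\<close> for \<open>(p, p')\<close> equal to \<open>(-1, -1)\<close>,
  \<open>(-2, -1)\<close> and \<open>(-3, -1)\<close>: Weyl groups of orders 6, 8 and 12 in coroot
  coordinates.\<close>

definition dihedral_A2 :: "mat set" where
  "dihedral_A2 = {(1, 0, 0, 1), (- 1, 0, 1, 1), (1, 1, 0, - 1), (0, 1, - 1, - 1), (- 1, - 1, 1, 0), (0, - 1, - 1, 0)}"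

definition dihedral_B2 :: "mat set" where
  "dihedral_B2 = {(1, 0, 0, 1), (- 1, 0, 2, 1), (1, 1, 0, - 1), (1, 1, - 2, - 1), (- 1, - 1, 2, 1), (- 1, - 1, 0, 1), (1, 0, - 2, - 1), (- 1, 0, 0, - 1)}"

definition dihedral_G2 :: "mat set" where
  "dihedral_G2 = {(1, 0, 0, 1), (- 1, 0, 3, 1), (1, 1, 0, - 1), (2, 1, - 3, - 1), (- 1, - 1, 3, 2), (- 2, - 1, 3, 2), (2, 1, - 3, - 2), (1, 1, - 3, - 2), (- 2, - 1, 3, 1), (- 1, - 1, 0, 1), (1, 0, - 3, - 1), (- 1, 0, 0, - 1)}"

lemma zsmul_numerals: "(- 1) \<cdot> x = - x" "3 \<cdot> x = x + x + x" "4 \<cdot> x = x + x + x + x" "6 \<cdot> x = x + x + x + x + x + x"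
  using zsmul_minus_left[of 1 x] zsmul_add_left[of 2 1 x] zsmul_add_left[of 2 2 x] zsmul_add_left[of 4 2 x]
  by (simp_all add: zsmul_2 add.assoc)

text \<open>The values of \<open>om\<close> are half-periods.\<close>

locale rank_two_half = rank_two th far J H Z p p'
  for th :: "'g::ab_group_add \<Rightarrow> 'k::field" and far J H Z p p' +
  fixes om :: "int \<times> int \<Rightarrow> 'g"
  assumes om_add: "om (v + w) = om v + om w" and om_Z: "om w \<in> Z"
    and th_om: "odd a \<or> odd b \<Longrightarrow> th (om (a, b)) \<noteq> 0"
    and quasi_period: "\<exists>E c. (\<forall>u v. E (u + v) = E u * E v) \<and> (\<forall>u. E u \<noteq> 0) \<and> c \<noteq> 0 \<and>
      (\<forall>u. th (u + (om w + om w)) = c * E u * th u)"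

context rank_two begin

lemma eqv_both: "eqv a c \<Longrightarrow> eqv b c \<Longrightarrow> eqv a b"
  using eqv_sym eqv_trans by blast

text \<open>For fixed \<open>y\<close> the degree in \<open>x\<close> is 2, and the difference
  vanishes at \<open>x = 0\<close> and \<open>x = - y\<close>. These zeros coincide for
  \<open>y = 0\<close>; then, however, each word has an end letter with argument 0 and both reduce
  to the same word.\<close>

lemma word_coeff_A2:
  assumes pp: "p = - 1" "p' = - 1" and M: "M \<in> dihedral_A2"
    and x: "x \<in> Z" and y: "y \<in> Z" and y0: "y = 0 \<or> th y \<noteq> 0"
  shows "word_coeff [(True, y), (False, x + y), (True, x)] M = word_coeff [(False, x), (True, x + y), (False, y)] M"
proof -
  have rmul: "rmul True (a, b, c, d) = (- a, - b, c + a, d + b)" "rmul False (a, b, c, d) = (a + c, b + d, - c, - d)" for a b c d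
    by simp_all (simp_all add: pp)
  have det: "det M \<noteq> 0" using M by (auto simp: dihedral_A2_def)
  define ns where "ns = [(True, 0::nat, y), (False, 1, y), (True, 1, 0)]"
  define ms where "ms = [(False, 1::nat, 0), (True, 1, y), (False, 0, y)]"
  have inst: "inst t ns = [(True, y), (False, t + y), (True, t)]" "inst t ms = [(False, t), (True, t + y), (False, y)]" for t
    by (simp_all add: inst_def ns_def ms_def)
  have z: "eqv [(True, 0), (False, x), (True, x)] [(False, x), (True, x), (False, 0)]"
    by (rule eqv_both[OF eqv_zero eqv_Cons[OF eqv_Cons[OF eqv_zero]]]) (simp_all add: y Z_closed)
  have p0: "eqv [(True, y), (False, y), (True, 0)] [(False, 0), (True, y), (False, y)]"
    by (rule eqv_both[OF eqv_Cons[OF eqv_Cons[OF eqv_zero]] eqv_zero]) (simp_all add: y Z_closed)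
  have p1: "eqv [(True, y), (False, 0), (True, - y)] [(False, - y), (True, 0), (False, y)]"
    by (rule eqv_both[OF eqv_cancel[OF eqv_zero _ _] eqv_cancel[OF eqv_zero _ _]]) (simp_all add: y Z_closed)
  show ?thesis
  proof (cases "y = 0")
    case True
    then show ?thesis using eqvD[OF z det] by simp
  next
    case False
    then have thy: "th y \<noteq> 0" using y0 by simp
    \<comment> \<open>\<open>(4, 2)\<close> is six times the fundamental coweight of the simple root
      \<open>i\<close>, and \<open>(- 2, - 4)\<close> its image under the longest element. The
      stabilizer of that coweight has two elements, whence two exceptional matrices: the longest
      element and one element of length 2.\<close>
    have "vmul (- 2, - 4) M \<noteq> (4, 2) \<or> M = (0, - 1, - 1, 0) \<or> M = (0, 1, - 1, - 1)"
      using M by (auto simp: dihedral_A2_def)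
    then consider (a) "vmul (- 2, - 4) M \<noteq> (4, 2)" | (b) "M = (0, - 1, - 1, 0)" | (c) "M = (0, 1, - 1, - 1)" by blast
    then show ?thesis
    proof cases
      case a
      have ch: "chain (map (\<lambda>(k, n, c). (k, int n)) ns) (4, 2) (- 2, - 4)" "chain (map (\<lambda>(k, n, c). (k, int n)) ms) (4, 2) (- 2, - 4)"
        by (simp_all add: ns_def ms_def) (simp_all add: pp)
      have mset: "mset (map snd ns) = mset (map snd ms)" by (simp add: ns_def ms_def)
      have "word_coeff (inst x ns) M = word_coeff (inst x ms) M"
      proof (rule word_identity[where as = "[0, - y]", OF ch mset _ _ _ det a _ _ _ _ _ x])
        fix t assume t: "t \<in> set [0, - y]"
        then have "eqv (inst t ns) (inst t ms)" using p0 p1 by (auto simp: inst)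
        then show "raw_coeff (inst t ns) M = raw_coeff (inst t ms) M"
          by (rule raw_coeff_eq_if_eqv[OF _ inst_mset[OF mset] inst_Z det]) (use t y Z_0 Z_minus in \<open>auto simp: ns_def\<close>)
      qed (use y Z_0 Z_minus thy in \<open>auto simp: ns_def ms_def th_minus\<close>)
      then show ?thesis by (simp add: inst)
    next
      case b
      show ?thesis unfolding b by (simp add: rmul pc_def qc_def lrow_def add.commute mult_ac del: rmul.simps)
    next
      case c
      show ?thesis unfolding c by (simp add: rmul pc_def qc_def lrow_def add.commute mult_ac del: rmul.simps)
    qed
  qed
qed

text \<open>The three letters that contain \<open>x\<close> give the zeros \<open>0\<close>,
  \<open>- y\<close> and \<open>- y - y\<close>; their differences are \<open>y\<close> and
  \<open>y + y\<close> up to sign, where theta must not vanish.\<close>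

lemma word_coeff_B2:
  assumes pp: "p = - 2" "p' = - 1" and M: "M \<in> dihedral_B2"
    and x: "x \<in> Z" and y: "y \<in> Z" and y0: "y = 0 \<or> th y \<noteq> 0 \<and> th (y + y) \<noteq> 0"
  shows "word_coeff [(False, y), (True, x + (y + y)), (False, x + y), (True, x)] M
       = word_coeff [(True, x), (False, x + y), (True, x + (y + y)), (False, y)] M"
proof -
  have rmul: "rmul True (a, b, c, d) = (- a, - b, c + 2 * a, d + 2 * b)" "rmul False (a, b, c, d) = (a + c, b + d, - c, - d)" for a b c d
    by simp_all (simp_all add: pp)
  have det: "det M \<noteq> 0" using M by (auto simp: dihedral_B2_def)
  define ns where "ns = [(False, 0::nat, y), (True, 1, y + y), (False, 1, y), (True, 1, 0)]"
  define ms where "ms = [(True, 1::nat, 0), (False, 1, y), (True, 1, y + y), (False, 0, y)]"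
  have inst: "inst t ns = [(False, y), (True, t + (y + y)), (False, t + y), (True, t)]"
    "inst t ms = [(True, t), (False, t + y), (True, t + (y + y)), (False, y)]" for t
    by (simp_all add: inst_def ns_def ms_def)
  have z: "eqv [(False, 0), (True, x), (False, x), (True, x)] [(True, x), (False, x), (True, x), (False, 0)]"
    by (rule eqv_both[OF eqv_zero eqv_Cons[OF eqv_Cons[OF eqv_Cons[OF eqv_zero]]]]) (simp_all add: y Z_closed)
  have p0: "eqv [(False, y), (True, y + y), (False, y), (True, 0)] [(True, 0), (False, y), (True, y + y), (False, y)]"
    by (rule eqv_both[OF eqv_Cons[OF eqv_Cons[OF eqv_Cons[OF eqv_zero]]] eqv_zero]) (simp_all add: y Z_closed)
  have p1: "eqv [(False, y), (True, y), (False, 0), (True, - y)] [(True, - y), (False, 0), (True, y), (False, y)]"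
    by (rule eqv_both[OF eqv_Cons[OF eqv_cancel[OF eqv_zero _ _]] eqv_cancel[OF eqv_zero _ _]]) (simp_all add: y Z_closed)
  have p2: "eqv [(False, y), (True, 0), (False, - y), (True, - y - y)] [(True, - y - y), (False, - y), (True, 0), (False, y)]"
    by (rule eqv_both[OF eqv_cancel[OF eqv_zero _ _] eqv_Cons[OF eqv_cancel[OF eqv_zero _ _]]]) (simp_all add: y Z_closed)
  show ?thesis
  proof (cases "y = 0")
    case True
    then show ?thesis using eqvD[OF z det] by simp
  next
    case False
    then have thy: "th y \<noteq> 0" "th (y + y) \<noteq> 0" using y0 by auto
    then have thy': "th (- y - y) \<noteq> 0" using th_minus[of "y + y"] by simp
    \<comment> \<open>\<open>(6, 3)\<close> is again six times the fundamental coweight of the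
      simple root \<open>i\<close>. The longest element is now minus the identity, so it sends the
      coweight to its negative.\<close>
    have "vmul (- 6, - 3) M \<noteq> (6, 3) \<or> M = (- 1, - 1, 0, 1) \<or> M = (- 1, 0, 0, - 1)"
      using M by (auto simp: dihedral_B2_def)
    then consider (a) "vmul (- 6, - 3) M \<noteq> (6, 3)" | (b) "M = (- 1, - 1, 0, 1)" | (c) "M = (- 1, 0, 0, - 1)" by blast
    then show ?thesis
    proof cases
      case a
      have ch: "chain (map (\<lambda>(k, n, c). (k, int n)) ns) (6, 3) (- 6, - 3)" "chain (map (\<lambda>(k, n, c). (k, int n)) ms) (6, 3) (- 6, - 3)"
        by (simp_all add: ns_def ms_def) (simp_all add: pp)
      have mset: "mset (map snd ns) = mset (map snd ms)" by (simp add: ns_def ms_def)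
      have "word_coeff (inst x ns) M = word_coeff (inst x ms) M"
      proof (rule word_identity[where as = "[0, - y, - y - y]", OF ch mset _ _ _ det a _ _ _ _ _ x])
        fix t assume t: "t \<in> set [0, - y, - y - y]"
        then have "eqv (inst t ns) (inst t ms)" using p0 p1 p2 by (auto simp: inst)
        then show "raw_coeff (inst t ns) M = raw_coeff (inst t ms) M"
          by (rule raw_coeff_eq_if_eqv[OF _ inst_mset[OF mset] inst_Z det])
            (use t y Z_0 Z_closed in \<open>auto simp: ns_def\<close>)
      qed (use y Z_0 Z_closed thy thy' in \<open>auto simp: ns_def ms_def th_minus\<close>)
      then show ?thesis by (simp add: inst)
    next
      case b
      show ?thesis unfolding b by (simp add: rmul pc_def qc_def lrow_def add.commute mult_ac del: rmul.simps)
    next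
      case c
      show ?thesis unfolding c by (simp add: rmul pc_def qc_def lrow_def add.commute mult_ac del: rmul.simps)
    qed
  qed
qed

end

context rank_two_half begin

lemma om_0: "om 0 = 0" using om_add[of 0 0] by simp
lemma om_diff: "om (v - w) = om v - om w" using om_add[of "v - w" w] by simp

text \<open>Both words contain the same pairs of multiplicity and argument and share their
  \<open>chain\<close> vectors, so the shift multiplies both coefficients by the same
  factor.\<close>

lemma raw_coeff_shift_eq:
  assumes eqv: "eqv (map (\<lambda>(k, n, z). (k, z)) zs) (map (\<lambda>(k, n, z). (k, z)) zs')"
    and ch: "chain (map (\<lambda>(k, n, z). (k, n)) zs) v u" "chain (map (\<lambda>(k, n, z). (k, n)) zs') v u"
    and ms: "mset (map snd zs) = mset (map snd zs')" and Z: "(\<lambda>(k, n, z). z) ` set zs \<subseteq> Z" and M: "det M \<noteq> 0"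
  shows "raw_coeff (map (\<lambda>(k, n, z). (k, z + n \<cdot> (om w + om w))) zs) M
       = raw_coeff (map (\<lambda>(k, n, z). (k, z + n \<cdot> (om w + om w))) zs') M"
proof -
  obtain E c where E: "\<And>u v. E (u + v) = E u * E v" "\<And>u. E u \<noteq> 0" and c: "c \<noteq> 0"
    and per: "\<And>u. th (u + (om w + om w)) = c * E u * th u" using quasi_period[of w] by blast
  have "\<forall>n. \<exists>C. \<forall>u. th (u + n \<cdot> (om w + om w)) = C * E (n \<cdot> u) * th u"
    using quasi_period_multiple[of E c, OF E c per] by blast
  then obtain C where C: "\<And>n u. th (u + n \<cdot> (om w + om w)) = C n * E (n \<cdot> u) * th u" by metis
  have snd: "map snd (map (\<lambda>(k, n, z). (k, z)) zs) = map snd (map snd zs)" for zs :: "(bool \<times> int \<times> 'g) list"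
    by (induction zs) auto
  have "mset (map snd (map (\<lambda>(k, n, z). (k, z)) zs)) = mset (map snd (map (\<lambda>(k, n, z). (k, z)) zs'))"
    unfolding snd mset_map[of snd "map snd _"] ms ..
  then have "raw_coeff (map (\<lambda>(k, n, z). (k, z)) zs) M = raw_coeff (map (\<lambda>(k, n, z). (k, z)) zs') M"
    by (rule raw_coeff_eq_if_eqv[OF eqv _ _ M]) (use Z in force)
  moreover have "(\<Prod>(k, n, z)\<leftarrow>zs. C n * E (n \<cdot> z)) = (\<Prod>(k, n, z)\<leftarrow>zs'. C n * E (n \<cdot> z))"
    by (rule prod_list_mset_cong[OF ms])
  ultimately have "raw_coeff (map (\<lambda>(k, n, z). (k, z + n \<cdot> (om w + om w))) zs) M * E (J v)
       = raw_coeff (map (\<lambda>(k, n, z). (k, z + n \<cdot> (om w + om w))) zs') M * E (J v)"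
    unfolding raw_coeff_shift[OF E(1) C ch(1)] raw_coeff_shift[OF E(1) C ch(2)] by simp
  then show ?thesis using E(2) by simp
qed

text \<open>The letters containing \<open>x\<close> have multiplicities 1, 1, 2, 1, 1, so the degree
  is 8. The arguments of multiplicity 1 give four zeros. The argument \<open>2 x + 3 y\<close> is
  zero up to a period at the points \<open>- 3 h + om w\<close>, which is why \<open>y\<close> is
  given as twice \<open>h\<close>.\<close>

lemma word_coeff_G2:
  assumes pp: "p = - 3" "p' = - 1" and M: "M \<in> dihedral_G2"
    and x: "x \<in> Z" and h: "h \<in> Z" and y: "y = h + h"
    and h0: "h = 0 \<or> (\<forall>n w. n \<noteq> 0 \<longrightarrow> th (n \<cdot> h + om w) \<noteq> 0)"
  shows "word_coeff [(False, y), (True, x + (y + y + y)), (False, x + (y + y)), (True, x + x + (y + y + y)), (False, x + y), (True, x)] M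
       = word_coeff [(True, x), (False, x + y), (True, x + x + (y + y + y)), (False, x + (y + y)), (True, x + (y + y + y)), (False, y)] M"
proof -
  have yZ: "y \<in> Z" using h y Z_add by simp
  have rmul: "rmul True (a, b, c, d) = (- a, - b, c + 3 * a, d + 3 * b)" "rmul False (a, b, c, d) = (a + c, b + d, - c, - d)" for a b c d
    by simp_all (simp_all add: pp)
  have det: "det M \<noteq> 0" using M by (auto simp: dihedral_G2_def)
  define ns where "ns = [(False, 0::nat, y), (True, 1, y + y + y), (False, 1, y + y), (True, 2, y + y + y), (False, 1, y), (True, 1, 0)]"
  define ms where "ms = [(True, 1::nat, 0), (False, 1, y), (True, 2, y + y + y), (False, 1, y + y), (True, 1, y + y + y), (False, 0, y)]"
  have inst: "inst t ns = [(False, y), (True, t + (y + y + y)), (False, t + (y + y)), (True, t + t + (y + y + y)), (False, t + y), (True, t)]"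
    "inst t ms = [(True, t), (False, t + y), (True, t + t + (y + y + y)), (False, t + (y + y)), (True, t + (y + y + y)), (False, y)]" for t
    by (simp_all add: inst_def ns_def ms_def zsmul_2)
  have z: "eqv [(False, 0), (True, x), (False, x), (True, x + x), (False, x), (True, x)] [(True, x), (False, x), (True, x + x), (False, x), (True, x), (False, 0)]"
    by (rule eqv_both[OF eqv_zero eqv_Cons[OF eqv_Cons[OF eqv_Cons[OF eqv_Cons[OF eqv_Cons[OF eqv_zero]]]]]]) (simp_all add: yZ Z_closed)
  have p0: "eqv [(False, y), (True, y + y + y), (False, y + y), (True, y + y + y), (False, y), (True, 0)] [(True, 0), (False, y), (True, y + y + y), (False, y + y), (True, y + y + y), (False, y)]"
    by (rule eqv_both[OF eqv_Cons[OF eqv_Cons[OF eqv_Cons[OF eqv_Cons[OF eqv_Cons[OF eqv_zero]]]]] eqv_zero]) (simp_all add: yZ Z_closed)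
  have p1: "eqv [(False, y), (True, y + y), (False, y), (True, y), (False, 0), (True, - y)] [(True, - y), (False, 0), (True, y), (False, y), (True, y + y), (False, y)]"
    by (rule eqv_both[OF eqv_Cons[OF eqv_Cons[OF eqv_Cons[OF eqv_cancel[OF eqv_zero _ _]]]] eqv_cancel[OF eqv_zero _ _]]) (simp_all add: yZ Z_closed)
  have p2: "eqv [(False, y), (True, y), (False, 0), (True, - y), (False, - y), (True, - y - y)] [(True, - y - y), (False, - y), (True, - y), (False, 0), (True, y), (False, y)]"
    by (rule eqv_both[OF eqv_cancel[OF eqv_cancel[OF eqv_zero _ _] _ _] eqv_Cons[OF eqv_cancel[OF eqv_cancel[OF eqv_zero _ _] _ _]]]) (simp_all add: yZ Z_closed)
  have p3: "eqv [(False, y), (True, 0), (False, - y), (True, - y - y - y), (False, - y - y), (True, - y - y - y)] [(True, - y - y - y), (False, - y - y), (True, - y - y - y), (False, - y), (True, 0), (False, y)]"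
    by (rule eqv_both[OF eqv_cancel[OF eqv_zero _ _] eqv_Cons[OF eqv_Cons[OF eqv_Cons[OF eqv_cancel[OF eqv_zero _ _]]]]]) (simp_all add: yZ Z_closed)
  \<comment> \<open>The line \<open>2 x + 3 y = 0\<close> is parametrized by \<open>x = 3 s\<close>,
    \<open>y = - 2 s\<close>: the letter with argument 0 disappears, and the letters around it
    cancel in pairs.\<close>
  have line: "eqv [(False, - s - s), (True, - s - s - s), (False, - s), (True, 0), (False, s), (True, s + s + s)] [(True, s + s + s), (False, s), (True, 0), (False, - s), (True, - s - s - s), (False, - s - s)]" if "s \<in> Z" for s
    by (rule eqv_both[OF eqv_Cons[OF eqv_cancel[OF eqv_cancel[OF eqv_zero _ _] _ _]] eqv_cancel[OF eqv_cancel[OF eqv_zero _ _] _ _]]) (simp_all add: that Z_closed)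
  \<comment> \<open>At this point \<open>2 x + 3 y\<close> equals the period
    \<open>om w + om w\<close>. Moving \<open>(x, y)\<close> by \<open>(-1, 1)\<close> times that
    period changes \<open>2 x + 3 y\<close> by exactly one period, so the point is the translate of
    a point of the line above.\<close>
  have half: "raw_coeff (inst t ns) M = raw_coeff (inst t ms) M" if t: "t = - (h + h + h) + om w" for t w
  proof -
    define s where "s = om w - h"
    have s: "s \<in> Z" using om_Z h Z_diff by (simp add: s_def)
    define zs where "zs = [(False, 1::int, - s - s), (True, 2, - s - s - s), (False, 1, - s), (True, 1, 0), (False, 0, s), (True, - 1, s + s + s)]"
    \<comment> \<open>The multiplicities in \<open>zs\<close> are the changes of the six arguments
      in the direction \<open>(-1, 1)\<close>, and \<open>(6, 6)\<close> is six times the coweight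
      with values \<open>-1\<close> and \<open>1\<close> on the simple roots \<open>i\<close> and
      \<open>j\<close>.\<close>
    have ch: "chain (map (\<lambda>(k, n, z). (k, n)) zs) (6, 6) (- 6, - 6)" "chain (map (\<lambda>(k, n, z). (k, n)) (rev zs)) (6, 6) (- 6, - 6)"
      by (simp_all add: zs_def) (simp_all add: pp)
    have "raw_coeff (map (\<lambda>(k, n, z). (k, z + n \<cdot> (om w + om w))) zs) M
       = raw_coeff (map (\<lambda>(k, n, z). (k, z + n \<cdot> (om w + om w))) (rev zs)) M"
      by (rule raw_coeff_shift_eq[OF _ ch])
        (use line[OF s] det s in \<open>auto simp: zs_def Z_0 Z_closed\<close>)
    moreover have "map (\<lambda>(k, n, z). (k, z + n \<cdot> (om w + om w))) zs = inst t ns"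
      unfolding inst by (simp add: zs_def y t s_def zsmul_2 zsmul_numerals algebra_simps)
    moreover have "map (\<lambda>(k, n, z). (k, z + n \<cdot> (om w + om w))) (rev zs) = inst t ms"
      unfolding inst by (simp add: zs_def y t s_def zsmul_2 zsmul_numerals algebra_simps)
    ultimately show ?thesis by simp
  qed
  show ?thesis
  proof (cases "h = 0")
    case True
    then show ?thesis using eqvD[OF z det] y by simp
  next
    case False
    then have thh: "th (n \<cdot> h + om w) \<noteq> 0" if "n \<noteq> 0" for n w using h0 that by blast
    then have thh1: "th (h + om w) \<noteq> 0" for w using thh[of 1 w] by simp
    have "vmul (- 12, - 6) M \<noteq> (12, 6) \<or> M = (- 1, - 1, 0, 1) \<or> M = (- 1, 0, 0, - 1)"
      using M by (auto simp: dihedral_G2_def)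
    then consider (a) "vmul (- 12, - 6) M \<noteq> (12, 6)" | (b) "M = (- 1, - 1, 0, 1)" | (c) "M = (- 1, 0, 0, - 1)" by blast
    then show ?thesis
    proof cases
      case a
      have ch: "chain (map (\<lambda>(k, n, c). (k, int n)) ns) (12, 6) (- 12, - 6)" "chain (map (\<lambda>(k, n, c). (k, int n)) ms) (12, 6) (- 12, - 6)"
        by (simp_all add: ns_def ms_def) (simp_all add: pp)
      have mset: "mset (map snd ns) = mset (map snd ms)" by (simp add: ns_def ms_def)
      \<comment> \<open>The triple \<open>(n, a, b)\<close> encodes the point \<open>n\<close> times
        \<open>h\<close> plus \<open>om (a, b)\<close>. Two of these points differ either in
        \<open>n\<close> or by an odd half-period, and theta is nonzero at both kinds of
        difference.\<close>
      define pts :: "(int \<times> int \<times> int) list" where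
        "pts = [(0, 0, 0), (- 2, 0, 0), (- 4, 0, 0), (- 6, 0, 0), (- 3, 0, 0), (- 3, 1, 0), (- 3, 0, 1), (- 3, 1, 1)]"
      define pt where "pt = (\<lambda>(n, w). n \<cdot> h + om w)"
      have pt_Z: "pt q \<in> Z" for q by (cases q) (simp add: pt_def h om_Z Z_add Z_zsmul)
      have om0: "om (0, 0) = 0" using om_0 by (simp add: zero_prod_def)
      have "word_coeff (inst x ns) M = word_coeff (inst x ms) M"
      proof (rule word_identity[where as = "map pt pts", OF ch mset _ _ _ det a _ _ _ _ _ x])
        have diff: "pt (n, w) - pt (m, v) = (n - m) \<cdot> h + om (w - v)" for n w m v
          by (simp add: pt_def om_diff zsmul_diff_left)
        have "sorted_wrt (\<lambda>a b. th (pt b - pt a) \<noteq> 0) pts"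
          unfolding pts_def sorted_wrt.simps list.set ball_simps
          by (simp add: diff thh thh1 th_om)
        then show "sorted_wrt (\<lambda>a b. th (b - a) \<noteq> 0) (map pt pts)" by (simp add: sorted_wrt_map)
      next
        fix t assume t: "t \<in> set (map pt pts)"
        then have tZ: "t \<in> Z" using pt_Z by auto
        have e: "eqv zs zs' \<Longrightarrow> zs = inst t ns \<Longrightarrow> zs' = inst t ms \<Longrightarrow> raw_coeff (inst t ns) M = raw_coeff (inst t ms) M" for zs zs'
          by (rule raw_coeff_eq_if_eqv[OF _ inst_mset[OF mset] inst_Z det])
            (use tZ yZ Z_0 Z_add in \<open>auto simp: ns_def\<close>)
        consider "t = 0" | "t = - y" | "t = - y - y" | "t = - y - y - y" | w where "t = - (h + h + h) + om w"
        proof -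
          have "pt (0, 0, 0) = 0" "pt (- 2, 0, 0) = - y" "pt (- 4, 0, 0) = - y - y" "pt (- 6, 0, 0) = - y - y - y"
            by (simp_all add: pt_def om0 y zsmul_2 zsmul_numerals zsmul_minus_left)
          moreover have "pt (- 3, v) = - (h + h + h) + om v" for v
            by (simp add: pt_def zsmul_numerals zsmul_minus_left)
          ultimately show thesis using t that unfolding pts_def by auto
        qed
        then show "raw_coeff (inst t ns) M = raw_coeff (inst t ms) M"
        proof cases
          case 1 show ?thesis by (rule e[OF p0]) (simp_all add: inst 1)
        next
          case 2 show ?thesis by (rule e[OF p1]) (simp_all add: inst 2)
        next
          case 3 show ?thesis by (rule e[OF p2]) (simp_all add: inst 3)
        next
          case 4 show ?thesis by (rule e[OF p3]) (simp_all add: inst 4)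
        next
          case 5 then show ?thesis by (rule half)
        qed
      qed (use yZ Z_0 Z_add pt_Z in \<open>auto simp: ns_def ms_def pts_def\<close>)
      then show ?thesis by (simp add: inst)
    next
      case b
      show ?thesis unfolding b by (simp add: rmul pc_def qc_def lrow_def add.commute mult_ac del: rmul.simps)
    next
      case c
      show ?thesis unfolding c by (simp add: rmul pc_def qc_def lrow_def add.commute mult_ac del: rmul.simps)
    qed
  qed
qed

end

section \<open>Formal sums of monomials\<close>

text \<open>The series with terms \<open>a i * X ^ e i\<close>. An infinite fibre of
  \<open>e\<close> would contribute the default value 0 of \<open>sum\<close>; \<open>proper\<close>
  excludes this.\<close>

definition fsum :: "'i set \<Rightarrow> ('i \<Rightarrow> nat) \<Rightarrow> ('i \<Rightarrow> 'a::comm_ring_1) \<Rightarrow> 'a fps" where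
  "fsum I e a = Abs_fps (\<lambda>k. \<Sum>i\<in>{i \<in> I. e i = k}. a i)"

lemma fsum_nth: "fps_nth (fsum I e a) k = (\<Sum>i\<in>{i \<in> I. e i = k}. a i)"
  by (simp add: fsum_def)

definition proper :: "'i set \<Rightarrow> ('i \<Rightarrow> nat) \<Rightarrow> bool" where
  "proper I e \<longleftrightarrow> (\<forall>k. finite {i \<in> I. e i = k})"

lemma fsum_mult:
  assumes "proper I e" "proper J f"
  shows "fsum I e a * fsum J f b = fsum (I \<times> J) (\<lambda>(i, j). e i + f j) (\<lambda>(i, j). a i * b j)"
proof (rule fps_ext)
  fix n
  have fin: "finite {i \<in> I. e i = k}" "finite {j \<in> J. f j = k}" for k
    using assms by (auto simp: proper_def)
  have U: "{p \<in> I \<times> J. (\<lambda>(i, j). e i + f j) p = n} =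
      (\<Union>l\<in>{0..n}. {i \<in> I. e i = l} \<times> {j \<in> J. f j = n - l})" by auto
  have "fps_nth (fsum (I \<times> J) (\<lambda>(i, j). e i + f j) (\<lambda>(i, j). a i * b j)) n =
     (\<Sum>l=0..n. \<Sum>(i, j)\<in>{i \<in> I. e i = l} \<times> {j \<in> J. f j = n - l}. a i * b j)"
    unfolding fsum_nth U by (rule sum.UNION_disjoint) (auto simp: fin)
  also have "\<dots> = fps_nth (fsum I e a * fsum J f b) n"
    by (simp add: fps_mult_nth fsum_nth sum_product sum.cartesian_product)
  finally show "fps_nth (fsum I e a * fsum J f b) n =
      fps_nth (fsum (I \<times> J) (\<lambda>(i, j). e i + f j) (\<lambda>(i, j). a i * b j)) n" by simp
qed

lemma fsum_reindex:
  assumes "bij_betw h J I" "\<And>j. j \<in> J \<Longrightarrow> f j = e (h j)" "\<And>j. j \<in> J \<Longrightarrow> b j = a (h j)"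
  shows "fsum I e a = fsum J f b"
proof (rule fps_ext)
  fix k
  have "bij_betw h {j \<in> J. f j = k} {i \<in> I. e i = k}"
    using assms(1,2) by (auto simp: bij_betw_def inj_on_def)
  then show "fps_nth (fsum I e a) k = fps_nth (fsum J f b) k"
    unfolding fsum_nth by (subst sum.reindex_bij_betw[symmetric]) (auto simp: assms(3))
qed

lemma fsum_Un:
  assumes "proper I e" "proper J e" "I \<inter> J = {}"
  shows "fsum (I \<union> J) e a = fsum I e a + fsum J e a"
proof (rule fps_ext)
  fix k
  have "{i \<in> I \<union> J. e i = k} = {i \<in> I. e i = k} \<union> {i \<in> J. e i = k}" by auto
  then show "fps_nth (fsum (I \<union> J) e a) k = fps_nth (fsum I e a + fsum J e a) k"
    using assms by (simp add: fsum_nth proper_def sum.union_disjoint disjoint_iff)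
qed

lemma fsum_cmult: "fps_const c * fsum I e a = fsum I e (\<lambda>i. c * a i)"
  by (rule fps_ext) (simp add: fsum_nth sum_distrib_left)

lemma proper_square:
  fixes f :: "int \<Rightarrow> int"
  assumes "\<And>m. \<bar>m\<bar> \<le> f m + c"
  shows "proper I (\<lambda>m. nat (f m))"
  unfolding proper_def
proof
  fix k
  have "{m \<in> I. nat (f m) = k} \<subseteq> {- int k - c..int k + c}"
  proof
    fix m assume "m \<in> {m \<in> I. nat (f m) = k}"
    then have "f m \<le> int k" by auto
    then show "m \<in> {- int k - c..int k + c}" using assms[of m] by auto
  qed
  then show "finite {m \<in> I. nat (f m) = k}" using finite_subset by blast
qed

lemma proper_Times:
  assumes "proper I e" "proper J f"
  shows "proper (I \<times> J) (\<lambda>(i, j). e i + f j)"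
  unfolding proper_def
proof
  fix n
  have "{p \<in> I \<times> J. (\<lambda>(i, j). e i + f j) p = n} =
      (\<Union>l\<in>{0..n}. {i \<in> I. e i = l} \<times> {j \<in> J. f j = n - l})" by auto
  then show "finite {p \<in> I \<times> J. (\<lambda>(i, j). e i + f j) p = n}"
    using assms by (auto simp: proper_def)
qed

lemma abs_le_square_int: "\<bar>x::int\<bar> \<le> x\<^sup>2"
proof (cases "x = 0")
  case False
  then have "\<bar>x\<bar> * 1 \<le> \<bar>x\<bar> * \<bar>x\<bar>" by (intro mult_left_mono) auto
  then show ?thesis by (simp add: power2_eq_square)
qed simp

section \<open>The series model of theta with half-periods\<close>

text \<open>
  An argument \<open>(u, a, b)\<close> is the point \<open>u\<close> of the lattice shifted by \<open>a\<close> and \<open>b\<close> times the two half-periods.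
  The series \<open>Th\<close> below is written in \<open>r\<close> with \<open>r\<^sup>1\<^sup>6 = q\<close>, and completing the square to
  \<open>2 (m + b)\<^sup>2\<close> (which only changes the normalization of the value at a shifted point) keeps all its
  exponents nonnegative integers.
\<close>

locale theta_model =
  fixes ch :: "'l::ab_group_add \<Rightarrow> 'f::field" and ii :: 'f and far0 :: "nat \<Rightarrow> 'l"
  assumes ch_add: "ch (u + v) = ch u * ch v" and ch_0: "ch 0 = 1"
    and ch_sq: "u \<noteq> 0 \<Longrightarrow> ch u ^ 2 \<noteq> 1 \<and> ch u ^ 2 \<noteq> - 1"
    and i_sq: "ii ^ 2 = - 1" and two: "(1::'f) \<noteq> - 1"
    and far0: "0 < k \<Longrightarrow> \<forall>\<^sub>F N in sequentially. k \<cdot> far0 N + u \<noteq> 0"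
begin

lemma i_nz: "ii \<noteq> 0" using i_sq by auto

lemma ch_nz: "ch u \<noteq> 0"
  using ch_add[of u "- u"] ch_0 by auto

fun chi :: "'l \<times> int \<times> int \<Rightarrow> 'f" where
  "chi (u, a, b) = ch u * ii powi a"

lemma chi_add: "chi (p + q) = chi p * chi q"
  by (cases p; cases q) (simp add: ch_add power_int_add i_nz)

lemma chi_nz: "chi p \<noteq> 0"
  by (cases p) (simp add: ch_nz i_nz)

lemma chi_0: "chi 0 = 1" by (simp add: zero_prod_def ch_0)

lemma chi_minus: "chi (- p) = inverse (chi p)"
  using chi_add[of p "- p"] chi_0 by (simp add: inverse_unique)

lemma chi_diff: "chi (p - q) = chi p / chi q"
  using chi_add[of p "- q"] by (simp add: chi_minus divide_inverse)

definition shift :: "'l \<times> int \<times> int \<Rightarrow> int" where "shift p = snd (snd p)"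

lemma shift_add: "shift (p + q) = shift p + shift q" by (simp add: shift_def)
lemma shift_diff: "shift (p - q) = shift p - shift q" by (simp add: shift_def)
lemma shift_minus: "shift (- p) = - shift p" by (simp add: shift_def)

definition Th :: "'l \<times> int \<times> int \<Rightarrow> 'f fps" where
  "Th p = fsum {m. odd m} (\<lambda>m. nat (2 * (m + shift p)\<^sup>2)) (\<lambda>m. ii powi (m - 1) * chi p powi m)"

text \<open>Theta series with exponent \<open>(2 m + b) ^ 2\<close>, split by the parity of
  \<open>m\<close>: the entries of the determinants that express products of two
  \<open>Th\<close>.\<close>

definition part :: "bool \<Rightarrow> 'l \<times> int \<times> int \<Rightarrow> 'f fps" where
  "part r p = fsum {m. odd m = r} (\<lambda>m. nat ((2 * m + shift p)\<^sup>2)) (\<lambda>m. chi p powi m)"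

lemma proper_Th: "proper I (\<lambda>m::int. nat (2 * (m + b)\<^sup>2))"
  by (rule proper_square[where c = "\<bar>b\<bar>"]) (use abs_le_square_int in \<open>smt (verit)\<close>)

lemma proper_part: "proper I (\<lambda>m::int. nat ((2 * m + b)\<^sup>2))"
  by (rule proper_square[where c = "\<bar>b\<bar>"]) (use abs_le_square_int in \<open>smt (verit)\<close>)

lemma i_even: "ii powi (2 * n) = (if even n then 1 else - 1)"
proof -
  have "ii powi (2 * n) = (- 1) powi n"
    by (simp add: power_int_mult i_sq)
  then show ?thesis by (simp add: power_int_minus_left)
qed

lemma i_sq_power: "(ii powi a) ^ 2 = ii powi (2 * a)"
  by (simp add: power2_eq_square i_nz flip: power_int_add)

text \<open>The substitution \<open>(m, n) = (M + N, M - N)\<close> matches pairs of odd numbers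
  with pairs of opposite parity, and \<open>2 (m + a) ^ 2 + 2 (n + b) ^ 2 = (2 M + a + b) ^ 2 + (2 N
  + a - b) ^ 2\<close>. The powers of \<open>ii\<close> give a sign that depends on which of
  \<open>M\<close> and \<open>N\<close> is odd.\<close>

lemma Th_mult: "Th p * Th q = part True (p + q) * part False (p - q) - part False (p + q) * part True (p - q)"
proof -
  let ?e = "\<lambda>(M, N). nat ((2 * M + shift (p + q))\<^sup>2) + nat ((2 * N + shift (p - q))\<^sup>2)"
  let ?a = "\<lambda>(M, N). (if odd M then 1 else - 1) * (chi (p + q) powi M * chi (p - q) powi N)"
  let ?OE = "{M::int. odd M = True} \<times> {N::int. odd N = False}"
  let ?EO = "{M::int. odd M = False} \<times> {N::int. odd N = True}"
  have "Th p * Th q = fsum ({m. odd m} \<times> {n. odd n})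
     (\<lambda>(m, n). nat (2 * (m + shift p)\<^sup>2) + nat (2 * (n + shift q)\<^sup>2))
     (\<lambda>(m, n). ii powi (m - 1) * chi p powi m * (ii powi (n - 1) * chi q powi n))"
    unfolding Th_def by (rule fsum_mult) (rule proper_Th)+
  also have "\<dots> = fsum (?OE \<union> ?EO) ?e ?a"
  proof (rule fsum_reindex[where h = "\<lambda>(M, N). (M + N, M - N)"])
    show "bij_betw (\<lambda>(M, N). (M + N, M - N)) (?OE \<union> ?EO) ({m. odd m} \<times> {n. odd n})"
      by (rule bij_betw_byWitness[where f' = "\<lambda>(m, n). ((m + n) div 2, (m - n) div 2)"])
        (auto elim!: oddE, (presburger+)?)
  next
    fix j assume "j \<in> ?OE \<union> ?EO"
    obtain M N where j: "j = (M, N)" by (cases j)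
    have "nat ((2 * M + shift (p + q))\<^sup>2) + nat ((2 * N + shift (p - q))\<^sup>2)
        = nat ((2 * M + shift (p + q))\<^sup>2 + (2 * N + shift (p - q))\<^sup>2)"
      by (simp add: nat_add_distrib)
    also have "(2 * M + shift (p + q))\<^sup>2 + (2 * N + shift (p - q))\<^sup>2 = 2 * (M + N + shift p)\<^sup>2 + 2 * (M - N + shift q)\<^sup>2"
      by (simp add: shift_add shift_diff power2_eq_square algebra_simps)
    finally show "?e j = (case case j of (M, N) \<Rightarrow> (M + N, M - N) of
       (m, n) \<Rightarrow> nat (2 * (m + shift p)\<^sup>2) + nat (2 * (n + shift q)\<^sup>2))"
      by (simp add: j nat_add_distrib)
    have "ii powi (M + N - 1) * ii powi (M - N - 1) = ii powi (2 * (M - 1))"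
      by (simp add: i_nz flip: power_int_add)
    also have "\<dots> = (if odd M then 1 else - 1)" unfolding i_even by simp
    finally have 1: "ii powi (M + N - 1) * ii powi (M - N - 1) = (if odd M then 1 else - 1)" .
    have 2: "chi p powi (M + N) * chi q powi (M - N) = chi (p + q) powi M * chi (p - q) powi N"
      by (simp add: chi_add chi_diff power_int_add power_int_diff chi_nz power_int_mult_distrib power_int_divide_distrib field_simps)
    show "?a j = (case case j of (M, N) \<Rightarrow> (M + N, M - N) of
       (m, n) \<Rightarrow> ii powi (m - 1) * chi p powi m * (ii powi (n - 1) * chi q powi n))"
    proof -
      have "ii powi (M + N - 1) * chi p powi (M + N) * (ii powi (M - N - 1) * chi q powi (M - N))
         = (ii powi (M + N - 1) * ii powi (M - N - 1)) * (chi p powi (M + N) * chi q powi (M - N))"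
        by (simp only: mult_ac)
      then show ?thesis unfolding j 1 2 prod.case by simp
    qed
  qed
  also have "\<dots> = fsum ?OE ?e ?a + fsum ?EO ?e ?a"
    by (intro fsum_Un proper_Times proper_part) auto
  also have "fsum ?OE ?e ?a = part True (p + q) * part False (p - q)"
    unfolding part_def fsum_mult[OF proper_part proper_part]
    by (rule fsum_reindex[of id]) auto
  also have "fsum ?EO ?e ?a = fps_const (- 1) * (part False (p + q) * part True (p - q))"
    unfolding part_def fsum_mult[OF proper_part proper_part] fsum_cmult
    by (rule fsum_reindex[of id]) auto
  also have "fps_const (- 1 :: 'f) = - 1" by (simp flip: fps_const_neg)
  finally show ?thesis by simp
qed

lemma Th_minus: "Th (- p) = - Th p"
proof -
  have "Th (- p) = fsum {m. odd m} (\<lambda>m. nat (2 * (m + shift p)\<^sup>2)) (\<lambda>m. - 1 * (ii powi (m - 1) * chi p powi m))"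
    unfolding Th_def
  proof (rule fsum_reindex[where h = uminus])
    show "bij_betw uminus {m::int. odd m} {m. odd m}"
      by (rule bij_betw_byWitness[where f' = uminus]) auto
  next
    fix m :: int assume m: "m \<in> {m. odd m}"
    have "(m + shift p)\<^sup>2 = (- m + shift (- p))\<^sup>2" by (simp add: shift_minus power2_eq_square algebra_simps)
    then show "nat (2 * (m + shift p)\<^sup>2) = nat (2 * (- m + shift (- p))\<^sup>2)" by simp
    have "ii powi (- m - 1) = ii powi (m - 1) * ii powi (2 * (- m))"
      by (simp add: i_nz flip: power_int_add)
    also have "\<dots> = - 1 * ii powi (m - 1)" using m by (simp only: i_even) simp
    finally show "- 1 * (ii powi (m - 1) * chi p powi m) = ii powi (- m - 1) * chi (- p) powi (- m)"
      by (simp add: chi_minus power_int_minus power_int_inverse)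
  qed
  also have "\<dots> = fps_const (- 1) * Th p" unfolding Th_def fsum_cmult ..
  also have "fps_const (- 1 :: 'f) = - 1" by (simp flip: fps_const_neg)
  finally show ?thesis by simp
qed

text \<open>By \<open>Th_mult\<close>, each of the six pairs of factors is a minor of the 2 by 4
  matrix whose columns hold \<open>part True\<close> and \<open>part False\<close> at
  \<open>U\<close>, \<open>Y\<close>, \<open>V\<close>, \<open>W\<close>. The claim is the Pluecker
  relation among these minors.\<close>

lemma Th_fay: "Th a * Th b * Th (c + d - a) * Th (c - d + b) + Th c * Th (a - b - c) * Th d * Th (a + b - d)
        + Th (c + b) * Th (c - a) * Th (d - b) * Th (a - d) = 0"
proof -
  let ?f = "part True" let ?g = "part False"
  define U Y V W where "U = a + b" and "Y = a - b" and "V = c + c + b - a" and "W = d + d - a - b"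
  have 1: "Th a * Th b = ?f U * ?g Y - ?g U * ?f Y"
    using Th_mult[of a b] by (simp add: U_def Y_def)
  have 2: "Th (c + d - a) * Th (c - d + b) = ?f V * ?g W - ?g V * ?f W"
    using Th_mult[of "c + d - a" "c - d + b"] by (simp add: V_def W_def algebra_simps)
  have 3: "Th c * Th (a - b - c) = ?f Y * ?g V - ?g Y * ?f V"
    using Th_mult[of c "a - b - c"] by (simp add: Y_def V_def algebra_simps)
  have 4: "Th d * Th (a + b - d) = ?f U * ?g W - ?g U * ?f W"
    using Th_mult[of d "a + b - d"] by (simp add: U_def W_def algebra_simps)
  have 5: "Th (c + b) * Th (c - a) = ?f V * ?g U - ?g V * ?f U"
    using Th_mult[of "c + b" "c - a"] by (simp add: V_def U_def algebra_simps)
  have 6: "Th (d - b) * Th (a - d) = ?f Y * ?g W - ?g Y * ?f W"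
    using Th_mult[of "d - b" "a - d"] by (simp add: Y_def W_def algebra_simps)
  have "(?f U * ?g Y - ?g U * ?f Y) * (?f V * ?g W - ?g V * ?f W)
      + (?f Y * ?g V - ?g Y * ?f V) * (?f U * ?g W - ?g U * ?f W)
      + (?f V * ?g U - ?g V * ?f U) * (?f Y * ?g W - ?g Y * ?f W) = 0"
    by (simp add: algebra_simps)
  then show ?thesis unfolding 1[symmetric] 2[symmetric] 3[symmetric] 4[symmetric] 5[symmetric] 6[symmetric]
    by (simp only: mult.assoc)
qed

text \<open>For odd shift, the constant coefficient is the single term \<open>m = - shift p\<close>.
  For even shift, the coefficient of \<open>X ^ 2\<close> collects the terms with
  \<open>m + shift p\<close> equal to \<open>1\<close> or \<open>- 1\<close>, and is a unit times
  \<open>chi p ^ 2 - 1\<close>.\<close>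

lemma Th_nz:
  assumes "odd (shift p) \<or> chi p ^ 2 \<noteq> 1"
  shows "Th p \<noteq> 0"
proof (cases "odd (shift p)")
  case True
  have "{m \<in> {m. odd m}. nat (2 * (m + shift p)\<^sup>2) = 0} = {- shift p}" using True by auto
  then have "fps_nth (Th p) 0 = ii powi (- shift p - 1) * chi p powi (- shift p)"
    unfolding Th_def fsum_nth by simp
  then show ?thesis using i_nz chi_nz by (metis fps_zero_nth mult_eq_0_iff power_int_not_zero)
next
  case False
  define b where "b = shift p"
  have b: "even b" using False by (simp add: b_def)
  have sq: "nat (2 * x\<^sup>2) = 2 \<longleftrightarrow> x = 1 \<or> x = - 1" for x :: int
    using power2_eq_1_iff[of x] by auto
  have "odd m \<and> nat (2 * (m + b)\<^sup>2) = 2 \<longleftrightarrow> m = 1 - b \<or> m = - 1 - b" for m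
    unfolding sq using b by presburger
  then have "{m \<in> {m. odd m}. nat (2 * (m + b)\<^sup>2) = 2} = {1 - b, - 1 - b}" by blast
  then have "fps_nth (Th p) 2 = ii powi (- b) * chi p powi (1 - b) + ii powi (- 2 - b) * chi p powi (- 1 - b)"
    unfolding Th_def fsum_nth b_def[symmetric] by simp
  also have "ii powi (- 2 - b) = - (ii powi (- b))"
    using i_nz by (simp add: power_int_diff i_sq power_int_minus divide_inverse)
  also have "chi p powi (1 - b) = chi p powi (- 1 - b) * chi p ^ 2"
    by (simp add: chi_nz flip: power_int_add power_int_numeral)
  finally have "fps_nth (Th p) 2 = ii powi (- b) * chi p powi (- 1 - b) * (chi p ^ 2 - 1)"
    by (simp add: algebra_simps)
  moreover have "chi p ^ 2 \<noteq> 1" using assms False by simp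
  ultimately have "fps_nth (Th p) 2 \<noteq> 0" using i_nz chi_nz by simp
  then show ?thesis by auto
qed

text \<open>Shifting the index by \<open>2 b\<close> absorbs the period. No power of
  \<open>X\<close> appears, because completing the square has built it into the
  normalization.\<close>

lemma Th_quasi: "Th (p + (0, 2 * a, 2 * b)) = fps_const ((- 1) powi (a + b) * chi p powi (- 2 * b)) * Th p"
  unfolding Th_def fsum_cmult
proof (rule fsum_reindex[where h = "\<lambda>m. m - 2 * b"])
  show "bij_betw (\<lambda>m. m - 2 * b) {m. odd m} {m. odd m}"
    by (rule bij_betw_byWitness[where f' = "\<lambda>m. m + 2 * b"]) auto
next
  fix m :: int assume "m \<in> {m. odd m}"
  then have m: "odd m" by simp
  show "nat (2 * (m + shift p)\<^sup>2) = nat (2 * (m - 2 * b + shift (p + (0, 2 * a, 2 * b)))\<^sup>2)"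
    by (simp add: shift_def)
  have c: "chi (p + (0, 2 * a, 2 * b)) = chi p * ii powi (2 * a)"
    by (simp only: chi_add chi.simps) (simp add: ch_0)
  have "ii powi (m - 2 * b - 1) * (ii powi (2 * a)) powi (m - 2 * b) = ii powi (m - 1) * ii powi (2 * (a * (m - 2 * b) - b))"
    by (simp add: i_nz flip: power_int_mult power_int_add) (simp add: algebra_simps)
  also have "ii powi (2 * (a * (m - 2 * b) - b)) = (- 1) powi (a + b)"
    unfolding i_even using m by (auto simp: power_int_minus_left)
  finally have 1: "ii powi (m - 2 * b - 1) * (ii powi (2 * a)) powi (m - 2 * b) = ii powi (m - 1) * (- 1) powi (a + b)" .
  have 2: "chi p powi (m - 2 * b) = chi p powi (- 2 * b) * chi p powi m"
    by (simp add: chi_nz flip: power_int_add)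
  have "ii powi (m - 2 * b - 1) * chi (p + (0, 2 * a, 2 * b)) powi (m - 2 * b)
     = (ii powi (m - 2 * b - 1) * (ii powi (2 * a)) powi (m - 2 * b)) * chi p powi (m - 2 * b)"
    unfolding c power_int_mult_distrib by (simp only: mult_ac)
  also have "\<dots> = (- 1) powi (a + b) * chi p powi (- 2 * b) * (ii powi (m - 1) * chi p powi m)"
    unfolding 1 2 by (simp only: mult_ac)
  finally show "(- 1) powi (a + b) * chi p powi (- 2 * b) * (ii powi (m - 1) * chi p powi m) =
    ii powi (m - 2 * b - 1) * chi (p + (0, 2 * a, 2 * b)) powi (m - 2 * b)" by simp
qed

definition th :: "'l \<times> int \<times> int \<Rightarrow> 'f fps fract" where "th p = to_fract (Th p)"

lemma th_nz: "odd (shift p) \<or> chi p ^ 2 \<noteq> 1 \<Longrightarrow> th p \<noteq> 0"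
  using Th_nz by (simp add: th_def)

lemma th_nz_ch:
  assumes "u \<noteq> 0" shows "th (u, a, b) \<noteq> 0"
proof (rule th_nz, rule disjI2)
  have "chi (u, a, b) ^ 2 = ch u ^ 2 * ii powi (2 * a)"
    by (simp only: chi.simps power_mult_distrib i_sq_power)
  then show "chi (u, a, b) ^ 2 \<noteq> 1"
    using ch_sq[OF assms] by (auto simp: i_even minus_equation_iff)
qed

lemma th_half_period:
  assumes "odd a \<or> odd b" shows "th (0, a, b) \<noteq> 0"
proof (rule th_nz)
  have "chi (0, a, b) ^ 2 = ii powi (2 * a)"
    by (simp only: chi.simps power_mult_distrib i_sq_power ch_0) simp
  then show "odd (shift (0, a, b)) \<or> chi (0, a, b) ^ 2 \<noteq> 1"
    using assms two by (auto simp: i_even shift_def)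
qed

lemma theta_function_th: "theta_function th (\<lambda>N. (far0 N, 0, 0))"
proof
  show m: "th (- u) = - th u" for u by (simp add: th_def Th_minus)
  \<comment> \<open>Oddness only says that twice \<open>Th 0\<close> is 0; the assumption
    \<open>two\<close> excludes characteristic 2.\<close>
  have "Th 0 + Th 0 = 0" using Th_minus[of 0] by (simp add: eq_neg_iff_add_eq_0)
  then have "fps_nth (Th 0) k + fps_nth (Th 0) k = 0" for k by (metis fps_add_nth fps_zero_nth)
  then have "fps_nth (Th 0) k * (1 + 1) = 0" for k
    by (simp only: distrib_left mult_1_right)
  moreover have "(1 :: 'f) + 1 \<noteq> 0" using two by (simp add: eq_neg_iff_add_eq_0)
  ultimately have "fps_nth (Th 0) k = 0" for k using mult_eq_0_iff by blast
  then have "Th 0 = 0" by (intro fps_ext) simp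
  then show "th 0 = 0" by (simp add: th_def)
  show "th a * th b * th (c + d - a) * th (c - d + b) + th c * th (a - b - c) * th d * th (a + b - d) +
       th (c + b) * th (c - a) * th (d - b) * th (a - d) = 0" for a b c d
    unfolding th_def to_fract_mult[symmetric] to_fract_add[symmetric] Th_fay by (rule to_fract_0)
  show "\<forall>\<^sub>F N in sequentially. th (k \<cdot> (far0 N, 0, 0) + u) \<noteq> 0" if "0 < k" for k and u :: "'l \<times> int \<times> int"
  proof -
    obtain v a b where u: "u = (v, a, b)" by (cases u)
    from far0[OF that, of v] show ?thesis
      by eventually_elim (simp add: u th_nz_ch)
  qed
qed

lemma th_quasi_period:
  "\<exists>E c. (\<forall>u v. E (u + v) = E u * E v) \<and> (\<forall>u. E u \<noteq> 0) \<and> c \<noteq> 0 \<and>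
      (\<forall>u. th (u + ((0, w) + (0, w))) = c * E u * th u)"
proof -
  obtain a b where w: "w = (a, b)" by (cases w)
  define E where "E u = to_fract (fps_const (chi u powi (- 2 * b)))" for u
  define c where "c = to_fract (fps_const ((- 1 :: 'f) powi (a + b)))"
  have "E (u + v) = E u * E v" for u v
    by (simp add: E_def chi_add power_int_mult_distrib flip: fps_const_mult to_fract_mult)
  moreover have "E u \<noteq> 0" for u by (simp add: E_def chi_nz)
  moreover have "c \<noteq> 0" by (simp add: c_def)
  moreover have "th (u + ((0, w) + (0, w))) = c * E u * th u" for u
  proof -
    have "(0, w) + (0, w) = (0 :: 'l, 2 * a, 2 * b)" by (simp add: w)
    then show ?thesis unfolding th_def E_def c_def by (simp add: Th_quasi flip: fps_const_mult to_fract_mult)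
  qed
  ultimately show ?thesis by blast
qed

end

section \<open>Jacobi's triple product\<close>

definition agree :: "nat \<Rightarrow> 'a::comm_ring_1 fps \<Rightarrow> 'a fps \<Rightarrow> bool" where
  "agree n f g \<longleftrightarrow> (\<forall>k<n. fps_nth f k = fps_nth g k)"

lemma agree_refl: "agree n f f" by (simp add: agree_def)
lemma agree_sym: "agree n f g \<Longrightarrow> agree n g f" by (simp add: agree_def)
lemma agree_trans: "agree n f g \<Longrightarrow> agree n g h \<Longrightarrow> agree n f h" by (simp add: agree_def)
lemma agree_mono: "agree n f g \<Longrightarrow> m \<le> n \<Longrightarrow> agree m f g" by (simp add: agree_def)

lemma agree_mult: "agree n f f' \<Longrightarrow> agree n g g' \<Longrightarrow> agree n (f * g) (f' * g')"
  by (auto simp: agree_def fps_mult_nth intro!: sum.cong)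

lemma agree_power_X: "agree n f g \<Longrightarrow> agree (n + m) (fps_X ^ m * f) (fps_X ^ m * g)"
  by (auto simp: agree_def fps_X_power_mult_nth)

lemma agree_one_minus_X: "agree n (1 - fps_X ^ n * a) 1"
  by (simp add: agree_def fps_X_power_mult_nth)

lemma agree_cancel:
  assumes Q: "fps_nth Q 0 = 1" and QY: "agree n (Q * f) (Q * g)"
  shows "agree n f g"
  unfolding agree_def
proof (intro allI impI)
  fix k assume "k < n"
  then show "fps_nth f k = fps_nth g k"
  proof (induction k rule: less_induct)
    case (less k)
    have "fps_nth (Q * h) k = fps_nth h k + (\<Sum>i=1..k. fps_nth Q i * fps_nth h (k - i))" for h
      by (simp add: fps_mult_nth sum.atLeast_Suc_atMost[of 0 k] Q)
    moreover have "(\<Sum>i=1..k. fps_nth Q i * fps_nth f (k - i)) = (\<Sum>i=1..k. fps_nth Q i * fps_nth g (k - i))"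
      using less by (intro sum.cong refl) auto
    ultimately show ?case using QY less.prems unfolding agree_def by (metis add_right_cancel)
  qed
qed

definition qfact :: "nat \<Rightarrow> 'a::comm_ring_1 fps" where "qfact n = (\<Prod>k<n. 1 - fps_X ^ Suc k)"

lemma qfact_Suc: "qfact (Suc n) = qfact n * (1 - fps_X ^ Suc n)" by (simp add: qfact_def)

text \<open>Euler's product of all \<open>1 - X ^ n\<close> with \<open>n > 0\<close>. The
  coefficient at \<open>k\<close> is stationary from the partial product \<open>qfact k\<close> on,
  so the diagonal defines the limit.\<close>

definition qfact_inf :: "'a::comm_ring_1 fps" where "qfact_inf = Abs_fps (\<lambda>k. fps_nth (qfact k) k)"

lemma qfact_agree: "n \<le> m \<Longrightarrow> agree (Suc n) (qfact m) (qfact n)"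
proof (induction m rule: dec_induct)
  case (step m)
  have "agree (Suc n) (qfact m * (1 - fps_X ^ Suc m)) (qfact m * 1)"
    using agree_one_minus_X[of "Suc m" 1] step.hyps by (intro agree_mult agree_refl) (auto intro: agree_mono)
  then show ?case using step.IH agree_trans by (simp add: qfact_Suc)
qed (rule agree_refl)

lemma qfact_inf_agree: "n \<le> m \<Longrightarrow> agree (Suc n) qfact_inf (qfact m)"
  unfolding agree_def qfact_inf_def fps_nth_Abs_fps
proof (intro allI impI)
  fix k assume "n \<le> m" "k < Suc n"
  then have "agree (Suc k) (qfact m) (qfact k)" by (intro qfact_agree) simp
  then show "fps_nth (qfact k) k = fps_nth (qfact m) k" unfolding agree_def by (metis lessI)
qed

lemma qfact_inf_0: "fps_nth qfact_inf 0 = 1" by (simp add: qfact_inf_def qfact_def)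

text \<open>The \<open>q\<close>-binomial coefficient of \<open>2 N\<close> over \<open>N + j\<close>.\<close>

fun qcentral :: "nat \<Rightarrow> int \<Rightarrow> 'a::comm_ring_1 fps" where
  "qcentral 0 j = (if j = 0 then 1 else 0)"
| "qcentral (Suc N) j = (1 + fps_X ^ (2 * N + 1)) * qcentral N j
     + fps_X ^ nat (int N + 1 - j) * qcentral N (j - 1) + fps_X ^ nat (int N + 1 + j) * qcentral N (j + 1)"

lemma qcentral_zero: "\<bar>j\<bar> > int N \<Longrightarrow> qcentral N j = 0"
  by (induction N arbitrary: j) auto

text \<open>The quotient formula for q-binomial coefficients, cleared of denominators. The recursion
  of \<open>qcentral\<close> is q-Pascal applied twice; multiplied by both factorials it becomes the
  identity \<open>key\<close>. At the boundary a vanishing neighbour is matched by a factor such as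
  \<open>1 - A'\<close>, which is 0 because \<open>nat\<close> makes the exponent 0.\<close>

lemma qcentral_qfact:
  "\<bar>j\<bar> \<le> int N \<Longrightarrow> qcentral N j * qfact (nat (int N + j)) * qfact (nat (int N - j)) = (qfact (2 * N) :: 'a::comm_ring_1 fps)"
proof (induction N arbitrary: j)
  case 0
  then show ?case by (simp add: qfact_def)
next
  case (Suc N)
  define a b :: nat where "a = nat (int N + j)" and "b = nat (int N - j)"
  define U :: "'a fps" where "U = fps_X"
  define R :: "'a fps" where "R = qfact (2 * N)"
  define A A' B B' where "A = U ^ nat (int N + 1 + j)" and "A' = U ^ nat (int N + j)"
    and "B = U ^ nat (int N + 1 - j)" and "B' = U ^ nat (int N - j)"
  have step: "qfact (nat (k + 1)) = qfact (nat k) * (1 - fps_X ^ nat (k + 1))" if "k \<ge> 0" for k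
    using that by (simp add: nat_add_distrib qfact_Suc)
  have sA: "qfact (nat (int N + 1 + j)) = qfact (nat (int N + j)) * (1 - A)" if "int N + j \<ge> 0"
    using step[OF that] by (simp add: A_def U_def algebra_simps)
  have sA': "qfact (nat (int N + j)) = qfact (nat (int N + (j - 1))) * (1 - A')" if "int N + j \<ge> 1"
    using step[of "int N + (j - 1)"] that by (simp add: A'_def U_def algebra_simps)
  have sB: "qfact (nat (int N + 1 - j)) = qfact (nat (int N - j)) * (1 - B)" if "int N - j \<ge> 0"
    using step[OF that] by (simp add: B_def U_def algebra_simps)
  have sB': "qfact (nat (int N - j)) = qfact (nat (int N - (j + 1))) * (1 - B')" if "int N - j \<ge> 1"
    using step[of "int N - (j + 1)"] that by (simp add: B'_def U_def algebra_simps)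
  let ?U = "qfact (nat (int N + 1 + j)) * qfact (nat (int N + 1 - j)) :: 'a fps"
  have t0: "qcentral N j * ?U = (1 - A) * (1 - B) * R"
  proof (cases "\<bar>j\<bar> \<le> int N")
    case True
    then show ?thesis using Suc.IH[OF True, symmetric] by (simp add: sA sB R_def mult_ac)
  next
    case False
    then have "j = int N + 1 \<or> j = - int N - 1" using Suc.prems by linarith
    then have "A = 1 \<or> B = 1" by (auto simp: A_def B_def)
    then show ?thesis using False by (auto simp: qcentral_zero)
  qed
  have t1: "qcentral N (j + 1) * ?U = (1 - B) * (1 - B') * R"
  proof (cases "j + 1 \<le> int N")
    case True
    then have "\<bar>j + 1\<bar> \<le> int N" using Suc.prems by auto
    from Suc.IH[OF this, symmetric] show ?thesis using True
      by (simp add: sB sB' R_def mult_ac) (simp add: algebra_simps)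
  next
    case False
    then have "B' = 1" "qcentral N (j + 1) = (0 :: 'a fps)" by (auto simp: B'_def qcentral_zero)
    then show ?thesis by simp
  qed
  have t2: "qcentral N (j - 1) * ?U = (1 - A) * (1 - A') * R"
  proof (cases "- int N \<le> j - 1")
    case True
    then have "\<bar>j - 1\<bar> \<le> int N" using Suc.prems by auto
    from Suc.IH[OF this, symmetric] show ?thesis using True
      by (simp add: sA sA' R_def mult_ac) (simp add: algebra_simps)
  next
    case False
    then have "A' = 1" "qcentral N (j - 1) = (0 :: 'a fps)" by (auto simp: A'_def qcentral_zero)
    then show ?thesis by simp
  qed
  have AB: "A * B = U ^ (2 * N + 2)"
  proof -
    have "nat (int N + 1 + j) + nat (int N + 1 - j) = 2 * N + 2" using Suc.prems by linarith
    then show ?thesis by (simp only: A_def B_def flip: power_add)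
  qed
  have key: "(1 + U ^ (2 * N + 1)) * ((1 - A) * (1 - B)) + B * ((1 - A) * (1 - A')) + A * ((1 - B) * (1 - B'))
      = (1 - U ^ (2 * N + 1)) * (1 - U ^ (2 * N + 2))"
  proof -
    consider "j = int N + 1" | "j = - int N - 1" | "\<bar>j\<bar> \<le> int N" using Suc.prems by linarith
    then show ?thesis
    proof cases
      case 1
      then have n: "nat (int N + 1 + j) = 2 * N + 2" "nat (int N + j) = 2 * N + 1" "nat (int N + 1 - j) = 0" by linarith+
      have "A = U ^ (2 * N + 2)" "A' = U ^ (2 * N + 1)" "B = 1"
        unfolding A_def A'_def B_def n by simp_all
      then show ?thesis by (simp add: algebra_simps)
    next
      case 2
      then have n: "nat (int N + 1 - j) = 2 * N + 2" "nat (int N - j) = 2 * N + 1" "nat (int N + 1 + j) = 0" by linarith+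
      have "B = U ^ (2 * N + 2)" "B' = U ^ (2 * N + 1)" "A = 1"
        unfolding A_def B'_def B_def n by simp_all
      then show ?thesis by (simp add: algebra_simps)
    next
      case 3
      define P where "P = U ^ (2 * N)"
      have n: "nat (int N + 1 + j) = Suc (nat (int N + j))" "nat (int N + 1 - j) = Suc (nat (int N - j))"
        "nat (int N + j) + nat (int N - j) = 2 * N" using 3 by linarith+
      have A: "A = U * A'" and B: "B = U * B'" by (simp_all add: A_def A'_def B_def B'_def n)
      have P: "A' * B' = P" unfolding A'_def B'_def P_def power_add[symmetric] n ..
      have "U ^ (2 * N + 1) = U * P" "U ^ (2 * N + 2) = U * U * P" by (simp_all add: P_def)
      then show ?thesis unfolding A B by (simp add: algebra_simps flip: P)
    qed
  qed
  have "qcentral (Suc N) j * ?U = ((1 + U ^ (2 * N + 1)) * (qcentral N j * ?U)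
      + B * (qcentral N (j - 1) * ?U) + A * (qcentral N (j + 1) * ?U))"
    by (simp add: A_def B_def U_def algebra_simps)
  also have "\<dots> = ((1 + U ^ (2 * N + 1)) * ((1 - A) * (1 - B)) + B * ((1 - A) * (1 - A')) + A * ((1 - B) * (1 - B'))) * R"
    unfolding t0 t1 t2 by (simp add: algebra_simps)
  also have "\<dots> = qfact (2 * Suc N)"
    unfolding key by (simp add: R_def qfact_Suc U_def mult_ac)
  finally show ?case by (simp add: algebra_simps)
qed

definition tri :: "int \<Rightarrow> nat" where "tri j = nat (j * (j + 1) div 2)"

lemma tri_double: "2 * int (tri j) = j * (j + 1)"
proof -
  have "0 \<le> j * (j + 1)" by (cases "0 \<le> j") (auto intro: mult_nonpos_nonpos)
  then show ?thesis by (simp add: tri_def)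
qed

lemma tri_shift: "int (tri (j - 1)) = int (tri j) - j" "int (tri (j + 1)) = int (tri j) + j + 1"
  using tri_double[of j] tri_double[of "j - 1"] tri_double[of "j + 1"] by (simp_all add: algebra_simps)

lemma tri_ge: "int (tri j) \<ge> \<bar>j\<bar> - 1"
proof (cases "0 \<le> j")
  case True
  have "0 \<le> (j - 1) * (j - 1) + (j + 1)" using True by simp
  then show ?thesis using True tri_double[of j] by (simp add: algebra_simps)
next
  case False
  have "0 \<le> (j + 1) * (j + 2)" using False by (cases "j = - 1") (auto intro: mult_nonpos_nonpos)
  then show ?thesis using False tri_double[of j] by (simp add: algebra_simps)
qed

definition sgn_even :: "int \<Rightarrow> 'a::comm_ring_1" where "sgn_even j = (if even j then 1 else - 1)"

lemma sum_shift_support: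
  fixes f :: "int \<Rightarrow> 'b::comm_monoid_add"
  assumes "\<And>j. \<bar>j\<bar> > N \<Longrightarrow> f j = 0" "N < M" "\<bar>d\<bar> \<le> 1"
  shows "(\<Sum>j=-M..M. f j) = (\<Sum>j=-M..M. f (j + d))"
proof -
  have "(\<Sum>j=-M..M. f j) = (\<Sum>j=-N..N. f j)"
    by (rule sum.mono_neutral_right) (use assms in auto)
  also have "\<dots> = (\<Sum>j=-N-d..N-d. f (j + d))"
    by (rule sum.reindex_bij_witness[of _ "\<lambda>j. j + d" "\<lambda>j. j - d"]) auto
  also have "\<dots> = (\<Sum>j=-M..M. f (j + d))"
    by (rule sum.mono_neutral_left) (use assms in auto)
  finally show ?thesis .
qed

context
  fixes z :: "int \<Rightarrow> 'a::comm_ring_1"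
  assumes z_add: "z (i + j) = z i * z j" and z_0: "z 0 = 1"
begin

text \<open>The second factor starts at exponent 0, not 1: it includes \<open>1 - z (- 1)\<close>,
  which for theta is the prefactor up to the unit \<open>expo u\<close>.\<close>

definition finite_triple :: "nat \<Rightarrow> 'a fps" where
  "finite_triple N = (\<Prod>k<N. (1 - fps_X ^ Suc k * fps_const (z 1)) * (1 - fps_X ^ k * fps_const (z (- 1))))"

text \<open>Cauchy's finite form of the triple product. The factors of index \<open>N\<close> shift
  the summation index by 0, 1 and -1, and the three contributions form the recursion of
  \<open>qcentral\<close>. The bound \<open>M\<close> is free so that the range stays fixed during
  the induction.\<close>

lemma finite_triple_expand:
  "int N \<le> M \<Longrightarrow> finite_triple N = (\<Sum>j=-M..M. fps_const (sgn_even j * z j) * (fps_X ^ tri j * qcentral N j))"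
proof (induction N)
  case 0
  have "(\<Sum>j=-M..M. fps_const (sgn_even j * z j) * (fps_X ^ tri j * qcentral 0 j)) =
     (\<Sum>j=-M..M. if j = 0 then 1 else 0)"
    by (rule sum.cong) (auto simp: sgn_even_def z_0 tri_def)
  then show ?case using 0 by (simp add: finite_triple_def)
next
  case (Suc N)
  define f where "f j = fps_const (sgn_even j * z j) * (fps_X ^ tri j * qcentral N j)" for j
  have f0: "\<bar>j\<bar> > int N \<Longrightarrow> f j = 0" for j by (simp add: f_def qcentral_zero)
  have up: "- (fps_X ^ (N + 1) * fps_const (z 1) * f (j - 1)) =
      fps_const (sgn_even j * z j) * (fps_X ^ tri j * (fps_X ^ nat (int N + 1 - j) * qcentral N (j - 1)))" for j
  proof (cases "\<bar>j - 1\<bar> \<le> int N")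
    case True
    have "N + 1 + tri (j - 1) = tri j + nat (int N + 1 - j)"
      using True tri_shift(1)[of j] by linarith
    then have 1: "fps_X ^ (N + 1) * (fps_X ^ tri (j - 1) :: 'a fps) = fps_X ^ tri j * fps_X ^ nat (int N + 1 - j)"
      unfolding power_add[symmetric] by (rule arg_cong)
    have 2: "- (fps_const (z 1) * fps_const (sgn_even (j - 1) * z (j - 1))) = fps_const (sgn_even j * z j)"
      using z_add[of 1 "j - 1"] by (simp add: sgn_even_def)
    have "- (fps_X ^ (N + 1) * fps_const (z 1) * f (j - 1)) =
       - (fps_const (z 1) * fps_const (sgn_even (j - 1) * z (j - 1))) * ((fps_X ^ (N + 1) * fps_X ^ tri (j - 1)) * qcentral N (j - 1))"
      by (simp only: f_def mult_ac mult_minus_left mult_minus_right)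
    then show ?thesis unfolding 1 2 by (simp only: mult.assoc)
  qed (simp add: f_def qcentral_zero)
  have down: "- (fps_X ^ N * fps_const (z (- 1)) * f (j + 1)) =
      fps_const (sgn_even j * z j) * (fps_X ^ tri j * (fps_X ^ nat (int N + 1 + j) * qcentral N (j + 1)))" for j
  proof (cases "\<bar>j + 1\<bar> \<le> int N")
    case True
    have "N + tri (j + 1) = tri j + nat (int N + 1 + j)"
      using True tri_shift(2)[of j] by linarith
    then have 1: "fps_X ^ N * (fps_X ^ tri (j + 1) :: 'a fps) = fps_X ^ tri j * fps_X ^ nat (int N + 1 + j)"
      unfolding power_add[symmetric] by (rule arg_cong)
    have 2: "- (fps_const (z (- 1)) * fps_const (sgn_even (j + 1) * z (j + 1))) = fps_const (sgn_even j * z j)"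
      using z_add[of "- 1" "j + 1"] by (simp add: sgn_even_def)
    have "- (fps_X ^ N * fps_const (z (- 1)) * f (j + 1)) =
       - (fps_const (z (- 1)) * fps_const (sgn_even (j + 1) * z (j + 1))) * ((fps_X ^ N * fps_X ^ tri (j + 1)) * qcentral N (j + 1))"
      by (simp only: f_def mult_ac mult_minus_left mult_minus_right)
    then show ?thesis unfolding 1 2 by (simp only: mult.assoc)
  qed (simp add: f_def qcentral_zero)
  have zz: "fps_const (z 1) * fps_const (z (- 1)) = 1" using z_add[of 1 "- 1"] z_0 by simp
  have fac: "(1 - fps_X ^ Suc N * fps_const (z 1)) * (1 - fps_X ^ N * fps_const (z (- 1)))
     = (1 + fps_X ^ (2 * N + 1)) + (- (fps_X ^ (N + 1) * fps_const (z 1))) + (- (fps_X ^ N * fps_const (z (- 1))))"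
  proof -
    have "(1 - P * a) * (1 - Q * b) = (1 + P * Q) + (- (P * a)) + (- (Q * b))" if "a * b = 1" for P Q a b :: "'a fps"
    proof -
      have "(1 - P * a) * (1 - Q * b) = (1 + P * Q * (a * b)) + (- (P * a)) + (- (Q * b))"
        by (simp add: algebra_simps)
      then show ?thesis using that by simp
    qed
    from this[OF zz, of "fps_X ^ Suc N" "fps_X ^ N"]
    have "(1 - fps_X ^ Suc N * fps_const (z 1)) * (1 - fps_X ^ N * fps_const (z (- 1)))
      = (1 + fps_X ^ Suc N * fps_X ^ N) + (- (fps_X ^ Suc N * fps_const (z 1))) + (- (fps_X ^ N * fps_const (z (- 1))))" .
    moreover have "fps_X ^ Suc N * fps_X ^ N = (fps_X ^ (2 * N + 1) :: 'a fps)"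
      unfolding power_add[symmetric] by (rule arg_cong[of _ _ "power fps_X"]) simp
    ultimately show ?thesis unfolding Suc_eq_plus1 by (simp only:)
  qed
  have M: "int N < M" using Suc.prems by simp
  have "finite_triple (Suc N) = finite_triple N * ((1 - fps_X ^ Suc N * fps_const (z 1)) * (1 - fps_X ^ N * fps_const (z (- 1))))"
    by (simp add: finite_triple_def)
  also have "\<dots> = (1 + fps_X ^ (2 * N + 1)) * (\<Sum>j=-M..M. f j) + (- (fps_X ^ (N + 1) * fps_const (z 1))) * (\<Sum>j=-M..M. f j)
      + (- (fps_X ^ N * fps_const (z (- 1)))) * (\<Sum>j=-M..M. f j)"
    using Suc.IH M unfolding fac f_def by (simp add: algebra_simps)
  also have "\<dots> = (\<Sum>j=-M..M. (1 + fps_X ^ (2 * N + 1)) * f j) + (- (fps_X ^ (N + 1) * fps_const (z 1))) * (\<Sum>j=-M..M. f (j - 1))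
      + (- (fps_X ^ N * fps_const (z (- 1)))) * (\<Sum>j=-M..M. f (j + 1))"
  proof -
    have s: "(\<Sum>j=-M..M. f (j - 1)) = (\<Sum>j=-M..M. f j)" "(\<Sum>j=-M..M. f (j + 1)) = (\<Sum>j=-M..M. f j)"
      using sum_shift_support[of "int N" f M "- 1", OF f0 M] sum_shift_support[of "int N" f M 1, OF f0 M]
      by simp_all
    show ?thesis unfolding s by (simp only: sum_distrib_left)
  qed
  also have "\<dots> = (\<Sum>j=-M..M. (1 + fps_X ^ (2 * N + 1)) * f j + (- (fps_X ^ (N + 1) * fps_const (z 1))) * f (j - 1)
      + (- (fps_X ^ N * fps_const (z (- 1)))) * f (j + 1))"
    by (simp only: sum_distrib_left sum.distrib)
  also have "\<dots> = (\<Sum>j=-M..M. fps_const (sgn_even j * z j) * (fps_X ^ tri j * qcentral (Suc N) j))"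
  proof (rule sum.cong[OF refl])
    fix j
    show "(1 + fps_X ^ (2 * N + 1)) * f j + (- (fps_X ^ (N + 1) * fps_const (z 1))) * f (j - 1)
      + (- (fps_X ^ N * fps_const (z (- 1)))) * f (j + 1) = fps_const (sgn_even j * z j) * (fps_X ^ tri j * qcentral (Suc N) j)"
      unfolding mult_minus_left up down qcentral.simps distrib_left by (simp only: f_def mult_ac)
  qed
  finally show ?case .
qed

text \<open>To this precision all three factorials in the quotient formula agree with
  \<open>qfact_inf\<close>, and one copy can be cancelled since its constant term is 1.\<close>

lemma qcentral_limit:
  assumes "\<bar>j\<bar> \<le> int N"
  shows "agree (Suc (nat (int N - \<bar>j\<bar>))) (qcentral N j * qfact_inf) (1 :: 'a fps)"
proof -
  let ?n = "Suc (nat (int N - \<bar>j\<bar>))"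
  have q: "agree ?n (qfact m) qfact_inf" if "nat (int N - \<bar>j\<bar>) \<le> m" for m
    by (rule agree_sym[OF qfact_inf_agree[OF that]])
  have "agree ?n (qcentral N j * qfact (nat (int N + j)) * qfact (nat (int N - j))) (qcentral N j * qfact_inf * qfact_inf)"
    by (intro agree_mult agree_refl q) (use assms in auto)
  then have "agree ?n (qfact (2 * N)) (qcentral N j * qfact_inf * qfact_inf)"
    unfolding qcentral_qfact[OF assms] .
  moreover have "agree ?n (qfact (2 * N)) qfact_inf" by (rule q) auto
  ultimately have "agree ?n (qcentral N j * qfact_inf * qfact_inf) qfact_inf"
    using agree_sym agree_trans by blast
  then have "agree ?n (qfact_inf * (qcentral N j * qfact_inf)) (qfact_inf * 1)"
    by (simp add: mult.commute[of _ qfact_inf])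
  then show ?thesis by (rule agree_cancel[OF qfact_inf_0])
qed

text \<open>The term of index \<open>j\<close> is known only to precision
  \<open>N - |j| + 1\<close>, but its factor \<open>X ^ tri j\<close> shifts the error up by at
  least \<open>|j| - 1\<close>. So every term is correct below \<open>X ^ N\<close>.\<close>

lemma finite_triple_limit:
  "agree N (finite_triple N * qfact_inf) (fsum UNIV tri (\<lambda>j. sgn_even j * z j))"
  unfolding agree_def
proof (intro allI impI)
  fix k assume k: "k < N"
  have "finite_triple N * qfact_inf = (\<Sum>j=-int N..int N. fps_const (sgn_even j * z j) * (fps_X ^ tri j * (qcentral N j * qfact_inf)))"
    using finite_triple_expand[of N "int N"] by (simp add: sum_distrib_right mult.assoc)
  then have "fps_nth (finite_triple N * qfact_inf) k =
      (\<Sum>j=-int N..int N. (sgn_even j * z j) * fps_nth (fps_X ^ tri j * (qcentral N j * qfact_inf)) k)"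
    by (simp add: fps_sum_nth)
  also have "\<dots> = (\<Sum>j=-int N..int N. if tri j = k then sgn_even j * z j else 0)"
  proof (rule sum.cong[OF refl])
    fix j assume "j \<in> {- int N..int N}"
    then have j: "\<bar>j\<bar> \<le> int N" by auto
    have "agree (Suc (nat (int N - \<bar>j\<bar>)) + tri j) (fps_X ^ tri j * (qcentral N j * qfact_inf)) (fps_X ^ tri j * 1 :: 'a fps)"
      by (rule agree_power_X[OF qcentral_limit[OF j]])
    moreover have "k < Suc (nat (int N - \<bar>j\<bar>)) + tri j" using k j tri_ge[of j] by linarith
    ultimately have "fps_nth (fps_X ^ tri j * (qcentral N j * qfact_inf)) k = fps_nth (fps_X ^ tri j :: 'a fps) k"
      by (simp add: agree_def)
    then show "(sgn_even j * z j) * fps_nth (fps_X ^ tri j * (qcentral N j * qfact_inf)) k = (if tri j = k then sgn_even j * z j else 0)"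
      by (simp add: fps_X_power_nth)
  qed
  also have "\<dots> = (\<Sum>j\<in>{j \<in> UNIV. tri j = k}. sgn_even j * z j)"
  proof -
    have "{j \<in> UNIV. tri j = k} \<subseteq> {- int N..int N}"
    proof
      fix j assume "j \<in> {j \<in> UNIV. tri j = k}"
      then show "j \<in> {- int N..int N}" using k tri_ge[of j] by auto
    qed
    then show ?thesis by (intro sum.mono_neutral_cong_right) auto
  qed
  finally show "fps_nth (finite_triple N * qfact_inf) k = fps_nth (fsum UNIV tri (\<lambda>j. sgn_even j * z j)) k"
    by (simp add: fsum_nth)
qed

end

lemma expo_add: "expo (u + v) = expo u * expo v"
  by transfer (simp add: mult_single)

lemma expo_0: "expo 0 = 1"
  by transfer simp

text \<open>Convergence is used coefficientwise: for each \<open>k\<close>, one sufficiently long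
  partial product agrees with the infinite one through degree \<open>k\<close> and is compared with
  \<open>finite_triple\<close>.\<close>

lemma theta_triple_product:
  fixes u :: "'l::lattice_group"
  shows "theta u * qfact_inf = fsum UNIV tri (\<lambda>j. sgn_even j * expo ((2 * j + 1) \<cdot> u))"
proof -
  define z where "z j = expo ((2 * j) \<cdot> u)" for j
  have z_add: "z (i + j) = z i * z j" for i j
    by (simp add: z_def distrib_left zsmul_add_left expo_add)
  have z_0: "z 0 = 1" by (simp add: z_def expo_0)
  have z1: "z 1 = expo (u + u)" "z (- 1) = expo (- (u + u))"
    by (simp_all add: z_def zsmul_2 zsmul_minus_left)
  define P where "P N = (\<Prod>k<N. theta_factor u k)" for N
  have tf: "theta_factor u k = (1 - fps_X ^ Suc k * fps_const (z 1)) * (1 - fps_X ^ Suc k * fps_const (z (- 1)))" for k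
    by (simp only: theta_factor_def z1)
  \<comment> \<open>The factors with \<open>z (- 1)\<close> run over exponents 1 to \<open>N\<close>
    in \<open>P N\<close> and 0 to \<open>N - 1\<close> in \<open>finite_triple\<close>; one end
    factor on each side accounts for the difference.\<close>
  have FP: "finite_triple z N * (1 - fps_X ^ N * fps_const (z (- 1))) = (1 - fps_const (z (- 1))) * P N" for N
  proof (induction N)
    case (Suc N)
    have "finite_triple z (Suc N) * (1 - fps_X ^ Suc N * fps_const (z (- 1)))
       = (finite_triple z N * (1 - fps_X ^ N * fps_const (z (- 1)))) * theta_factor u N"
      unfolding tf by (simp add: finite_triple_def[OF z_add z_0] mult_ac)
    then show ?case unfolding Suc.IH by (simp add: P_def mult_ac)
  qed (simp add: finite_triple_def[OF z_add z_0] P_def)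
  obtain p where p: "theta_factor u has_prod p" "fps_nth p 0 = 1" using theta_convergent by blast
  then have "p \<noteq> 0" by auto
  then have "(\<lambda>n. \<Prod>i\<le>n. theta_factor u i) \<longlonglongrightarrow> p"
    using p(1) by (auto simp: has_prod_def raw_has_prod_def)
  then have lim: "\<forall>\<^sub>F n in sequentially. fps_nth (\<Prod>i\<le>n. theta_factor u i) k = fps_nth p k" for k
    unfolding tendsto_fps_iff by blast
  have "prodinf (theta_factor u) = p" by (rule has_prod_unique[OF p(1), symmetric])
  then have "theta u = fps_const (expo u - expo (- u)) * p"
    unfolding theta_def theta_factor_def[abs_def] by simp
  also have "expo u - expo (- u) = expo u * (1 - z (- 1))"
    using expo_add[of u "- (u + u)"] by (simp add: z1 algebra_simps)
  finally have th: "theta u = fps_const (expo u) * ((1 - fps_const (z (- 1))) * p)"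
    by (simp add: mult.assoc flip: fps_const_mult fps_const_sub)
  show ?thesis
  proof (rule fps_ext)
    fix k
    have "\<forall>\<^sub>F n in sequentially. \<forall>i\<in>{..k}. fps_nth (\<Prod>i\<le>n. theta_factor u i) i = fps_nth p i"
      by (rule eventually_ball_finite) (use lim in auto)
    then have "\<forall>\<^sub>F n in sequentially. k < n \<and> (\<forall>i\<in>{..k}. fps_nth (\<Prod>i\<le>n. theta_factor u i) i = fps_nth p i)"
      by (rule eventually_conj[OF eventually_gt_at_top])
    from eventually_happens[OF this]
    obtain n where n: "k < n" "\<And>i. i \<le> k \<Longrightarrow> fps_nth (\<Prod>i\<le>n. theta_factor u i) i = fps_nth p i" by auto
    have Pp: "agree (Suc k) (P (Suc n)) p"
      using n(2) by (auto simp: agree_def P_def lessThan_Suc_atMost)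
    have "agree (Suc n) (finite_triple z (Suc n) * (1 - fps_X ^ Suc n * fps_const (z (- 1)))) (finite_triple z (Suc n) * 1)"
      by (intro agree_mult agree_refl agree_one_minus_X)
    then have "agree (Suc n) ((1 - fps_const (z (- 1))) * P (Suc n)) (finite_triple z (Suc n))"
      unfolding FP by simp
    then have "agree (Suc k) ((1 - fps_const (z (- 1))) * P (Suc n)) (finite_triple z (Suc n))"
      by (rule agree_mono) (use n(1) in simp)
    moreover have "agree (Suc k) ((1 - fps_const (z (- 1))) * P (Suc n)) ((1 - fps_const (z (- 1))) * p)"
      by (intro agree_mult agree_refl Pp)
    ultimately have "agree (Suc k) ((1 - fps_const (z (- 1))) * p) (finite_triple z (Suc n))"
      using agree_sym agree_trans by blast
    then have "agree (Suc k) (fps_const (expo u) * ((1 - fps_const (z (- 1))) * p) * qfact_inf) (fps_const (expo u) * finite_triple z (Suc n) * qfact_inf)"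
      by (intro agree_mult agree_refl)
    moreover have "agree (Suc k) (finite_triple z (Suc n) * qfact_inf) (fsum UNIV tri (\<lambda>j. sgn_even j * z j))"
      by (rule agree_mono[OF finite_triple_limit[OF z_add z_0]]) (use n(1) in simp)
    then have "agree (Suc k) (fps_const (expo u) * (finite_triple z (Suc n) * qfact_inf)) (fps_const (expo u) * fsum UNIV tri (\<lambda>j. sgn_even j * z j))"
      by (intro agree_mult agree_refl)
    ultimately have "agree (Suc k) (theta u * qfact_inf) (fps_const (expo u) * fsum UNIV tri (\<lambda>j. sgn_even j * z j))"
      unfolding th mult.assoc by (rule agree_trans)
    moreover have "fps_const (expo u) * fsum UNIV tri (\<lambda>j. sgn_even j * z j) = fsum UNIV tri (\<lambda>j. sgn_even j * expo ((2 * j + 1) \<cdot> u))"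
      unfolding fsum_cmult by (simp add: z_def zsmul_add_left expo_add mult_ac)
    ultimately show "fps_nth (theta u * qfact_inf) k = fps_nth (fsum UNIV tri (\<lambda>j. sgn_even j * expo ((2 * j + 1) \<cdot> u))) k"
      unfolding agree_def by simp
  qed
qed

section \<open>Torsion-freeness, and ring maps applied to coefficients\<close>

lemma zsmul_eq_0_iff:
  fixes x :: "'l::lattice_group"
  assumes "n \<noteq> 0"
  shows "n \<cdot> x = 0 \<longleftrightarrow> x = 0"
proof
  assume nx: "n \<cdot> x = 0"
  obtain \<iota> :: "'l \<Rightarrow> (nat \<Rightarrow>\<^sub>0 int)" where \<iota>: "inj \<iota>" "\<And>x y. \<iota> (x + y) = \<iota> x + \<iota> y"
    using lattice_embedding by blast
  have i0: "\<iota> 0 = 0" using \<iota>(2)[of 0 0] by simp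
  have "Poly_Mapping.lookup (\<iota> (n \<cdot> x)) k = n * Poly_Mapping.lookup (\<iota> x) k" for k
    using zsmul_hom[of "\<lambda>x. Poly_Mapping.lookup (\<iota> x) k" n x] \<iota>(2) by (simp add: lookup_add)
  then have "\<iota> x = 0" using nx i0 assms by (intro poly_mapping_eqI) simp
  then show "x = 0" using \<iota>(1) i0 by (metis injD)
qed simp

lemma zsmul_inj:
  fixes x y :: "'l::lattice_group"
  assumes "n \<noteq> 0" "n \<cdot> x = n \<cdot> y" shows "x = y"
  using zsmul_eq_0_iff[OF assms(1), of "x - y"] assms(2) by (simp add: zsmul_diff_right)

locale ring_map =
  fixes g :: "'a::comm_ring_1 \<Rightarrow> 'b::comm_ring_1"
  assumes g_add: "g (a + b) = g a + g b" and g_mult: "g (a * b) = g a * g b" and g_1: "g 1 = 1"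
begin

lemma g_0: "g 0 = 0" using g_add[of 0 0] by simp
lemma g_minus: "g (- a) = - g a" using g_add[of a "- a"] g_0 by (simp add: eq_neg_iff_add_eq_0 add.commute)
lemma g_diff: "g (a - b) = g a - g b" using g_add[of a "- b"] g_minus by simp
lemma g_sum: "g (\<Sum>i\<in>I. f i) = (\<Sum>i\<in>I. g (f i))"
  by (induction I rule: infinite_finite_induct) (simp_all add: g_0 g_add)

lemma fps_map_nth: "fps_nth (fps_map g f) n = g (fps_nth f n)" by (simp add: fps_map_def)

lemma fps_map_mult: "fps_map g (f * h) = fps_map g f * fps_map g h"
  by (rule fps_ext) (simp add: fps_map_nth fps_mult_nth g_sum g_mult)

lemma fps_map_qfact: "fps_map g (qfact n) = qfact n"
proof (induction n)
  case 0
  show ?case by (rule fps_ext) (simp add: fps_map_nth qfact_def g_0 g_1)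
next
  case (Suc n)
  have "fps_map g (1 - fps_X ^ Suc n) = 1 - fps_X ^ Suc n"
    by (rule fps_ext) (simp add: fps_map_nth g_diff g_0 g_1 del: power_Suc)
  then show ?case by (simp only: qfact_Suc fps_map_mult Suc.IH)
qed

lemma fps_map_qfact_inf: "fps_map g qfact_inf = qfact_inf"
proof (rule fps_ext)
  fix k
  have "g (fps_nth (qfact k) k) = fps_nth (qfact k) k"
    using arg_cong[OF fps_map_qfact[of k], of "\<lambda>f. fps_nth f k"] by (simp add: fps_map_nth)
  then show "fps_nth (fps_map g qfact_inf) k = fps_nth qfact_inf k" by (simp add: fps_map_nth qfact_inf_def)
qed

lemma fps_map_fsum: "fps_map g (fsum I e a) = fsum I e (\<lambda>i. g (a i))"
  by (rule fps_ext) (simp add: fps_map_nth fsum_nth g_sum)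

lemma g_sgn_even: "g (sgn_even j) = sgn_even j" by (simp add: sgn_even_def g_1 g_minus)

end

text \<open>In the series form a ring map acts on the coefficients term by term, which avoids
  commuting it with the infinite product.\<close>

lemma fps_map_theta:
  fixes u :: "'l::lattice_group"
  assumes "ring_map g"
  shows "fps_map g (theta u) * qfact_inf = fsum UNIV tri (\<lambda>j. sgn_even j * g (expo ((2 * j + 1) \<cdot> u)))"
proof -
  interpret ring_map g by fact
  show ?thesis
    using arg_cong[OF theta_triple_product[of u], of "fps_map g"]
    by (simp add: fps_map_mult fps_map_qfact_inf fps_map_fsum g_mult g_sgn_even)
qed

lemma qfact_inf_nz: "qfact_inf \<noteq> (0 :: 'a::comm_ring_1 fps)"
proof
  assume "qfact_inf = (0 :: 'a fps)"
  then have "fps_nth (qfact_inf :: 'a fps) 0 = 0" by simp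
  then show False by (simp add: qfact_inf_0)
qed

lemma ga_map_expo: "ga_map f (expo u) = expo (f u)"
  by transfer simp

lemma ga_map_ring_map:
  assumes "\<And>x y. f (x + y) = f x + f y"
  shows "ring_map (ga_map f)"
  by unfold_locales (use assms in \<open>simp_all add: ga_map_add ga_map_mult ga_map_1\<close>)

lemma dyn_fps_theta:
  fixes w :: "'y::lattice_group \<Rightarrow> 'y"
  assumes w: "add_bij w"
  shows "dyn_fps w (theta (a, b, c)) = theta (a :: 'x::lattice_group, w b, c)"
proof -
  let ?f = "\<lambda>(x::'x, y, n::int). (x, w y, n)"
  have add: "?f (x + y) = ?f x + ?f y" for x y
    using w by (auto simp: add_bij_def split: prod.splits)
  interpret ring_map "ga_map ?f" by (rule ga_map_ring_map) (rule add)
  have "?f (n \<cdot> (a, b, c)) = n \<cdot> (a, w b, c)" for n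
    using zsmul_hom[of ?f n "(a, b, c)"] add by simp
  then have "dyn_fps w (theta (a, b, c)) * qfact_inf = theta (a, w b, c) * qfact_inf"
    unfolding dyn_fps_def fps_map_theta[OF ring_map_axioms] theta_triple_product ga_map_expo by simp
  then show ?thesis using qfact_inf_nz by (metis mult_right_cancel)
qed

section \<open>The model field and the embedding into it\<close>

text \<open>The algebraic closure supplies a square root of -1, the value of the character at the
  first half-period.\<close>

type_synonym 'l model_field = "'l group_alg fract alg_closure"

definition cchar :: "'l::lattice_group \<Rightarrow> 'l model_field" where
  "cchar u = to_ac (to_fract (expo u))"

lemma expo_inj: "expo u = expo v \<Longrightarrow> u = v"
  by transfer (metis lookup_single_eq lookup_single_not_eq one_neq_zero)

lemma expo_neq_minus: "expo u \<noteq> - expo v"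
proof transfer
  fix u v :: 'a
  show "Poly_Mapping.single u (1::rat) \<noteq> - Poly_Mapping.single v 1"
  proof
    assume "Poly_Mapping.single u (1::rat) = - Poly_Mapping.single v 1"
    then have "Poly_Mapping.lookup (Poly_Mapping.single u (1::rat)) u = - Poly_Mapping.lookup (Poly_Mapping.single v 1) u"
      by (metis lookup_uminus)
    then show False by (auto simp: lookup_single when_def split: if_splits)
  qed
qed

lemma cchar_add: "cchar (u + v) = cchar u * cchar v"
  by (simp add: cchar_def expo_add)

lemma cchar_0: "cchar 0 = 1" by (simp add: cchar_def expo_0)

lemma cchar_eq_1: "cchar u = 1 \<Longrightarrow> u = 0"
  using expo_inj[of u 0] by (simp add: cchar_def expo_0 flip: to_fract_1 to_ac_1)

lemma cchar_neq_minus_1: "cchar u \<noteq> - 1"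
  using expo_neq_minus[of u 0] by (simp add: cchar_def expo_0 flip: to_fract_1 to_ac_1 to_fract_uminus to_ac_minus)

definition iunit :: "'l::lattice_group model_field" where
  "iunit = (SOME i. i ^ 2 = - 1)"

lemma iunit_sq: "iunit ^ 2 = - 1"
proof -
  have "\<exists>i :: 'a model_field. i ^ 2 = - 1"
    by (rule nth_root_exists) simp
  then show ?thesis unfolding iunit_def by (rule someI_ex)
qed

text \<open>The hbar direction is unbounded even when both other lattices are 0.\<close>

definition far :: "nat \<Rightarrow> 'x::lattice_group \<times> 'y::lattice_group \<times> int" where
  "far N = (0, 0, int N)"

interpretation model: theta_model "cchar :: 'x::lattice_group \<times> 'y::lattice_group \<times> int \<Rightarrow> _" iunit far
proof
  fix u :: "'x \<times> 'y \<times> int"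
  show "cchar u ^ 2 \<noteq> 1 \<and> cchar u ^ 2 \<noteq> - 1" if "u \<noteq> 0"
  proof -
    have "cchar u ^ 2 = cchar (2 \<cdot> u)" by (simp add: power2_eq_square cchar_add zsmul_2)
    moreover have "2 \<cdot> u \<noteq> 0" using that zsmul_eq_0_iff by (metis zero_neq_numeral)
    ultimately show ?thesis using cchar_eq_1 cchar_neq_minus_1 by metis
  qed
  show "\<forall>\<^sub>F N in sequentially. k \<cdot> far N + u \<noteq> 0" if "0 < k" for k
  proof -
    have "k \<cdot> far N + u \<noteq> 0" if "N > nat \<bar>snd (snd u)\<bar>" for N
    proof -
      have "int N \<le> k * int N" using \<open>0 < k\<close> by (simp add: mult_le_cancel_right1)
      then have "k * int N + snd (snd u) \<noteq> 0" using that by linarith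
      then show ?thesis by (auto simp: far_def zero_prod_def prod_eq_iff)
    qed
    then show ?thesis by (rule eventually_mono[OF eventually_gt_at_top])
  qed
  have "cchar (0 :: 'x \<times> 'y \<times> int) \<noteq> - 1" by (rule cchar_neq_minus_1)
  then show "(1 :: ('x \<times> 'y \<times> int) model_field) \<noteq> - 1" by (simp add: cchar_0)
qed (simp_all add: cchar_add cchar_0 iunit_sq)

definition gmap :: "'l::lattice_group group_alg \<Rightarrow> 'l model_field" where
  "gmap x = to_ac (to_fract (ga_map (\<lambda>u. 6 \<cdot> u) x))"

lemma gmap_ring_map: "ring_map gmap"
proof -
  interpret ring_map "ga_map (\<lambda>u::'a. 6 \<cdot> u)" by (rule ga_map_ring_map) (rule zsmul_add_right)
  show ?thesis by unfold_locales (simp_all add: gmap_def g_add g_mult g_1)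
qed

lemma gmap_eq_0: "gmap x = 0 \<Longrightarrow> x = 0"
proof -
  assume "gmap x = 0"
  then have "ga_map (\<lambda>u. 6 \<cdot> u) x = 0" by (simp add: gmap_def)
  then show "x = 0" by (rule ga_map_inj[rotated]) (auto intro!: injI zsmul_inj[of 6])
qed

lemma gmap_expo: "gmap (expo u) = cchar (6 \<cdot> u)" by (simp add: gmap_def cchar_def ga_map_expo)

text \<open>The substitution \<open>e\<^sup>u \<mapsto> e\<^sup>6\<^sup>u\<close>, \<open>q \<mapsto> r\<^sup>1\<^sup>6\<close>.\<close>

definition psi0 :: "'l::lattice_group group_alg fps \<Rightarrow> 'l model_field fps" where
  "psi0 f = fps_compose (fps_map gmap f) (fps_X ^ 16)"

lemma psi0_mult: "psi0 (a * b) = psi0 a * psi0 b"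
proof -
  interpret ring_map "gmap :: 'a group_alg \<Rightarrow> _" by (rule gmap_ring_map)
  show ?thesis unfolding psi0_def fps_map_mult by (rule fps_compose_mult_distrib) simp
qed

lemma psi0_add: "psi0 (a + b) = psi0 a + psi0 b"
proof -
  interpret ring_map "gmap :: 'a group_alg \<Rightarrow> _" by (rule gmap_ring_map)
  have "fps_map gmap (a + b) = fps_map gmap a + fps_map gmap b"
    by (rule fps_ext) (simp add: fps_map_nth g_add)
  then show ?thesis by (simp add: psi0_def fps_compose_add_distrib)
qed

lemma psi0_nz: "a \<noteq> 0 \<Longrightarrow> psi0 a \<noteq> 0"
proof
  interpret ring_map "gmap :: 'a group_alg \<Rightarrow> _" by (rule gmap_ring_map)
  assume a: "a \<noteq> 0" and "psi0 a = 0"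
  then have "fps_map gmap a = 0" by (simp add: psi0_def fps_compose_eq_0_iff)
  then have "gmap (fps_nth a n) = 0" for n by (metis fps_map_nth fps_zero_nth)
  then show False using a gmap_eq_0 by (metis fps_ext fps_zero_nth)
qed

lemma fsum_compose:
  "fps_compose (fsum I e a) (fps_X ^ 16) = fsum I (\<lambda>i. 16 * e i) (a :: _ \<Rightarrow> 'f::field)"
proof (rule fps_ext)
  fix k
  have "fps_nth (fps_compose (fsum I e a) (fps_X ^ 16)) k = (\<Sum>i=0..k. if k = 16 * i then fps_nth (fsum I e a) i else 0)"
    unfolding fps_compose_nth power_mult[symmetric] fps_X_power_nth by (rule sum.cong) auto
  also have "\<dots> = (\<Sum>i\<in>{i \<in> I. 16 * e i = k}. a i)"
  proof (cases "16 dvd k")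
    case True
    then obtain l where l: "k = 16 * l" by blast
    have "(\<Sum>i=0..k. if k = 16 * i then fps_nth (fsum I e a) i else 0) = (\<Sum>i=0..k. if i = l then fps_nth (fsum I e a) l else 0)"
      by (rule sum.cong) (auto simp: l)
    also have "\<dots> = fps_nth (fsum I e a) l" by (simp add: l)
    finally show ?thesis by (simp add: fsum_nth l)
  next
    case False
    then have "{i \<in> I. 16 * e i = k} = {}" by auto
    moreover have "(\<Sum>i=0..k. if k = 16 * i then fps_nth (fsum I e a) i else 0) = 0"
      using False by (intro sum.neutral) auto
    ultimately show ?thesis by (simp only: sum.empty)
  qed
  finally show "fps_nth (fps_compose (fsum I e a) (fps_X ^ 16)) k = fps_nth (fsum I (\<lambda>i. 16 * e i) a) k"
    by (simp add: fsum_nth)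
qed

lemma fsum_X_power: "fps_X ^ m * fsum I e a = fsum I (\<lambda>i. e i + m) a"
proof (rule fps_ext)
  fix k
  show "fps_nth (fps_X ^ m * fsum I e a) k = fps_nth (fsum I (\<lambda>i. e i + m) a) k"
  proof (cases "k < m")
    case True
    then have "{i \<in> I. e i + m = k} = {}" by auto
    then show ?thesis using True by (simp add: fps_X_power_mult_nth fsum_nth del: Collect_empty_eq)
  next
    case False
    then have "{i \<in> I. e i + m = k} = {i \<in> I. e i = k - m}" by auto
    then show ?thesis using False by (simp add: fps_X_power_mult_nth fsum_nth)
  qed
qed

text \<open>The factor between \<open>model.th\<close> and the image of \<open>theta\<close>:
  Euler's product from the series form, and the \<open>X ^ 2\<close> left over from completing the
  square. It cancels in P and Q, which have as many thetas above as below.\<close>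

definition kappa :: "'l::lattice_group model_field fps fract" where
  "kappa = to_fract (fps_X ^ 2 * fps_compose qfact_inf (fps_X ^ 16))"

lemma kappa_nz: "kappa \<noteq> (0 :: 'l::lattice_group model_field fps fract)"
  by (simp add: kappa_def fps_compose_eq_0_iff qfact_inf_nz)

lemma model_th_eq:
  fixes u :: "'x::lattice_group \<times> 'y::lattice_group \<times> int"
  shows "model.th (6 \<cdot> u, 0, 0) = kappa * to_fract (psi0 (theta u))"
proof -
  interpret ring_map "gmap :: ('x \<times> 'y \<times> int) group_alg \<Rightarrow> _" by (rule gmap_ring_map)
  have ch: "model.chi (v, 0, 0) powi n = cchar (n \<cdot> v)" for v :: "'x \<times> 'y \<times> int" and n
  proof -
    have "cchar v \<noteq> 0" for v :: "'x \<times> 'y \<times> int" using model.ch_nz .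
    moreover have "cchar (a - b) = cchar a / cchar b" for a b :: "'x \<times> 'y \<times> int"
      using cchar_add[of "a - b" b] model.ch_nz[of b] by (simp add: field_simps)
    ultimately have "cchar v powi n = cchar (n \<cdot> v)"
      by (induction n rule: int_induct[of _ 0])
        (simp_all add: cchar_0 zsmul_add_left zsmul_diff_left cchar_add power_int_add power_int_diff)
    then show ?thesis by simp
  qed
  have "fps_X ^ 2 * fps_compose qfact_inf (fps_X ^ 16) * psi0 (theta u) = fps_X ^ 2 * fps_compose (fps_map gmap (theta u) * qfact_inf) (fps_X ^ 16)"
    unfolding psi0_def by (subst fps_compose_mult_distrib) (simp_all add: mult_ac)
  also have "\<dots> = fsum UNIV (\<lambda>j. 16 * tri j + 2) (\<lambda>j. sgn_even j * cchar (6 \<cdot> ((2 * j + 1) \<cdot> u)))"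
    unfolding fps_map_theta[OF ring_map_axioms] fsum_compose fsum_X_power gmap_expo ..
  also have "\<dots> = model.Th (6 \<cdot> u, 0, 0)"
    unfolding model.Th_def
  proof (rule fsum_reindex[symmetric, where h = "\<lambda>j. 2 * j + 1"])
    show "bij_betw (\<lambda>j. 2 * j + 1) UNIV {m::int. odd m}"
      by (rule bij_betw_byWitness[where f' = "\<lambda>m. (m - 1) div 2"]) auto
    fix j :: int
    \<comment> \<open>The origin of the exponent 16: \<open>2 (2 j + 1) ^ 2\<close> is 2 plus 16
      times the triangular number of \<open>j\<close>.\<close>
    have "2 * (2 * j + 1 + model.shift (6 \<cdot> u, 0, 0))\<^sup>2 = int (16 * tri j + 2)"
      using tri_double[of j] by (simp add: model.shift_def power2_eq_square algebra_simps)
    then show "16 * tri j + 2 = nat (2 * (2 * j + 1 + model.shift (6 \<cdot> u, 0, 0))\<^sup>2)" by linarith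
    have "iunit powi (2 * j + 1 - 1) = (sgn_even j :: ('x \<times> 'y \<times> int) model_field)"
      using model.i_even[of j] by (simp add: sgn_even_def)
    then show "sgn_even j * cchar (6 \<cdot> ((2 * j + 1) \<cdot> u)) = iunit powi (2 * j + 1 - 1) * model.chi (6 \<cdot> u, 0, 0) powi (2 * j + 1)"
      unfolding ch zsmul_assoc by (simp add: mult.commute)
  qed
  finally show ?thesis by (simp add: model.th_def kappa_def flip: to_fract_mult)
qed

definition psi :: "'l::lattice_group group_alg fps fract \<Rightarrow> 'l model_field fps fract" where
  "psi = fract_map psi0"

lemma psi_Fract: "b \<noteq> 0 \<Longrightarrow> psi (Fract a b) = Fract (psi0 a) (psi0 b)"
  unfolding psi_def by (rule fract_map_Fract) (simp_all add: psi0_mult psi0_nz)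

lemma psi_add: "psi (a + b) = psi a + psi b"
  by (cases a, cases b) (simp add: psi_Fract psi0_nz psi0_add psi0_mult)

lemma psi_mult: "psi (a * b) = psi a * psi b"
  by (cases a, cases b) (simp add: psi_Fract psi0_mult)

lemma psi_0: "psi (0 :: 'l::lattice_group group_alg fps fract) = 0"
  using psi_add[of "0 :: 'l group_alg fps fract" 0] add_left_imp_eq[of "psi (0 :: 'l group_alg fps fract)" "psi 0" 0]
  by simp

lemma psi_nz: "a \<noteq> 0 \<Longrightarrow> psi a \<noteq> 0"
  by (cases a) (auto simp: psi_Fract eq_fract Zero_fract_def psi0_nz)

lemma psi_1: "psi (1 :: 'l::lattice_group group_alg fps fract) = 1"
  using psi_mult[of "1 :: 'l group_alg fps fract" 1] psi_nz[of "1 :: 'l group_alg fps fract"] by simp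

lemma psi_inj: "psi a = psi b \<Longrightarrow> a = b"
  using psi_add[of "a - b" b] psi_nz[of "a - b"] by auto

lemma psi_quotient:
  fixes a b c d :: "'x::lattice_group \<times> 'y::lattice_group \<times> int"
  assumes "c \<noteq> 0" "d \<noteq> 0"
  shows "psi (Fract (theta a * theta b) (theta c * theta d)) =
    model.th (6 \<cdot> a, 0, 0) * model.th (6 \<cdot> b, 0, 0) / (model.th (6 \<cdot> c, 0, 0) * model.th (6 \<cdot> d, 0, 0))"
proof -
  have "psi (Fract (theta a * theta b) (theta c * theta d)) =
     to_fract (psi0 (theta a)) * to_fract (psi0 (theta b)) / (to_fract (psi0 (theta c)) * to_fract (psi0 (theta d)))"
  proof -
    have "theta c * theta d \<noteq> 0" using assms theta_nonzero by auto
    from psi_Fract[OF this, of "theta a * theta b"] show ?thesis by (simp only: psi0_mult Fract_conv_to_fract to_fract_mult)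
  qed
  then show ?thesis using kappa_nz[where 'l = "'x \<times> 'y \<times> int"] by (simp add: model_th_eq)
qed

type_synonym ('x, 'y) point = "('x \<times> 'y \<times> int) \<times> int \<times> int"

text \<open>There is no factor 6 here, unlike in \<open>lattice_H\<close> and \<open>weight\<close>:
  \<open>lrow\<close> supplies it for coroots, and the other integer vectors serve as sixths of
  coroots.\<close>

definition lattice_J :: "'y::lattice_group \<Rightarrow> 'y \<Rightarrow> int \<times> int \<Rightarrow> ('x::lattice_group, 'y) point" where
  "lattice_J l m = (\<lambda>(a, b). ((0, a \<cdot> l + b \<cdot> m, 0), 0, 0))"

definition lattice_H :: "('x::lattice_group, 'y::lattice_group) point" where
  "lattice_H = (6 \<cdot> hbar, 0, 0)"

text \<open>All points without coroot and hbar components, half-periods included. Adding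
  \<open>lattice_H\<close>, or a nonzero combination of independent coroots, leaves a nonzero
  lattice part, where theta cannot vanish.\<close>

definition lattice_Z :: "(('x::lattice_group, 'y::lattice_group) point) set" where
  "lattice_Z = {z. \<exists>\<beta> w. z = ((\<beta>, 0, 0), w)}"

definition weight :: "'x \<Rightarrow> ('x::lattice_group, 'y::lattice_group) point" where
  "weight \<beta> = (6 \<cdot> zvar \<beta>, 0, 0)"

lemma rank_two_half_model:
  fixes l m :: "'y::lattice_group"
  assumes indep: "\<And>a b. a \<cdot> l + b \<cdot> m = 0 \<Longrightarrow> a = 0 \<and> b = 0"
  shows "rank_two_half (model.th :: ('x::lattice_group, 'y) point \<Rightarrow> _) (\<lambda>N. (far N, 0, 0))
    (lattice_J l m) lattice_H lattice_Z (\<lambda>w. (0, w))"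
proof (intro rank_two_half.intro rank_two.intro model.theta_function_th, unfold_locales)
  fix u v :: "int \<times> int"
  show "lattice_J l m (u + v) = (lattice_J l m u + lattice_J l m v :: ('x, 'y) point)"
    by (cases u; cases v) (simp add: lattice_J_def zsmul_add_left zero_prod_def algebra_simps)
next
  fix z z' :: "('x, 'y) point"
  show "z \<in> lattice_Z \<Longrightarrow> z' \<in> lattice_Z \<Longrightarrow> z - z' \<in> lattice_Z"
  proof -
    assume "z \<in> lattice_Z" "z' \<in> lattice_Z"
    then obtain \<beta> w \<gamma> v where "z = ((\<beta>, 0, 0), w)" "z' = ((\<gamma>, 0, 0), v)" by (auto simp: lattice_Z_def)
    then show "z - z' \<in> lattice_Z" by (simp add: lattice_Z_def zero_prod_def)
  qed
next
  fix v :: "int \<times> int" and z :: "('x, 'y) point"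
  assume v: "v \<noteq> 0" and "z \<in> lattice_Z"
  then obtain \<beta> a b where z: "z = ((\<beta>, 0, 0), a, b)" by (auto simp: lattice_Z_def)
  obtain c d where v': "v = (c, d)" by (cases v)
  have "c \<cdot> l + d \<cdot> m \<noteq> 0" using indep[of c d] v by (auto simp: v' zero_prod_def)
  then show "model.th (lattice_J l m v + z) \<noteq> 0"
    unfolding z v' lattice_J_def by (simp add: model.th_nz_ch zero_prod_def)
next
  fix z :: "('x, 'y) point"
  assume "z \<in> lattice_Z"
  then obtain \<beta> a b where z: "z = ((\<beta>, 0, 0), a, b)" by (auto simp: lattice_Z_def)
  show "model.th (z + lattice_H) \<noteq> 0"
    unfolding z lattice_H_def by (simp add: hbar_def model.th_nz_ch zero_prod_def)
next
  show "(0 :: ('x, 'y) point) \<in> lattice_Z"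
    by (simp add: lattice_Z_def zero_prod_def)
next
  fix v w :: "int \<times> int"
  show "(0 :: 'x \<times> 'y \<times> int, v + w) = (0, v) + (0, w)" by simp
  show "(0 :: 'x \<times> 'y \<times> int, w) \<in> lattice_Z" by (simp add: lattice_Z_def zero_prod_def)
next
  fix a b :: int
  show "odd a \<or> odd b \<Longrightarrow> model.th (0 :: 'x \<times> 'y \<times> int, a, b) \<noteq> 0" by (rule model.th_half_period)
next
  fix w :: "int \<times> int"
  show "\<exists>E c. (\<forall>u v. E (u + v) = E u * E v) \<and> (\<forall>u. E u \<noteq> 0) \<and> c \<noteq> 0 \<and>
      (\<forall>u :: ('x, 'y) point. model.th (u + ((0, w) + (0, w))) = c * E u * model.th u)"
    by (rule model.th_quasi_period)
qed

lemma psi_funP: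
  fixes \<beta> :: "'x::lattice_group" and y :: "'y::lattice_group"
  assumes "y \<noteq> 0"
  shows "psi (funP (lamvar y) (zvar \<beta>)) =
    model.th ((6 \<cdot> lamvar y, 0, 0) - weight \<beta>) * model.th lattice_H / model.th (6 \<cdot> lamvar y, 0, 0) / model.th (weight \<beta> + lattice_H)"
proof -
  have "lamvar y \<noteq> (0 :: 'x \<times> 'y \<times> int)" "zvar \<beta> + hbar \<noteq> (0 :: 'x \<times> 'y \<times> int)"
    using assms by (simp_all add: lamvar_def zvar_def hbar_def zero_prod_def)
  from psi_quotient[OF this(2,1)] show ?thesis
    by (simp add: funP_def weight_def lattice_H_def zsmul_add_right zsmul_diff_right mult.commute zero_prod_def)
qed

lemma psi_funQ:
  fixes \<beta> :: "'x::lattice_group" and y :: "'y::lattice_group"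
  assumes "y \<noteq> 0"
  shows "psi (funQ (lamvar y) (zvar \<beta>)) =
    model.th ((6 \<cdot> lamvar y, 0, 0) + lattice_H) * model.th (weight \<beta>) / model.th (6 \<cdot> lamvar y, 0, 0) / model.th (weight \<beta> + lattice_H)"
proof -
  have "lamvar y \<noteq> (0 :: 'x \<times> 'y \<times> int)" "zvar \<beta> + hbar \<noteq> (0 :: 'x \<times> 'y \<times> int)"
    using assms by (simp_all add: lamvar_def zvar_def hbar_def zero_prod_def)
  from psi_quotient[OF this(2,1)] show ?thesis
    by (simp add: funQ_def weight_def lattice_H_def zsmul_add_right zsmul_diff_right mult.commute zero_prod_def)
qed

lemma dyn_funP:
  fixes w :: "'y::lattice_group \<Rightarrow> 'y" and \<beta> :: "'x::lattice_group"
  assumes w: "add_bij w" and y: "y \<noteq> 0"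
  shows "dyn w (funP (lamvar y) (zvar \<beta>)) = funP (lamvar (w y)) (zvar \<beta>)"
    and "dyn w (funQ (lamvar y) (zvar \<beta>)) = funQ (lamvar (w y)) (zvar \<beta>)"
proof -
  have w0: "w 0 = 0" using w[unfolded add_bij_def, THEN conjunct2, rule_format, of 0 0] by simp
  have nz: "theta (zvar \<beta> + hbar) * theta (lamvar y) \<noteq> (0 :: ('x \<times> 'y \<times> int) group_alg fps)"
  proof -
    have "theta (zvar \<beta> + hbar :: 'x \<times> 'y \<times> int) \<noteq> 0"
      by (rule theta_nonzero) (simp add: zvar_def hbar_def zero_prod_def)
    moreover have "theta (lamvar y :: 'x \<times> 'y \<times> int) \<noteq> 0"
      by (rule theta_nonzero) (simp add: lamvar_def y zero_prod_def)
    ultimately show ?thesis by simp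
  qed
  show "dyn w (funP (lamvar y) (zvar \<beta>)) = funP (lamvar (w y)) (zvar \<beta>)"
    unfolding funP_def dyn_Fract[OF w nz] dyn_fps_mult[OF w]
    by (simp add: lamvar_def zvar_def hbar_def dyn_fps_theta[OF w] w0)
  show "dyn w (funQ (lamvar y) (zvar \<beta>)) = funQ (lamvar (w y)) (zvar \<beta>)"
    unfolding funQ_def dyn_Fract[OF w nz] dyn_fps_mult[OF w]
    by (simp add: lamvar_def zvar_def hbar_def dyn_fps_theta[OF w] w0)
qed

section \<open>Coefficients in the twisted group algebra\<close>

abbreviation "coef \<equiv> Poly_Mapping.lookup"

text \<open>As \<open>v\<close> is its own inverse, \<open>u = w v\<close> is the only element with
  \<open>u v = w\<close>.\<close>

lemma lookup_twisted_mult_involution: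
  assumes keys: "\<And>u. u \<in> Poly_Mapping.keys F \<Longrightarrow> add_bij u" and v: "v \<circ> v = id"
  shows "coef (twisted_mult F (Poly_Mapping.single v a)) w = coef F (w \<circ> v) * dyn (w \<circ> v) a"
proof -
  have eq: "u \<circ> v = w \<longleftrightarrow> u = w \<circ> v" for u
    using v by (auto simp: comp_assoc)
  have "twisted_mult F (Poly_Mapping.single v a) = (\<Sum>u\<in>Poly_Mapping.keys F. Poly_Mapping.single (u \<circ> v) (coef F u * dyn u a))"
    by (subst twisted_mult_superset[of "Poly_Mapping.keys F" "{v}"]) (auto simp: keys)
  then have "coef (twisted_mult F (Poly_Mapping.single v a)) w =
      (\<Sum>u\<in>Poly_Mapping.keys F. if u = w \<circ> v then coef F u * dyn u a else 0)"
    by (simp add: lookup_sum lookup_single when_def eq)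
  then show ?thesis by (simp add: in_keys_iff)
qed

context based_root_datum
begin

abbreviation simple_coroot :: "'i \<Rightarrow> 'y" where "simple_coroot i \<equiv> coroot D (simple_root D i)"
abbreviation cartan :: "'i \<Rightarrow> 'i \<Rightarrow> int" where "cartan i j \<equiv> pairing D (simple_root D i) (simple_coroot j)"
abbreviation QW_mult (infixl "\<star>" 70) where "F \<star> G \<equiv> F \<otimes>\<^bsub>QW D\<^esub> G"

lemma pairing_0_right: "pairing D x 0 = 0" using pairing_add_right[of x 0 0] by simp
lemma pairing_0_left: "pairing D 0 y = 0" using pairing_add_left[of 0 0 y] by simp
lemma pairing_zsmul_right: "pairing D x (n \<cdot> y) = n * pairing D x y"
  using zsmul_hom[of "pairing D x" n y] pairing_add_right by simp
lemma pairing_zsmul_left: "pairing D (n \<cdot> x) y = n * pairing D x y"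
  using zsmul_hom[of "\<lambda>x. pairing D x y" n x] pairing_add_left by simp
lemma pairing_diff_right: "pairing D x (y - z) = pairing D x y - pairing D x z"
  using pairing_add_right[of x "y - z" z] by simp

lemma simple_root_in: "i \<in> index D \<Longrightarrow> simple_root D i \<in> roots D" using simple_roots by blast

lemma pairing_simple_coroot: "i \<in> index D \<Longrightarrow> cartan i i = 2"
  using pairing_root_coroot simple_root_in by blast

lemma srefl_eq: "srefl D i y = y - pairing D (simple_root D i) y \<cdot> simple_coroot i"
  by (simp add: srefl_def coroot_refl_def)

lemma srefl_weyl: "i \<in> index D \<Longrightarrow> srefl D i \<in> carrier (weyl D)"
  using simple_root_in by (auto simp: srefl_def weyl_def intro!: generate.incl)

lemma srefl_srefl: "i \<in> index D \<Longrightarrow> srefl D i \<circ> srefl D i = id"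
  by (auto simp: fun_eq_iff srefl_eq pairing_diff_right pairing_zsmul_right pairing_simple_coroot zsmul_minus_left)

lemma simple_coroot_nz: "i \<in> index D \<Longrightarrow> simple_coroot i \<noteq> 0"
  using pairing_simple_coroot[of i] pairing_0_right by auto

lemma id_weyl: "id \<in> carrier (weyl D)"
  using group.is_monoid[OF weyl_group] monoid.one_closed weyl_one by metis

lemma comp_weyl: "v \<in> carrier (weyl D) \<Longrightarrow> w \<in> carrier (weyl D) \<Longrightarrow> v \<circ> w \<in> carrier (weyl D)"
  using group.is_monoid[OF weyl_group] monoid.m_closed weyl_mult by metis

lemma weyl_add: "w \<in> carrier (weyl D) \<Longrightarrow> w (x + y) = w x + w y"
  using weyl_add_bij by (auto simp: add_bij_def)
lemma weyl_zsmul: "w \<in> carrier (weyl D) \<Longrightarrow> w (n \<cdot> x) = n \<cdot> w x"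
  by (rule zsmul_hom) (rule weyl_add)
lemma weyl_diff: "w \<in> carrier (weyl D) \<Longrightarrow> w (x - y) = w x - w y"
  using weyl_add[of w "x - y" y] by simp
lemma weyl_nz: "w \<in> carrier (weyl D) \<Longrightarrow> y \<noteq> 0 \<Longrightarrow> w y \<noteq> 0"
  using weyl_add_bij[of w] weyl_diff[of w 0 0] by (auto simp: add_bij_def bij_def inj_def)

text \<open>Moving Q to the left of the simple reflection twists it by that reflection; read from
  the coefficient at \<open>w\<close> times the reflection, the total twist is \<open>w\<close>. So
  P and Q are both evaluated at the image of the coroot under \<open>w\<close>, as in
  \<open>word_coeff\<close>.\<close>

lemma lookup_mult_Rmat:
  assumes F: "F \<in> carrier (QW D)" and i: "i \<in> index D" and w: "w \<in> carrier (weyl D)"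
  shows "coef (F \<star> Rmat D i \<beta>) w =
     coef F w * funP (lamvar (w (simple_coroot i))) (zvar \<beta>)
     + coef F (w \<circ> srefl D i) * funQ (lamvar (w (simple_coroot i))) (zvar \<beta>)"
proof -
  let ?s = "srefl D i"
  have keys: "add_bij u" if "u \<in> Poly_Mapping.keys F" for u
    using that F weyl_add_bij by (auto simp: QW_def)
  have s: "add_bij ?s" "add_bij w" "add_bij (w \<circ> ?s)"
    using weyl_add_bij srefl_weyl[OF i] w comp_weyl by auto
  have R: "Rmat D i \<beta> = Poly_Mapping.single id (funP (lamvar (simple_coroot i)) (zvar \<beta>))
     + Poly_Mapping.single ?s (dyn ?s (funQ (lamvar (simple_coroot i)) (zvar \<beta>)))"
    by (simp add: Rmat_def QW_def scalar_def delta_def twisted_mult_single[OF s(1)])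
  have ss: "w \<circ> ?s \<circ> ?s = w" using srefl_srefl[OF i] by (simp add: comp_assoc)
  have "coef (F \<star> Rmat D i \<beta>) w =
     coef F (w \<circ> id) * dyn (w \<circ> id) (funP (lamvar (simple_coroot i)) (zvar \<beta>))
     + coef F (w \<circ> ?s) * dyn (w \<circ> ?s) (dyn ?s (funQ (lamvar (simple_coroot i)) (zvar \<beta>)))"
    unfolding R using keys srefl_srefl[OF i]
    by (simp add: QW_def twisted_mult_add_right lookup_add lookup_twisted_mult_involution del: comp_id)
  also have "dyn (w \<circ> ?s) (dyn ?s (funQ (lamvar (simple_coroot i)) (zvar \<beta>))) = dyn w (funQ (lamvar (simple_coroot i)) (zvar \<beta>))"
    using dyn_comp[OF s(3,1)] ss by simp
  finally show ?thesis unfolding dyn_funP[OF s(2) simple_coroot_nz[OF i]] comp_id .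
qed

lemma lookup_one: "coef \<one>\<^bsub>QW D\<^esub> w = (if w = id then 1 else 0)"
  by (simp add: QW_def lookup_single when_def)

lemma QW_eqI:
  assumes "F \<in> carrier (QW D)" "G \<in> carrier (QW D)"
    and "\<And>w. w \<in> carrier (weyl D) \<Longrightarrow> coef F w = coef G w"
  shows "F = G"
proof (rule poly_mapping_eqI)
  fix w
  show "coef F w = coef G w"
  proof (cases "w \<in> carrier (weyl D)")
    case False
    then have "w \<notin> Poly_Mapping.keys F" "w \<notin> Poly_Mapping.keys G" using assms(1,2) by (auto simp: QW_def)
    then show ?thesis by (simp add: in_keys_iff)
  qed (rule assms(3))
qed

lemma QW_mult_closed: "F \<in> carrier (QW D) \<Longrightarrow> G \<in> carrier (QW D) \<Longrightarrow> F \<star> G \<in> carrier (QW D)"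
  using ring.is_monoid[OF QW_ring] monoid.m_closed by metis

lemma QW_one_closed: "\<one>\<^bsub>QW D\<^esub> \<in> carrier (QW D)"
  using ring.is_monoid[OF QW_ring] monoid.one_closed by metis

lemma QW_one_mult: "F \<in> carrier (QW D) \<Longrightarrow> \<one>\<^bsub>QW D\<^esub> \<star> F = F"
  using ring.is_monoid[OF QW_ring] monoid.l_one by metis

lemma simple_roots_inj: "i \<in> index D \<Longrightarrow> j \<in> index D \<Longrightarrow> i \<noteq> j \<Longrightarrow>
   a \<cdot> simple_root D i + b \<cdot> simple_root D j = 0 \<Longrightarrow> a = 0 \<and> b = 0"
proof -
  assume ij: "i \<in> index D" "j \<in> index D" "i \<noteq> j" and 0: "a \<cdot> simple_root D i + b \<cdot> simple_root D j = 0"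
  define c where "c k = (if k = i then a else if k = j then b else 0)" for k
  have "(\<Sum>k\<in>index D. c k \<cdot> simple_root D k) = (\<Sum>k\<in>{i, j}. c k \<cdot> simple_root D k)"
    using ij finite_index by (intro sum.mono_neutral_right) (auto simp: c_def)
  also have "\<dots> = 0" using ij 0 by (simp add: c_def)
  finally have "c i = 0" "c j = 0" using simple_independent ij by blast+
  then show ?thesis using ij by (simp add: c_def)
qed

end

section \<open>The subgroup generated by two simple reflections\<close>

text \<open>\<open>4 - p * p'\<close> is the determinant of the Cartan matrix of the pair; that it
  is nonzero makes the coroots independent and the encoding by matrices faithful.\<close>

locale simple_pair = based_root_datum D
  for D :: "('x::lattice_group, 'y::lattice_group, 'i) root_data" +
  fixes i j :: 'i and p p' :: int
  assumes i: "i \<in> index D" and j: "j \<in> index D" and ij: "i \<noteq> j"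
    and p: "cartan i j = p"
    and p': "cartan j i = p'"
    and regular: "p * p' \<noteq> 4"
begin

lemma pairing_comb:
  "pairing D (simple_root D i) (a \<cdot> simple_coroot i + b \<cdot> simple_coroot j) = 2 * a + p * b"
  "pairing D (simple_root D j) (a \<cdot> simple_coroot i + b \<cdot> simple_coroot j) = p' * a + 2 * b"
  using p p' pairing_simple_coroot[OF i] pairing_simple_coroot[OF j] by (simp_all add: pairing_add_right pairing_zsmul_right)

lemma independent: "a \<cdot> simple_coroot i + b \<cdot> simple_coroot j = 0 \<Longrightarrow> a = 0 \<and> b = 0"
proof -
  assume "a \<cdot> simple_coroot i + b \<cdot> simple_coroot j = 0"
  then have 1: "2 * a + p * b = 0" "p' * a + 2 * b = 0" using pairing_comb[of a b] pairing_0_right by auto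
  have "(4 - p * p') * a = 2 * (2 * a + p * b) - p * (p' * a + 2 * b)" by (simp add: algebra_simps)
  moreover have "(4 - p * p') * b = 2 * (p' * a + 2 * b) - p' * (2 * a + p * b)" by (simp add: algebra_simps)
  ultimately show ?thesis using 1 regular by auto
qed

sublocale R: rank_two_half "model.th :: ('x, 'y) point \<Rightarrow> _" "\<lambda>N. (far N, 0, 0)"
    "lattice_J (simple_coroot i) (simple_coroot j)" lattice_H lattice_Z p p' "\<lambda>w. (0, w)"
  by (rule rank_two_half_model) (rule independent)

definition ix :: "bool \<Rightarrow> 'i" where "ix k = (if k then i else j)"

lemma ix_in: "ix k \<in> index D" by (simp add: ix_def i j)

fun hasmat :: "('y \<Rightarrow> 'y) \<Rightarrow> mat \<Rightarrow> bool" where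
  "hasmat w (a, b, c, d) \<longleftrightarrow> w (simple_coroot i) = a \<cdot> simple_coroot i + b \<cdot> simple_coroot j \<and> w (simple_coroot j) = c \<cdot> simple_coroot i + d \<cdot> simple_coroot j"

lemma comb_eq: "a \<cdot> simple_coroot i + b \<cdot> simple_coroot j = c \<cdot> simple_coroot i + d \<cdot> simple_coroot j \<Longrightarrow> a = c \<and> b = d"
  using independent[of "a - c" "b - d"] by (simp add: zsmul_diff_left algebra_simps)

lemma hasmat_unique: "hasmat w M \<Longrightarrow> hasmat w N \<Longrightarrow> M = N"
  by (cases M; cases N) (auto dest!: comb_eq)

lemma hasmat_id: "hasmat id (1, 0, 0, 1)" by simp

lemma hasmat_row: "hasmat w M \<Longrightarrow> w (simple_coroot (ix k)) = fst (R.row k M) \<cdot> simple_coroot i + snd (R.row k M) \<cdot> simple_coroot j"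
  by (cases M; cases k) (simp_all add: ix_def)

lemma srefl_simple_coroot:
  "srefl D i (simple_coroot i) = - simple_coroot i" "srefl D i (simple_coroot j) = simple_coroot j - p \<cdot> simple_coroot i"
  "srefl D j (simple_coroot j) = - simple_coroot j" "srefl D j (simple_coroot i) = simple_coroot i - p' \<cdot> simple_coroot j"
  using p p' pairing_simple_coroot[OF i] pairing_simple_coroot[OF j] by (simp_all add: srefl_eq zsmul_2)

lemma hasmat_rmul:
  assumes w: "w \<in> carrier (weyl D)" and M: "hasmat w M"
  shows "hasmat (w \<circ> srefl D (ix k)) (R.rmul k M)"
proof -
  have w0: "w (- x) = - w x" for x using weyl_diff[OF w, of 0 x] weyl_diff[OF w, of 0 0] by simp
  show ?thesis using M
    by (cases M; cases k)
      (auto simp: ix_def srefl_simple_coroot weyl_diff[OF w] weyl_zsmul[OF w] w0 zsmul_diff_left zsmul_minus_left zsmul_add_right zsmul_assoc)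
qed

text \<open>Words grow on the right, as factors are appended to a product of R-matrices.\<close>

inductive_set dihedral :: "('y \<Rightarrow> 'y) set" where
  id: "id \<in> dihedral"
| step: "w \<in> dihedral \<Longrightarrow> w \<circ> srefl D (ix k) \<in> dihedral"

lemma dihedral_weyl: "w \<in> dihedral \<Longrightarrow> w \<in> carrier (weyl D)"
  by (induction rule: dihedral.induct) (blast intro: id_weyl comp_weyl srefl_weyl ix_in)+

lemma dihedral_back: "w \<circ> srefl D (ix k) \<in> dihedral \<Longrightarrow> w \<in> dihedral"
  using dihedral.step[of "w \<circ> srefl D (ix k)" k] srefl_srefl[OF ix_in[of k]] by (simp add: comp_assoc)

lemma dihedral_fixes:
  assumes "w \<in> dihedral" "pairing D (simple_root D i) y = 0" "pairing D (simple_root D j) y = 0"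
  shows "w y = y"
  using assms(1) by (induction rule: dihedral.induct) (auto simp: srefl_eq ix_def assms(2,3))

text \<open>By Cramer's rule, \<open>d\<close> times any \<open>y\<close> is a vector annihilated by
  both simple roots plus a combination of the two coroots. The former is fixed by the whole
  subgroup, the latter by hypothesis, and the lattice is torsion-free.\<close>

lemma dihedral_faithful:
  assumes w: "w \<in> dihedral" and M: "hasmat w (1, 0, 0, 1)"
  shows "w = id"
proof
  fix y
  note W = dihedral_weyl[OF w]
  define d where "d = 4 - p * p'"
  define a where "a = 2 * pairing D (simple_root D i) y - p * pairing D (simple_root D j) y"
  define b where "b = 2 * pairing D (simple_root D j) y - p' * pairing D (simple_root D i) y"
  define z where "z = d \<cdot> y - (a \<cdot> simple_coroot i + b \<cdot> simple_coroot j)"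
  have "pairing D (simple_root D i) z = 0" "pairing D (simple_root D j) z = 0"
    unfolding z_def pairing_diff_right pairing_comb pairing_zsmul_right
    by (simp_all add: d_def a_def b_def algebra_simps)
  then have "w z = z" by (rule dihedral_fixes[OF w])
  moreover have "w (a \<cdot> simple_coroot i + b \<cdot> simple_coroot j) = a \<cdot> simple_coroot i + b \<cdot> simple_coroot j"
    using M by (simp add: weyl_add[OF W] weyl_zsmul[OF W])
  moreover have "d \<cdot> y = z + (a \<cdot> simple_coroot i + b \<cdot> simple_coroot j)" by (simp add: z_def)
  ultimately have "w (d \<cdot> y) = d \<cdot> y" by (simp add: weyl_add[OF W])
  then have "d \<cdot> w y = d \<cdot> y" by (simp add: weyl_zsmul[OF W])
  moreover have "d \<noteq> 0" using regular by (simp add: d_def)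
  ultimately show "w y = id y" using zsmul_inj by auto
qed

text \<open>The link between the algebra and the model, through the injection \<open>psi\<close>;
  the word is reversed as in \<open>word_coeff\<close>. Vanishing off \<open>dihedral\<close> is
  recorded separately, since elements there need not have a matrix.\<close>

definition represents :: "(('y \<Rightarrow> 'y) \<Rightarrow>\<^sub>0 ('x, 'y) dynfield) \<Rightarrow> (bool \<times> ('x, 'y) point) list \<Rightarrow> bool" where
  "represents F zs \<longleftrightarrow> F \<in> carrier (QW D) \<and>
     (\<forall>w\<in>carrier (weyl D). (w \<notin> dihedral \<longrightarrow> coef F w = 0) \<and>
        (w \<in> dihedral \<longrightarrow> (\<forall>M. hasmat w M \<longrightarrow> psi (coef F w) = R.word_coeff zs M)))"

lemma representsD:
  assumes "represents F zs" "w \<in> carrier (weyl D)"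
  shows "w \<notin> dihedral \<Longrightarrow> coef F w = 0"
    and "w \<in> dihedral \<Longrightarrow> hasmat w M \<Longrightarrow> psi (coef F w) = R.word_coeff zs M"
  using assms unfolding represents_def by blast+

lemma represents_one: "represents \<one>\<^bsub>QW D\<^esub> []"
  unfolding represents_def
proof (intro conjI ballI impI allI QW_one_closed)
  show "coef \<one>\<^bsub>QW D\<^esub> w = 0" if "w \<notin> dihedral" for w
    using that dihedral.id by (auto simp: lookup_one)
  show "psi (coef \<one>\<^bsub>QW D\<^esub> w) = R.word_coeff [] M" if "w \<in> dihedral" "hasmat w M" for w M
    using that dihedral_faithful[of w] hasmat_unique[OF hasmat_id, of M]
    by (auto simp: lookup_one psi_0 psi_1)
qed

lemma represents_mult:
  assumes "represents F zs"
  shows "represents (F \<star> Rmat D (ix k) \<beta>) ((k, weight \<beta>) # zs)"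
proof -
  have F: "F \<in> carrier (QW D)" using assms by (simp add: represents_def)
  note look = lookup_mult_Rmat[OF F ix_in[of k]]
  show ?thesis
    unfolding represents_def
  proof (intro conjI ballI impI allI)
    show "F \<star> Rmat D (ix k) \<beta> \<in> carrier (QW D)" by (intro QW_mult_closed F Rmat_closed ix_in)
    fix w assume w: "w \<in> carrier (weyl D)"
    have ws: "w \<circ> srefl D (ix k) \<in> carrier (weyl D)" using comp_weyl[OF w srefl_weyl[OF ix_in]] .
    show "coef (F \<star> Rmat D (ix k) \<beta>) w = 0" if "w \<notin> dihedral"
      using representsD(1)[OF assms w that] representsD(1)[OF assms ws] that dihedral_back[of w k]
      by (auto simp: look[OF w])
    fix M assume wd: "w \<in> dihedral" and M: "hasmat w M"
    have IH: "psi (coef F w) = R.word_coeff zs M"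
      "psi (coef F (w \<circ> srefl D (ix k))) = R.word_coeff zs (R.rmul k M)"
      using representsD(2)[OF assms w wd M] representsD(2)[OF assms ws dihedral.step[OF wd] hasmat_rmul[OF w M]] by blast+
    have nz: "w (simple_coroot (ix k)) \<noteq> 0" by (rule weyl_nz[OF w simple_coroot_nz[OF ix_in]])
    have l: "(6 \<cdot> lamvar (w (simple_coroot (ix k))), 0, 0) = R.lrow k M"
      unfolding R.lrow_def hasmat_row[OF M]
      by (cases "R.row k M") (simp add: lattice_J_def lamvar_def zsmul_add_right zsmul_assoc)
    show "psi (coef (F \<star> Rmat D (ix k) \<beta>) w) = R.word_coeff ((k, weight \<beta>) # zs) M"
      unfolding look[OF w] psi_add psi_mult IH psi_funP[OF nz] psi_funQ[OF nz] l
      by (simp add: R.pc_def R.qc_def add_divide_distrib)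
  qed
qed

lemma represents_eq:
  assumes F: "represents F zs" and G: "represents G zs'"
    and id: "(1, 0, 0, 1) \<in> S" and rmul: "\<And>k M. M \<in> S \<Longrightarrow> R.rmul k M \<in> S"
    and eq: "\<And>M. M \<in> S \<Longrightarrow> R.word_coeff zs M = R.word_coeff zs' M"
  shows "F = G"
proof (rule QW_eqI)
  fix w assume w: "w \<in> carrier (weyl D)"
  show "coef F w = coef G w"
  proof (cases "w \<in> dihedral")
    case True
    have "\<exists>M\<in>S. hasmat w M" using True
      by (induction rule: dihedral.induct) (blast intro: hasmat_id hasmat_rmul dihedral_weyl id rmul)+
    then obtain M where "M \<in> S" "hasmat w M" by blast
    then have "psi (coef F w) = psi (coef G w)"
      using representsD(2)[OF F w True] representsD(2)[OF G w True] eq by metis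
    then show ?thesis by (rule psi_inj)
  next
    case False
    then show ?thesis using representsD(1)[OF F w] representsD(1)[OF G w] by simp
  qed
qed (use F G in \<open>simp_all add: represents_def\<close>)

end

section \<open>Weights as points of the model, and unitarity\<close>

lemma weight_add: "weight (x + y) = weight x + weight y"
  by (simp add: weight_def zvar_def zsmul_add_right zero_prod_def)

lemma weight_minus: "weight (- x) = - weight x"
  by (simp add: weight_def zvar_def zsmul_minus_right zero_prod_def)

lemma weight_0: "weight 0 = 0" by (simp add: weight_def zvar_def zero_prod_def)

lemma weight_Z: "weight x \<in> lattice_Z"
  by (auto simp: weight_def zvar_def lattice_Z_def)

lemma th_weight_nz:
  fixes x :: "'x::lattice_group"
  assumes "x \<noteq> 0" shows "model.th (weight x :: ('x, 'y::lattice_group) point) \<noteq> 0"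
  unfolding weight_def by (rule model.th_nz_ch) (simp add: zvar_def zsmul_eq_0_iff assms zero_prod_def)

lemma th_weight_H_nz: "model.th (weight (x :: 'x::lattice_group) + lattice_H :: ('x, 'y::lattice_group) point) \<noteq> 0"
  by (simp add: weight_def lattice_H_def, rule model.th_nz_ch) (simp add: zvar_def hbar_def zero_prod_def)

lemma double_nz: "x \<noteq> 0 \<Longrightarrow> x + x \<noteq> (0 :: 'l::lattice_group)"
  using zsmul_eq_0_iff[of 2 x] by (simp add: zsmul_2)

text \<open>The coefficients of h(x) h(-x) at the identity and at the reflection. In the model the
  first is \<open>theta_unitarity\<close> and the second cancels by oddness. Only one coroot is
  involved, so that root systems of rank one are covered.\<close>

lemma R_unitarity:
  fixes y :: "'y::lattice_group" and x :: "'x::lattice_group"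
  assumes y: "y \<noteq> 0"
  shows "funP (lamvar y) (zvar x) * funP (lamvar y) (zvar (- x)) + funQ (lamvar (- y)) (zvar x) * funQ (lamvar y) (zvar (- x)) = 1" (is "?A = _")
    and "funQ (lamvar (- y)) (zvar x) * funP (lamvar (- y)) (zvar (- x)) + funP (lamvar y) (zvar x) * funQ (lamvar (- y)) (zvar (- x)) = 0" (is "?B = _")
proof -
  interpret T: theta_function "model.th :: ('x, 'y) point \<Rightarrow> _" "\<lambda>N. (far N, 0, 0)"
    by (rule model.theta_function_th)
  define l :: "('x, 'y) point" where "l = (6 \<cdot> lamvar y, 0, 0)"
  define z :: "('x, 'y) point" where "z = weight x"
  define h :: "('x, 'y) point" where "h = lattice_H"
  have l: "model.th l \<noteq> 0"
    unfolding l_def by (rule model.th_nz_ch) (simp add: lamvar_def zsmul_eq_0_iff y zero_prod_def)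
  have ml: "(6 \<cdot> lamvar (- y), 0, 0) = - l"
    by (simp add: l_def lamvar_def zsmul_minus_right)
  have hz: "model.th (h + z) \<noteq> 0" "model.th (h - z) \<noteq> 0"
    using th_weight_H_nz[of x, where 'y = 'y] th_weight_H_nz[of "- x", where 'y = 'y]
    by (simp_all add: h_def z_def weight_minus add.commute)
  have y': "- y \<noteq> 0" using y by simp
  have e: "- l - z = - (l + z)" "- l - - z = - (l - z)" "- l + h = h - l" "l - - z = l + z" "- z + h = h - z" "z + h = h + z"
    by simp_all
  note P = psi_funP[OF y] psi_funQ[OF y] psi_funP[OF y'] psi_funQ[OF y']
  note P' = P[of x, folded z_def h_def l_def, unfolded ml[folded l_def]] P[of "- x", unfolded weight_minus, folded z_def h_def l_def, unfolded ml[folded l_def]]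
  have "psi (?A)
    = (model.th (l - z) * model.th h / model.th l * (model.th (l + z) * model.th h / model.th l)
       + model.th (h - l) * model.th z / model.th l * (model.th (l + h) * model.th z / model.th l)) / (model.th (h + z) * model.th (h - z))"
    unfolding psi_add psi_mult P' ml e T.th_minus using l hz by (simp add: field_simps)
  also have "\<dots> = psi 1" unfolding T.theta_unitarity[OF l] using hz by (simp add: psi_1)
  finally show "?A = 1"
    by (rule psi_inj)
  have "psi (?B) = psi 0"
    unfolding psi_add psi_mult P' ml e T.th_minus psi_0 by (simp add: mult_ac)
  then show "?B = 0"
    by (rule psi_inj)
qed

lemma (in based_root_datum) Rmat_unitary:
  assumes i: "i \<in> index D"
  shows "Rmat D i x \<star> Rmat D i (- x) = \<one>\<^bsub>QW D\<^esub>"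
proof -
  let ?s = "srefl D i"
  have R: "Rmat D i x \<in> carrier (QW D)" by (rule Rmat_closed[OF i])
  have s: "?s \<in> carrier (weyl D)" by (rule srefl_weyl[OF i])
  have ss: "?s \<circ> ?s = id" by (rule srefl_srefl[OF i])
  have sy: "?s (simple_coroot i) = - simple_coroot i" by (simp add: srefl_eq pairing_simple_coroot[OF i] zsmul_2)
  have s_id: "?s \<noteq> id"
  proof
    assume "?s = id"
    then have "simple_coroot i + simple_coroot i = 0" using sy by (metis id_apply add.right_inverse)
    then show False using double_nz[OF simple_coroot_nz[OF i]] by simp
  qed
  have ws: "w \<circ> ?s = id \<longleftrightarrow> w = ?s" for w using ss by (metis comp_assoc comp_id id_comp)
  have one: "coef (Rmat D i x) w =
      (if w = id then funP (lamvar (simple_coroot i)) (zvar x) else if w = ?s then funQ (lamvar (- simple_coroot i)) (zvar x) else 0)"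
    if "w \<in> carrier (weyl D)" for w
    using lookup_mult_Rmat[OF QW_one_closed i that, of x] s_id
    by (auto simp: QW_one_mult[OF R] lookup_one ws sy)
  show ?thesis
  proof (rule QW_eqI)
    show "Rmat D i x \<star> Rmat D i (- x) \<in> carrier (QW D)" by (intro QW_mult_closed Rmat_closed i)
    fix w assume w: "w \<in> carrier (weyl D)"
    have w2: "coef (Rmat D i x \<star> Rmat D i (- x)) w =
       coef (Rmat D i x) w * funP (lamvar (w (simple_coroot i))) (zvar (- x))
       + coef (Rmat D i x) (w \<circ> ?s) * funQ (lamvar (w (simple_coroot i))) (zvar (- x))"
      by (rule lookup_mult_Rmat[OF R i w])
    consider "w = id" | "w = ?s" | "w \<noteq> id" "w \<noteq> ?s" by blast
    then show "coef (Rmat D i x \<star> Rmat D i (- x)) w = coef \<one>\<^bsub>QW D\<^esub> w"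
    proof cases
      case 1
      then show ?thesis unfolding w2 lookup_one one[OF w] one[OF comp_weyl[OF w s]]
        using R_unitarity(1)[OF simple_coroot_nz[OF i]] s_id by simp
    next
      case 2
      then show ?thesis unfolding w2 lookup_one one[OF w] one[OF comp_weyl[OF w s]]
        using R_unitarity(2)[OF simple_coroot_nz[OF i]] s_id by (simp add: ss sy)
    next
      case 3
      then have "w \<circ> ?s \<noteq> ?s" "w \<circ> ?s \<noteq> id" using ws ss by (metis comp_assoc comp_id id_comp)+
      then show ?thesis using 3 unfolding w2 lookup_one one[OF w] one[OF comp_weyl[OF w s]] by simp
    qed
  qed (rule QW_one_closed)
qed

section \<open>The Yang-Baxter equations by type\<close>

context simple_pair begin

lemma represents_i: "represents F zs \<Longrightarrow> represents (F \<star> Rmat D i \<beta>) ((True, weight \<beta>) # zs)"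
  using represents_mult[of F zs True \<beta>] by (simp add: ix_def)

lemma represents_j: "represents F zs \<Longrightarrow> represents (F \<star> Rmat D j \<beta>) ((False, weight \<beta>) # zs)"
  using represents_mult[of F zs False \<beta>] by (simp add: ix_def)

lemma represents_i1: "represents (Rmat D i \<beta>) [(True, weight \<beta>)]"
  using represents_i[OF represents_one, of \<beta>] QW_one_mult[OF Rmat_closed[OF i]] by simp

lemma represents_j1: "represents (Rmat D j \<beta>) [(False, weight \<beta>)]"
  using represents_j[OF represents_one, of \<beta>] QW_one_mult[OF Rmat_closed[OF j]] by simp

lemmas represents_rules = represents_i represents_j represents_i1 represents_j1

text \<open>For orthogonal roots each reflection fixes the other coroot, so every coefficient is a
  single product and the two words agree factor by factor.\<close>

lemma yang_baxter_A1A1: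
  assumes pp: "p = 0" "p' = 0"
  shows "Rmat D i x \<star> Rmat D j y = Rmat D j y \<star> Rmat D i x"
proof (rule represents_eq)
  show "represents (Rmat D i x \<star> Rmat D j y) [(False, weight y), (True, weight x)]"
    "represents (Rmat D j y \<star> Rmat D i x) [(True, weight x), (False, weight y)]"
    by (intro represents_rules)+
  let ?S = "{(a, 0, 0, d) |a d. \<bar>a\<bar> = 1 \<and> \<bar>d\<bar> = 1} :: mat set"
  show "(1, 0, 0, 1) \<in> ?S" by simp
  have rmul: "R.rmul True (a, b, c, d) = (- a, - b, c, d)" "R.rmul False (a, b, c, d) = (a, b, - c, - d)" for a b c d
    by simp_all (simp_all add: pp)
  show "R.rmul k M \<in> ?S" if "M \<in> ?S" for k M
    using that by (cases k) (auto simp: rmul simp del: R.rmul.simps)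
  show "R.word_coeff [(False, weight y), (True, weight x)] M = R.word_coeff [(True, weight x), (False, weight y)] M" if "M \<in> ?S" for M
    using that by (auto simp: rmul R.pc_def R.qc_def R.lrow_def mult_ac simp del: R.rmul.simps)
qed

lemma yang_baxter_A2:
  assumes pp: "p = - 1" "p' = - 1"
  shows "Rmat D i x \<star> Rmat D j (x + y) \<star> Rmat D i y
       = Rmat D j y \<star> Rmat D i (x + y) \<star> Rmat D j x"
proof (rule represents_eq)
  show "represents (Rmat D i x \<star> Rmat D j (x + y) \<star> Rmat D i y) [(True, weight y), (False, weight (x + y)), (True, weight x)]"
    "represents (Rmat D j y \<star> Rmat D i (x + y) \<star> Rmat D j x) [(False, weight x), (True, weight (x + y)), (False, weight y)]"
    by (intro represents_rules)+
  show "(1, 0, 0, 1) \<in> dihedral_A2" by (simp add: dihedral_A2_def)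
  have rmul: "R.rmul True (a, b, c, d) = (- a, - b, c + a, d + b)" "R.rmul False (a, b, c, d) = (a + c, b + d, - c, - d)" for a b c d
    by simp_all (simp_all add: pp)
  show "R.rmul k M \<in> dihedral_A2" if "M \<in> dihedral_A2" for k M
    using that unfolding dihedral_A2_def by (cases k) (auto simp: rmul simp del: R.rmul.simps)
  show "R.word_coeff [(True, weight y), (False, weight (x + y)), (True, weight x)] M = R.word_coeff [(False, weight x), (True, weight (x + y)), (False, weight y)] M"
    if "M \<in> dihedral_A2" for M
    unfolding weight_add
    by (rule R.word_coeff_A2[OF pp that weight_Z weight_Z]) (use th_weight_nz[of y] weight_0 in auto)
qed

lemma yang_baxter_B2:
  assumes pp: "p = - 2" "p' = - 1"
  shows "Rmat D i x \<star> Rmat D j (x + y) \<star> Rmat D i (x + 2 \<cdot> y) \<star> Rmat D j y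
       = Rmat D j y \<star> Rmat D i (x + 2 \<cdot> y) \<star> Rmat D j (x + y) \<star> Rmat D i x"
proof (rule represents_eq)
  show "represents (Rmat D i x \<star> Rmat D j (x + y) \<star> Rmat D i (x + 2 \<cdot> y) \<star> Rmat D j y)
      [(False, weight y), (True, weight (x + 2 \<cdot> y)), (False, weight (x + y)), (True, weight x)]"
    "represents (Rmat D j y \<star> Rmat D i (x + 2 \<cdot> y) \<star> Rmat D j (x + y) \<star> Rmat D i x)
      [(True, weight x), (False, weight (x + y)), (True, weight (x + 2 \<cdot> y)), (False, weight y)]"
    by (intro represents_rules)+
  show "(1, 0, 0, 1) \<in> dihedral_B2" by (simp add: dihedral_B2_def)
  have rmul: "R.rmul True (a, b, c, d) = (- a, - b, c + 2 * a, d + 2 * b)" "R.rmul False (a, b, c, d) = (a + c, b + d, - c, - d)" for a b c d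
    by simp_all (simp_all add: pp)
  show "R.rmul k M \<in> dihedral_B2" if "M \<in> dihedral_B2" for k M
    using that unfolding dihedral_B2_def by (cases k) (auto simp: rmul simp del: R.rmul.simps)
  show "R.word_coeff [(False, weight y), (True, weight (x + 2 \<cdot> y)), (False, weight (x + y)), (True, weight x)] M
      = R.word_coeff [(True, weight x), (False, weight (x + y)), (True, weight (x + 2 \<cdot> y)), (False, weight y)] M"
    if "M \<in> dihedral_B2" for M
    unfolding zsmul_2 weight_add
  proof (rule R.word_coeff_B2[OF pp that weight_Z weight_Z])
    show "(weight y :: ('x, 'y) point) = 0 \<or>
      model.th (weight y :: ('x, 'y) point) \<noteq> 0 \<and> model.th (weight y + weight y :: ('x, 'y) point) \<noteq> 0"
    proof (cases "y = 0")
      case False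
      then show ?thesis
        using th_weight_nz[OF False, where 'y = 'y] th_weight_nz[OF double_nz[OF False], where 'y = 'y]
        by (simp add: weight_add)
    qed (simp add: weight_0)
  qed
qed

lemma yang_baxter_G2:
  assumes pp: "p = - 3" "p' = - 1"
  shows "Rmat D i x \<star> Rmat D j (x + y) \<star> Rmat D i (2 \<cdot> x + 3 \<cdot> y) \<star> Rmat D j (x + 2 \<cdot> y)
           \<star> Rmat D i (x + 3 \<cdot> y) \<star> Rmat D j y
       = Rmat D j y \<star> Rmat D i (x + 3 \<cdot> y) \<star> Rmat D j (x + 2 \<cdot> y) \<star> Rmat D i (2 \<cdot> x + 3 \<cdot> y)
           \<star> Rmat D j (x + y) \<star> Rmat D i x"
proof (rule represents_eq)
  show "represents (Rmat D i x \<star> Rmat D j (x + y) \<star> Rmat D i (2 \<cdot> x + 3 \<cdot> y) \<star> Rmat D j (x + 2 \<cdot> y)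
           \<star> Rmat D i (x + 3 \<cdot> y) \<star> Rmat D j y)
      [(False, weight y), (True, weight (x + 3 \<cdot> y)), (False, weight (x + 2 \<cdot> y)), (True, weight (2 \<cdot> x + 3 \<cdot> y)),
       (False, weight (x + y)), (True, weight x)]"
    "represents (Rmat D j y \<star> Rmat D i (x + 3 \<cdot> y) \<star> Rmat D j (x + 2 \<cdot> y) \<star> Rmat D i (2 \<cdot> x + 3 \<cdot> y)
           \<star> Rmat D j (x + y) \<star> Rmat D i x)
      [(True, weight x), (False, weight (x + y)), (True, weight (2 \<cdot> x + 3 \<cdot> y)), (False, weight (x + 2 \<cdot> y)),
       (True, weight (x + 3 \<cdot> y)), (False, weight y)]"
    by (intro represents_rules)+
  show "(1, 0, 0, 1) \<in> dihedral_G2" by (simp add: dihedral_G2_def)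
  have rmul: "R.rmul True (a, b, c, d) = (- a, - b, c + 3 * a, d + 3 * b)" "R.rmul False (a, b, c, d) = (a + c, b + d, - c, - d)" for a b c d
    by simp_all (simp_all add: pp)
  show "R.rmul k M \<in> dihedral_G2" if "M \<in> dihedral_G2" for k M
    using that unfolding dihedral_G2_def by (cases k) (auto simp: rmul simp del: R.rmul.simps)
  show "R.word_coeff [(False, weight y), (True, weight (x + 3 \<cdot> y)), (False, weight (x + 2 \<cdot> y)), (True, weight (2 \<cdot> x + 3 \<cdot> y)),
       (False, weight (x + y)), (True, weight x)] M
      = R.word_coeff [(True, weight x), (False, weight (x + y)), (True, weight (2 \<cdot> x + 3 \<cdot> y)), (False, weight (x + 2 \<cdot> y)),
       (True, weight (x + 3 \<cdot> y)), (False, weight y)] M"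
    if "M \<in> dihedral_G2" for M
    unfolding zsmul_2 zsmul_numerals weight_add
  proof (rule R.word_coeff_G2[OF pp that weight_Z])
    \<comment> \<open>\<open>weight y\<close> carries the factor 6, so its half is \<open>3\<close>
      times \<open>y\<close>.\<close>
    let ?h = "((3 \<cdot> y, 0, 0), 0, 0) :: ('x, 'y) point"
    show "?h \<in> lattice_Z" by (auto simp: lattice_Z_def)
    show "weight y = ?h + ?h"
      by (simp add: weight_def zvar_def zsmul_numerals zero_prod_def add.assoc)
    show "?h = 0 \<or> (\<forall>n w. n \<noteq> 0 \<longrightarrow> model.th (n \<cdot> ?h + (0, w)) \<noteq> 0)"
    proof (cases "y = 0")
      case False
      then show ?thesis
        by (auto simp: zsmul_assoc zsmul_eq_0_iff zero_prod_def intro!: model.th_nz_ch)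
    qed (simp add: zero_prod_def)
  qed
qed

end

section \<open>Cartan integers from the order of a product of reflections and from relative
  length\<close>

context based_root_datum begin

lemma weyl_pow: "w \<in> carrier (weyl D) \<Longrightarrow> w [^]\<^bsub>weyl D\<^esub> (n::nat) = w ^^ n"
proof (induction n)
  case 0
  then show ?case by (simp add: weyl_one)
next
  case (Suc n)
  interpret W: group "weyl D" by (rule weyl_group)
  have "w [^]\<^bsub>weyl D\<^esub> n \<in> carrier (weyl D)" using Suc.prems by simp
  then show ?case using Suc by (simp add: weyl_mult funpow_swap1 fun_eq_iff)
qed

text \<open>The reflection of simple root \<open>j\<close> in simple root \<open>i\<close> is a root
  with coefficient 1 at \<open>j\<close>, hence positive, and its coefficient at \<open>i\<close> is
  \<open>- cartan j i\<close>.\<close>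

lemma pairing_simple_nonpos:
  assumes i: "i \<in> index D" and j: "j \<in> index D" and ij: "i \<noteq> j"
  shows "cartan j i \<le> 0"
proof -
  define p where "p = cartan j i"
  have "root_refl D (simple_root D i) (simple_root D j) \<in> roots D"
    using refl_roots[OF simple_root_in[OF i]] simple_root_in[OF j] by blast
  then have "simple_root D j - p \<cdot> simple_root D i \<in> roots D" by (simp add: root_refl_def p_def)
  then obtain c where c: "\<And>k. k \<in> index D \<Longrightarrow> c k \<ge> 0"
    and eq: "simple_root D j - p \<cdot> simple_root D i = (\<Sum>k\<in>index D. c k \<cdot> simple_root D k) \<or>
      simple_root D j - p \<cdot> simple_root D i = - (\<Sum>k\<in>index D. c k \<cdot> simple_root D k)"
    using simple_generate by blast
  define e where "e k = (if k = j then 1 else if k = i then - p else 0)" for k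
  have "(\<Sum>k\<in>index D. e k \<cdot> simple_root D k) = (\<Sum>k\<in>{i, j}. e k \<cdot> simple_root D k)"
    using i j finite_index by (intro sum.mono_neutral_right) (auto simp: e_def)
  also have "\<dots> = simple_root D j - p \<cdot> simple_root D i" using ij by (simp add: e_def zsmul_minus_left)
  finally have e: "simple_root D j - p \<cdot> simple_root D i = (\<Sum>k\<in>index D. e k \<cdot> simple_root D k)" ..
  show ?thesis
  proof (rule disjE[OF eq])
    assume "simple_root D j - p \<cdot> simple_root D i = (\<Sum>k\<in>index D. c k \<cdot> simple_root D k)"
    then have "(\<Sum>k\<in>index D. (e k - c k) \<cdot> simple_root D k) = 0"
      by (simp add: e zsmul_diff_left sum_subtractf)
    then have "e i - c i = 0" by (rule simple_independent) (rule i)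
    then show ?thesis using c[OF i] ij by (simp add: e_def p_def)
  next
    assume "simple_root D j - p \<cdot> simple_root D i = - (\<Sum>k\<in>index D. c k \<cdot> simple_root D k)"
    then have "(\<Sum>k\<in>index D. (e k + c k) \<cdot> simple_root D k) = 0"
      by (simp add: e zsmul_add_left sum.distrib)
    then have "e j + c j = 0" by (rule simple_independent) (rule j)
    then show ?thesis using c[OF j] by (simp add: e_def)
  qed
qed

text \<open>Invariance under a reflection makes \<open>cartan l k\<close> times the squared length
  of root \<open>k\<close> symmetric in \<open>k\<close> and \<open>l\<close>. Hence the ratio of
  the two Cartan integers is inverse to that of the squared lengths of the roots whose coroots they
  involve.\<close>

lemma longer_pairing:
  assumes i: "i \<in> index D" and j: "j \<in> index D" and long: "longer D (simple_root D i) (simple_root D j)"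
    and neg: "cartan i j < 0" "cartan j i < 0"
  shows "cartan i j < cartan j i"
proof -
  obtain B where B: "invariant_form D B" and gt: "B (simple_root D i) (simple_root D i) > B (simple_root D j) (simple_root D j)"
    using long by (auto simp: longer_def)
  have add: "B (x + x') y = B x y + B x' y" and sym: "B x y = B y x" and pos: "x \<noteq> 0 \<Longrightarrow> B x x > 0"
    and inv: "\<alpha> \<in> roots D \<Longrightarrow> B (root_refl D \<alpha> x) (root_refl D \<alpha> y) = B x y" for x x' y \<alpha>
    using B unfolding invariant_form_def by blast+
  have "n \<cdot> (r::rat) = of_int n * r" for n r
    by (cases "n \<ge> 0") (simp_all add: zsmul_def)
  then have smul: "B (n \<cdot> x) y = of_int n * B x y" for n x y
    using zsmul_hom[of "\<lambda>x. B x y" n x] add by simp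
  have diff: "B (x - x') y = B x y - B x' y" for x x' y using add[of "x - x'" x' y] by simp
  have minus: "B (- x) y = - B x y" for x y using diff[of 0 x y] add[of 0 0 y] by simp
  have minus_right: "B x (- y) = - B x y" for x y using minus[of y x] sym[of x] by simp
  have key: "of_int (cartan l k) * B (simple_root D k) (simple_root D k) = 2 * B (simple_root D l) (simple_root D k)"
    if k: "k \<in> index D" for k l
  proof -
    have r: "root_refl D (simple_root D k) (simple_root D k) = - simple_root D k"
      by (simp add: root_refl_def pairing_simple_coroot[OF k] zsmul_2)
    have "B (simple_root D l) (simple_root D k) = B (simple_root D l - cartan l k \<cdot> simple_root D k) (- simple_root D k)"
      using inv[OF simple_root_in[OF k], of "simple_root D l" "simple_root D k"] r by (simp add: root_refl_def)
    also have "\<dots> = - (B (simple_root D l) (simple_root D k) - of_int (cartan l k) * B (simple_root D k) (simple_root D k))"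
      by (simp only: minus_right diff smul)
    finally show ?thesis by simp
  qed
  have eq: "of_int (cartan j i) * B (simple_root D i) (simple_root D i)
      = of_int (cartan i j) * B (simple_root D j) (simple_root D j)"
    unfolding key[OF i, of j] key[OF j, of i] sym[of "simple_root D i" "simple_root D j"] ..
  have "simple_root D j \<noteq> 0" using pairing_simple_coroot[OF j] pairing_0_left by auto
  then have pj: "B (simple_root D j) (simple_root D j) > 0" by (rule pos)
  show ?thesis
  proof (rule ccontr)
    assume "\<not> ?thesis"
    then have "of_int (cartan j i) * B (simple_root D j) (simple_root D j)
       \<le> (of_int (cartan i j) * B (simple_root D j) (simple_root D j) :: rat)"
      using pj by (intro mult_right_mono) auto
    moreover have "of_int (cartan j i) * B (simple_root D i) (simple_root D i)
       < of_int (cartan j i) * B (simple_root D j) (simple_root D j)"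
      using gt neg(2) by (intro mult_strict_left_mono_neg) auto
    ultimately show False using eq by simp
  qed
qed

text \<open>
  By Cayley--Hamilton the powers of \<open>s\<^sub>i s\<^sub>j\<close>, which has determinant 1 and trace \<open>p * p' - 2\<close> on the span of
  the two coroots, are given by Chebyshev polynomials of the trace.
\<close>

fun cheb :: "int \<Rightarrow> nat \<Rightarrow> int" where
  "cheb T 0 = 0" | "cheb T (Suc 0) = 1" | "cheb T (Suc (Suc n)) = T * cheb T (Suc n) - cheb T n"

lemma coxeter_power:
  assumes i: "i \<in> index D" and j: "j \<in> index D" and ij: "i \<noteq> j"
    and p: "cartan i j = p" and p': "cartan j i = p'"
    and pow: "(srefl D i \<circ> srefl D j) ^^ Suc m = id"
  shows "cheb (p * p' - 2) (Suc m) * p = 0" "cheb (p * p' - 2) (Suc m) * p' = 0"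
    "- cheb (p * p' - 2) (Suc m) - cheb (p * p' - 2) m = 1"
proof -
  define c where "c = srefl D i \<circ> srefl D j"
  define T where "T = p * p' - 2"
  \<comment> \<open>The powers are followed through the functionals \<open>I\<close> and
    \<open>J\<close>: simple roots are known to be independent, whereas independence of the coroots
    is deduced only from \<open>p * p'\<close> being different from 4.\<close>
  define I where "I y = pairing D (simple_root D i) y" for y
  define J where "J y = pairing D (simple_root D j) y" for y
  have s: "I (srefl D i y) = - I y" "J (srefl D i y) = J y - p' * I y"
    "J (srefl D j y) = - J y" "I (srefl D j y) = I y - p * J y" for y
    using pairing_simple_coroot[OF i] pairing_simple_coroot[OF j] p p'
    by (simp_all add: I_def J_def srefl_eq pairing_diff_right pairing_zsmul_right)
  have c1: "I (c y) = - I y + p * J y" "J (c y) = - p' * I y + (T + 1) * J y" for y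
    by (simp_all add: c_def s T_def algebra_simps)
  have c2: "I (c (c y)) = T * I (c y) - I y" "J (c (c y)) = T * J (c y) - J y" for y
    unfolding c1 T_def by (simp_all add: algebra_simps)
  have pw: "I ((c ^^ Suc n) y) = cheb T (Suc n) * I (c y) - cheb T n * I y \<and>
      J ((c ^^ Suc n) y) = cheb T (Suc n) * J (c y) - cheb T n * J y" for n y
  proof (induction n rule: less_induct)
    case (less n)
    consider "n = 0" | "n = 1" | k where "n = Suc (Suc k)" by (cases n; cases "n - 1") auto
    then show ?case
    proof cases
      case 3
      have "(c ^^ Suc n) y = c (c ((c ^^ Suc k) y))" "(c ^^ Suc (Suc k)) y = c ((c ^^ Suc k) y)"
        by (simp_all add: 3)
      then have e: "I ((c ^^ Suc n) y) = T * I ((c ^^ Suc (Suc k)) y) - I ((c ^^ Suc k) y)"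
        "J ((c ^^ Suc n) y) = T * J ((c ^^ Suc (Suc k)) y) - J ((c ^^ Suc k) y)"
        by (simp_all only: c2)
      have IH: "I ((c ^^ Suc k) y) = cheb T (Suc k) * I (c y) - cheb T k * I y"
        "J ((c ^^ Suc k) y) = cheb T (Suc k) * J (c y) - cheb T k * J y"
        "I ((c ^^ Suc (Suc k)) y) = cheb T (Suc (Suc k)) * I (c y) - cheb T (Suc k) * I y"
        "J ((c ^^ Suc (Suc k)) y) = cheb T (Suc (Suc k)) * J (c y) - cheb T (Suc k) * J y"
        using less[of k] less[of "Suc k"] 3 by auto
      show ?thesis unfolding e IH unfolding 3 by (simp add: algebra_simps)
    qed (simp_all add: c2)
  qed
  have id: "(c ^^ Suc m) y = y" for y using pow by (simp add: c_def)
  \<comment> \<open>Perfectness of the pairing turns a vanishing combination of the functionals into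
    one of the simple roots.\<close>
  have lin: "a = 0 \<and> b = 0" if "\<And>y. a * I y + b * J y = 0" for a b
  proof -
    have "pairing D (a \<cdot> simple_root D i + b \<cdot> simple_root D j) y = pairing D 0 y" for y
      using that[of y] by (simp add: pairing_add_left pairing_zsmul_left pairing_0_left I_def J_def)
    moreover have "\<exists>!x. \<forall>y. pairing D x y = 0" by (rule perfect_left) simp
    ultimately have "a \<cdot> simple_root D i + b \<cdot> simple_root D j = 0" using pairing_0_left by metis
    then show ?thesis by (rule simple_roots_inj[OF i j ij])
  qed
  have "(- cheb T (Suc m) - cheb T m - 1) * I y + (cheb T (Suc m) * p) * J y = 0" for y
    using pw[of m y] id[of y] c1[of y] by (simp add: algebra_simps)
  from lin[OF this] show "cheb (p * p' - 2) (Suc m) * p = 0" "- cheb (p * p' - 2) (Suc m) - cheb (p * p' - 2) m = 1"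
    by (simp_all add: T_def)
  have "(- cheb T (Suc m) * p') * I y + (cheb T (Suc m) * (T + 1) - cheb T m - 1) * J y = 0" for y
    using pw[of m y] id[of y] c1[of y] by (simp add: algebra_simps)
  from lin[OF this] show "cheb (p * p' - 2) (Suc m) * p' = 0" by (simp add: T_def)
qed

end

context simple_pair begin

lemma hasmat_coxeter:
  assumes "hasmat ((srefl D i \<circ> srefl D j) ^^ n) M"
  shows "hasmat ((srefl D i \<circ> srefl D j) ^^ Suc n) (R.rmul False (R.rmul True M))"
proof -
  let ?c = "srefl D i \<circ> srefl D j"
  have "?c ^^ n \<in> carrier (weyl D)"
  proof (induction n)
    case 0
    show ?case unfolding funpow.simps by (rule id_weyl)
  next
    case (Suc n)
    then show ?case unfolding funpow.simps by (intro comp_weyl srefl_weyl i j)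
  qed
  then have "hasmat (?c ^^ n \<circ> srefl D (ix True) \<circ> srefl D (ix False)) (R.rmul False (R.rmul True M))"
    by (intro hasmat_rmul comp_weyl srefl_weyl ix_in assms)
  then show ?thesis by (simp only: ix_def if_True if_False funpow_Suc_right comp_assoc)
qed

lemma hasmat_coxeter_0: "hasmat ((srefl D i \<circ> srefl D j) ^^ 0) (1, 0, 0, 1)"
  by simp

text \<open>A converse to \<open>coxeter_power\<close>: a power with identity matrix is the identity
  by faithfulness, so known Cartan integers limit the order.\<close>

lemma coxeter_order_dvd:
  assumes "hasmat ((srefl D i \<circ> srefl D j) ^^ n) (1, 0, 0, 1)"
  shows "group.ord (weyl D) (srefl D i \<otimes>\<^bsub>weyl D\<^esub> srefl D j) dvd n"
proof -
  interpret W: group "weyl D" by (rule weyl_group)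
  let ?c = "srefl D i \<circ> srefl D j"
  have c: "?c \<in> carrier (weyl D)" by (intro comp_weyl srefl_weyl i j)
  have "?c ^^ n \<in> dihedral"
  proof (induction n)
    case 0
    show ?case unfolding funpow.simps by (rule dihedral.id)
  next
    case (Suc n)
    have "(?c ^^ n) \<circ> srefl D (ix True) \<circ> srefl D (ix False) \<in> dihedral"
      by (intro dihedral.step Suc)
    then show ?case by (simp only: ix_def if_True if_False funpow_Suc_right comp_assoc)
  qed
  then have "?c ^^ n = id" by (rule dihedral_faithful) (rule assms)
  then show ?thesis
    using W.pow_eq_id[OF c] weyl_pow[OF c] weyl_one weyl_mult[OF srefl_weyl[OF i] srefl_weyl[OF j]] by simp
qed

end

text \<open>That the power \<open>m\<close> is the identity leaves few integral values of the trace
  \<open>T\<close>. For \<open>m\<close> equal to 4 or 6 it also holds when the order is a proper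
  divisor of \<open>m\<close>; \<open>not2\<close> and \<open>not3\<close> exclude the Cartan
  integers that would give order 2 or 3.\<close>

lemma (in based_root_datum) cartan_numbers:
  assumes i: "i \<in> index D" and j: "j \<in> index D" and ij: "i \<noteq> j"
    and p: "cartan i j = p" and p': "cartan j i = p'"
    and ord: "group.ord (weyl D) (srefl D i \<otimes>\<^bsub>weyl D\<^esub> srefl D j) = m"
  shows "m = 2 \<Longrightarrow> p = 0 \<and> p' = 0" "m = 3 \<Longrightarrow> p * p' = 1" "m = 4 \<Longrightarrow> p * p' = 2" "m = 6 \<Longrightarrow> p * p' = 3"
proof -
  interpret W: group "weyl D" by (rule weyl_group)
  let ?c = "srefl D i \<circ> srefl D j"
  have c: "?c \<in> carrier (weyl D)" by (intro comp_weyl srefl_weyl i j)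
  have ce: "srefl D i \<otimes>\<^bsub>weyl D\<^esub> srefl D j = ?c" by (rule weyl_mult[OF srefl_weyl[OF i] srefl_weyl[OF j]])
  have pow: "?c ^^ m = id"
    using W.pow_ord_eq_1[OF c] weyl_pow[OF c, of m] weyl_one ord by (simp add: ce)
  define T where "T = p * p' - 2"
  have not2: "m dvd 2" if "p = 0" "p' = 0"
  proof -
    interpret P: simple_pair D i j 0 0 by unfold_locales (use i j ij p p' that in auto)
    have "P.hasmat (?c ^^ Suc (Suc 0)) (1, 0, 0, 1)"
      using P.hasmat_coxeter[OF P.hasmat_coxeter[OF P.hasmat_coxeter_0]] by (simp only: P.R.rmul.simps) simp
    from P.coxeter_order_dvd[OF this] show ?thesis using ord by (simp add: numeral_2_eq_2)
  qed
  have not3: "m dvd 3" if "p = - 1" "p' = - 1"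
  proof -
    interpret P: simple_pair D i j "- 1" "- 1" by unfold_locales (use i j ij p p' that in auto)
    have "P.hasmat (?c ^^ Suc (Suc (Suc 0))) (1, 0, 0, 1)"
      using P.hasmat_coxeter[OF P.hasmat_coxeter[OF P.hasmat_coxeter[OF P.hasmat_coxeter_0]]] by (simp only: P.R.rmul.simps) simp
    from P.coxeter_order_dvd[OF this] show ?thesis using ord by (simp add: numeral_3_eq_3)
  qed
  have ne: "p \<le> 0" "p' \<le> 0"
    using pairing_simple_nonpos[OF i j ij] pairing_simple_nonpos[OF j i] ij p p' by auto
  note cox = coxeter_power[OF i j ij p p', folded T_def]
  show "m = 2 \<Longrightarrow> p = 0 \<and> p' = 0"
  proof -
    assume "m = 2"
    then have "m = Suc (Suc 0)" by simp
    from cox[OF pow[unfolded this]] have "T * p = 0" "T * p' = 0" "T = - 2" by simp_all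
    then show ?thesis by simp
  qed
  show "m = 3 \<Longrightarrow> p * p' = 1"
  proof -
    assume "m = 3"
    then have "m = Suc (Suc (Suc 0))" by simp
    from cox[OF pow[unfolded this]] have 1: "(T * T - 1) * p = 0" "T * (T + 1) = 0"
      by (simp_all add: algebra_simps)
    then consider "T = 0" | "T = - 1" by fastforce
    then show ?thesis
    proof cases
      case 1
      then show ?thesis using \<open>(T * T - 1) * p = 0\<close> by (simp add: T_def)
    qed (simp add: T_def)
  qed
  \<comment> \<open>The Chebyshev values for exponents 4 and 6 contain the factors
    \<open>T * T - 2\<close> and \<open>T * T - 3\<close>, which have no integral root.\<close>
  have sq: "T * T \<noteq> 2" "T * T \<noteq> 3"
  proof -
    have "T * T \<le> 1 \<or> T * T \<ge> 4"
    proof (cases "\<bar>T\<bar> \<le> 1")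
      case True
      then have "T = 0 \<or> T = 1 \<or> T = - 1" by linarith
      then show ?thesis by auto
    next
      case False
      then have "2 * 2 \<le> \<bar>T\<bar> * \<bar>T\<bar>" by (intro mult_mono) auto
      then show ?thesis by simp
    qed
    then show "T * T \<noteq> 2" "T * T \<noteq> 3" by auto
  qed
  show "m = 4 \<Longrightarrow> p * p' = 2"
  proof -
    assume m: "m = 4"
    then have "m = Suc (Suc (Suc (Suc 0)))" by simp
    note 1 = cox[OF pow[unfolded this]]
    have "cheb T (Suc (Suc (Suc (Suc 0)))) = T * (T * T - 2)" by (simp add: algebra_simps)
    note 1 = 1[unfolded this]
    have "\<not> (p = 0 \<and> p' = 0)" using not2 m by auto
    then have "T = 0" using 1(1,2) sq by auto
    then show ?thesis by (simp add: T_def)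
  qed
  show "m = 6 \<Longrightarrow> p * p' = 3"
  proof -
    assume m: "m = 6"
    then have "m = Suc (Suc (Suc (Suc (Suc (Suc 0)))))" by simp
    note 1 = cox[OF pow[unfolded this]]
    have "cheb T (Suc (Suc (Suc (Suc (Suc (Suc 0)))))) = T * (T * T - 1) * (T * T - 3)"
      "cheb T (Suc (Suc (Suc (Suc (Suc 0))))) = T * T * T * T - 3 * T * T + 1"
      by (simp_all add: algebra_simps)
    note 1 = 1[unfolded this]
    have "\<not> (p = 0 \<and> p' = 0)" using not2 m by auto
    then have "T * (T * T - 1) = 0" using 1(1,2) sq by auto
    \<comment> \<open>For \<open>T = 0\<close> the third relation of \<open>coxeter_power\<close>
      would read \<open>- 1 = 1\<close>.\<close>
    moreover have "T \<noteq> 0" using 1(3) by auto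
    ultimately have "(T - 1) * (T + 1) = 0" by (simp add: algebra_simps)
    moreover have "T \<noteq> - 1"
    proof
      assume "T = - 1"
      then have pp: "p * p' = 1" by (simp add: T_def)
      then have "p = - 1 \<and> p' = - 1" using ne by (auto simp: zmult_eq_1_iff)
      then show False using not3 m by auto
    qed
    ultimately show ?thesis by (simp add: T_def)
  qed
qed

theorem corollary4p3:
  fixes D :: "('x::lattice_group, 'y::lattice_group, 'i) root_data"
  assumes "based_root_datum D"
  shows
    "(\<forall>i\<in>index D. \<forall>x. Rmat D i x \<otimes>\<^bsub>QW D\<^esub> Rmat D i (- x) = \<one>\<^bsub>QW D\<^esub>) \<and>
     (\<forall>i\<in>index D. \<forall>j\<in>index D. i \<noteq> j \<longrightarrow>
         group.ord (weyl D) (srefl D i \<otimes>\<^bsub>weyl D\<^esub> srefl D j) = 2 \<longrightarrow>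
         (\<forall>x y. Rmat D i x \<otimes>\<^bsub>QW D\<^esub> Rmat D j y = Rmat D j y \<otimes>\<^bsub>QW D\<^esub> Rmat D i x)) \<and>
     (\<forall>i\<in>index D. \<forall>j\<in>index D. i \<noteq> j \<longrightarrow>
         group.ord (weyl D) (srefl D i \<otimes>\<^bsub>weyl D\<^esub> srefl D j) = 3 \<longrightarrow>
         (\<forall>x y. Rmat D i x \<otimes>\<^bsub>QW D\<^esub> Rmat D j (x + y) \<otimes>\<^bsub>QW D\<^esub> Rmat D i y
              = Rmat D j y \<otimes>\<^bsub>QW D\<^esub> Rmat D i (x + y) \<otimes>\<^bsub>QW D\<^esub> Rmat D j x)) \<and>
     (\<forall>i\<in>index D. \<forall>j\<in>index D. i \<noteq> j \<longrightarrow>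
         group.ord (weyl D) (srefl D i \<otimes>\<^bsub>weyl D\<^esub> srefl D j) = 4 \<longrightarrow>
         longer D (simple_root D i) (simple_root D j) \<longrightarrow>
         (\<forall>x y. Rmat D i x \<otimes>\<^bsub>QW D\<^esub> Rmat D j (x + y)
                  \<otimes>\<^bsub>QW D\<^esub> Rmat D i (x + 2 \<cdot> y) \<otimes>\<^bsub>QW D\<^esub> Rmat D j y
              = Rmat D j y \<otimes>\<^bsub>QW D\<^esub> Rmat D i (x + 2 \<cdot> y)
                  \<otimes>\<^bsub>QW D\<^esub> Rmat D j (x + y) \<otimes>\<^bsub>QW D\<^esub> Rmat D i x)) \<and>
     (\<forall>i\<in>index D. \<forall>j\<in>index D. i \<noteq> j \<longrightarrow>
         group.ord (weyl D) (srefl D i \<otimes>\<^bsub>weyl D\<^esub> srefl D j) = 6 \<longrightarrow>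
         longer D (simple_root D i) (simple_root D j) \<longrightarrow>
         (\<forall>x y. Rmat D i x \<otimes>\<^bsub>QW D\<^esub> Rmat D j (x + y)
                  \<otimes>\<^bsub>QW D\<^esub> Rmat D i (2 \<cdot> x + 3 \<cdot> y) \<otimes>\<^bsub>QW D\<^esub> Rmat D j (x + 2 \<cdot> y)
                  \<otimes>\<^bsub>QW D\<^esub> Rmat D i (x + 3 \<cdot> y) \<otimes>\<^bsub>QW D\<^esub> Rmat D j y
              = Rmat D j y \<otimes>\<^bsub>QW D\<^esub> Rmat D i (x + 3 \<cdot> y)
                  \<otimes>\<^bsub>QW D\<^esub> Rmat D j (x + 2 \<cdot> y) \<otimes>\<^bsub>QW D\<^esub> Rmat D i (2 \<cdot> x + 3 \<cdot> y)
                  \<otimes>\<^bsub>QW D\<^esub> Rmat D j (x + y) \<otimes>\<^bsub>QW D\<^esub> Rmat D i x))"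
proof -
  interpret based_root_datum D by fact
  have pair: "simple_pair D i j (cartan i j) (cartan j i)" if "i \<in> index D" "j \<in> index D" "i \<noteq> j" "cartan i j * cartan j i \<noteq> 4" for i j
    by unfold_locales (use that in auto)
  have neg: "cartan i j \<le> 0" if "i \<in> index D" "j \<in> index D" "i \<noteq> j" for i j
    by (rule pairing_simple_nonpos) (use that in auto)
  have A1A1: "simple_pair D i j 0 0"
    if ij: "i \<in> index D" "j \<in> index D" "i \<noteq> j" and ord: "group.ord (weyl D) (srefl D i \<otimes>\<^bsub>weyl D\<^esub> srefl D j) = 2" for i j
  proof -
    have pp: "cartan i j = 0 \<and> cartan j i = 0" using cartan_numbers(1)[OF ij refl refl ord] by simp
    then have "cartan i j * cartan j i \<noteq> 4" by simp
    from pair[OF ij this] pp show ?thesis by simp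
  qed
  have A2: "simple_pair D i j (- 1) (- 1)"
    if ij: "i \<in> index D" "j \<in> index D" "i \<noteq> j" and ord: "group.ord (weyl D) (srefl D i \<otimes>\<^bsub>weyl D\<^esub> srefl D j) = 3" for i j
  proof -
    have pp: "cartan i j * cartan j i = 1" using cartan_numbers(2)[OF ij refl refl ord] by simp
    then have "cartan i j * cartan j i \<noteq> 4" by simp
    moreover have "cartan i j = - 1" "cartan j i = - 1"
      using pp neg[OF ij] by (auto simp: zmult_eq_1_iff)
    ultimately show ?thesis using pair[OF ij] by simp
  qed
  have small: "a = - int n \<and> b = - 1" if "a * b = int n" "a \<le> 0" "b \<le> 0" "a < b" "n = 2 \<or> n = 3" for a b :: int and n
  proof -
    have nz: "a < 0" "b < 0" using that by (cases "a = 0"; cases "b = 0"; auto)+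
    have "b = - 1"
    proof (rule ccontr)
      assume "b \<noteq> - 1"
      \<comment> \<open>Here \<open>b\<close> is at most \<open>- 2\<close>, hence \<open>a\<close>
        at most \<open>- 3\<close>, and the product would be at least 6.\<close>
      then have "2 * 3 \<le> (- b) * (- a)" using nz that by (intro mult_mono) auto
      then show False using that by (auto simp: mult.commute)
    qed
    then show ?thesis using that by auto
  qed
  have long: "cartan i j < cartan j i" if ij: "i \<in> index D" "j \<in> index D" "i \<noteq> j" and "longer D (simple_root D i) (simple_root D j)"
    and "cartan i j * cartan j i > 0" for i j
  proof (rule longer_pairing)
    have "cartan i j \<noteq> 0" "cartan j i \<noteq> 0" using that(5) by auto
    then show "cartan i j < 0" "cartan j i < 0" using neg[OF ij] neg[OF ij(2,1)] ij(3) by auto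
  qed (use that in auto)
  have B2: "simple_pair D i j (- 2) (- 1)"
    if ij: "i \<in> index D" "j \<in> index D" "i \<noteq> j" and ord: "group.ord (weyl D) (srefl D i \<otimes>\<^bsub>weyl D\<^esub> srefl D j) = 4"
      and l: "longer D (simple_root D i) (simple_root D j)" for i j
  proof -
    have pp: "cartan i j * cartan j i = 2" using cartan_numbers(3)[OF ij refl refl ord] by simp
    then have 4: "cartan i j * cartan j i \<noteq> 4" by simp
    have "cartan i j = - 2 \<and> cartan j i = - 1"
      using small[of "cartan i j" "cartan j i" 2] pp neg[OF ij] neg[OF ij(2,1)] ij(3) long[OF ij l] by simp
    then show ?thesis using pair[OF ij 4] by simp
  qed
  have G2: "simple_pair D i j (- 3) (- 1)"
    if ij: "i \<in> index D" "j \<in> index D" "i \<noteq> j" and ord: "group.ord (weyl D) (srefl D i \<otimes>\<^bsub>weyl D\<^esub> srefl D j) = 6"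
      and l: "longer D (simple_root D i) (simple_root D j)" for i j
  proof -
    have pp: "cartan i j * cartan j i = 3" using cartan_numbers(4)[OF ij refl refl ord] by simp
    then have 4: "cartan i j * cartan j i \<noteq> 4" by simp
    have "cartan i j = - 3 \<and> cartan j i = - 1"
      using small[of "cartan i j" "cartan j i" 3] pp neg[OF ij] neg[OF ij(2,1)] ij(3) long[OF ij l] by simp
    then show ?thesis using pair[OF ij 4] by simp
  qed
  show ?thesis
    using Rmat_unitary simple_pair.yang_baxter_A1A1[OF A1A1 refl refl] simple_pair.yang_baxter_A2[OF A2 refl refl]
      simple_pair.yang_baxter_B2[OF B2 refl refl] simple_pair.yang_baxter_G2[OF G2 refl refl] by blast
qed

end
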